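(* Let $p$ be a prime, let $D$ be a finite dimensional noncommutative division $\mathbb{Q}_p$-algebra whose center is $\mathbb{Q}_p$, and let $G$ be an open subgroup of $SL_1(D)$. Then $G$ is not self-similar.
   Context: $SL_1(D)$ denotes the group of elements of $D$ of reduced norm $1$; it is a compact $p$-adic analytic group with the topology induced from $D$. Self-similar groups: let $d\geq 1$ be an integer. A group $G$ is self-similar of index $d$ if $G$ admits a faithful self-similar action on a regular rooted $d$-ary tree such that the action is transitive on the first level. (Identifying the tree with the set $X^*$ of finite words over an alphabet $X$ of size $d$, an action is self-similar if for all $g\in G$ and $x\in X$ there are $h\in G$ and $y\in X$ with $g(xw)=y\,h(w)$ for all $w\in X^*$.) Equivalently (a known fact), $G$ admits a simple virtual endomorphism of index $d$, where: a virtual endomorphism of $G$ of index $d$ is a group homomorphism $\varphi:H\to G$ with $H\leq G$ a subgroup of index $d$; it is simple if there is no nontrivial normal subgroup $N$ of $G$ with $N\subseteq H$ and $\varphi(N)\subseteq N$. A group is self-similar if it is self-similar of index $d$ for some integer $d\geq 1$. *)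

theory Defs
  imports
    "HOL-Analysis.Function_Topology"
    "HOL-Algebra.Group_Action"
    "HOL-Algebra.Algebraic_Closure_Type"
    "Berlekamp_Zassenhaus.Finite_Field"
    "Jordan_Normal_Form.Determinant"
begin

section \<open>The \<open>p\<close>-adic absolute value on the rationals\<close>

definition padic_abs :: "nat \<Rightarrow> rat \<Rightarrow> real" where
  "padic_abs p x = (if x = 0 then 0 else
     real p powi (int (multiplicity (int p) (snd (quotient_of x))) -
                  int (multiplicity (int p) (fst (quotient_of x)))))"

lemma padic_abs_0 [simp]: "padic_abs p 0 = 0"
  by (simp add: padic_abs_def)

context
  fixes p :: nat
  assumes p: "prime p"
begin

private lemma p_int: "prime_elem (int p)"
  using p by simp

private lemma p_gt1: "real p > 1"
  using prime_gt_1_nat[OF p] by simp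

lemma padic_abs_frac:
  assumes "a \<noteq> 0" "b \<noteq> 0"
  shows "padic_abs p (of_int a / of_int b) =
           real p powi (int (multiplicity (int p) b) - int (multiplicity (int p) a))"
proof -
  obtain n d where q: "quotient_of (of_int a / of_int b) = (n, d)"
    by (cases "quotient_of (of_int a / of_int b)") auto
  have d: "d > 0" using quotient_of_denom_pos[OF q] .
  have "of_int a / of_int b = (of_int n / of_int d :: rat)"
    using quotient_of_div[OF q] .
  hence "of_int (a * d) = (of_int (n * b) :: rat)"
    using assms d by (simp add: field_simps)
  hence eq: "a * d = n * b" by (simp only: of_int_eq_iff)
  have n: "n \<noteq> 0" using eq assms d by auto
  have "multiplicity (int p) a + multiplicity (int p) d = multiplicity (int p) n + multiplicity (int p) b"
    using arg_cong[OF eq, of "multiplicity (int p)"] assms d n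
    by (simp add: prime_elem_multiplicity_mult_distrib[OF p_int])
  hence "int (multiplicity (int p) d) - int (multiplicity (int p) n) =
         int (multiplicity (int p) b) - int (multiplicity (int p) a)" by linarith
  thus ?thesis using assms by (simp add: padic_abs_def q)
qed

lemma padic_abs_pos: "x \<noteq> 0 \<Longrightarrow> padic_abs p x > 0"
  using p_gt1 by (simp add: padic_abs_def zero_less_power_int)

lemma padic_abs_ge0 [simp]: "padic_abs p x \<ge> 0"
  using padic_abs_pos[of x] by (cases "x = 0") auto

lemma padic_abs_eq0_iff [simp]: "padic_abs p x = 0 \<longleftrightarrow> x = 0"
  using padic_abs_pos[of x] by (cases "x = 0") auto

private lemma rat_frac: "\<exists>a b. b \<noteq> 0 \<and> (x::rat) = of_int a / of_int b"
proof -
  obtain n d where q: "quotient_of x = (n, d)" by (cases "quotient_of x") auto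
  show ?thesis using quotient_of_denom_pos[OF q] quotient_of_div[OF q] by (metis less_irrefl)
qed

lemma padic_abs_mult: "padic_abs p (x * y) = padic_abs p x * padic_abs p y"
proof (cases "x = 0 \<or> y = 0")
  case False
  obtain a b c d where *: "b \<noteq> 0" "x = of_int a / of_int b" "d \<noteq> 0" "y = of_int c / of_int d"
    using rat_frac[of x] rat_frac[of y] by blast
  with False have nz: "a \<noteq> 0" "c \<noteq> 0" by auto
  have "x * y = of_int (a * c) / of_int (b * d)" using * by simp
  hence "padic_abs p (x * y) = real p powi (int (multiplicity (int p) (b * d)) - int (multiplicity (int p) (a * c)))"
    using * nz by (simp only: padic_abs_frac mult_eq_0_iff simp_thms not_False_eq_True)
  also have "\<dots> = real p powi ((int (multiplicity (int p) b) - int (multiplicity (int p) a)) +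
                (int (multiplicity (int p) d) - int (multiplicity (int p) c)))"
    using * nz by (simp add: prime_elem_multiplicity_mult_distrib[OF p_int] algebra_simps)
  also have "\<dots> = padic_abs p x * padic_abs p y"
    using * nz p_gt1 by (simp add: padic_abs_frac power_int_add)
  finally show ?thesis .
qed auto

lemma padic_abs_1 [simp]: "padic_abs p 1 = 1"
  using padic_abs_frac[of 1 1] by simp

lemma padic_abs_minus [simp]: "padic_abs p (- x) = padic_abs p x"
proof -
  have "padic_abs p (-1) = 1" using padic_abs_frac[of "-1" 1] by simp
  thus ?thesis using padic_abs_mult[of "-1" x] by simp
qed

lemma padic_abs_minus_commute: "padic_abs p (x - y) = padic_abs p (y - x)"
  using padic_abs_minus[of "x - y"] by simp

lemma padic_abs_inverse: "padic_abs p (inverse x) = inverse (padic_abs p x)"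
proof (cases "x = 0")
  case False
  hence "padic_abs p x * padic_abs p (inverse x) = 1"
    by (simp flip: padic_abs_mult)
  thus ?thesis by (metis inverse_unique)
qed auto

lemma padic_abs_ultra: "padic_abs p (x + y) \<le> max (padic_abs p x) (padic_abs p y)"
proof (cases "x = 0 \<or> y = 0 \<or> x + y = 0")
  case True
  thus ?thesis by (auto simp: le_max_iff_disj)
next
  case False
  obtain a b c d where *: "b \<noteq> 0" "x = of_int a / of_int b" "d \<noteq> 0" "y = of_int c / of_int d"
    using rat_frac[of x] rat_frac[of y] by blast
  define m where "m = b * d"
  define r where "r = a * d"
  define s where "s = c * b"
  have m: "m \<noteq> 0" using * by (simp add: m_def)
  have x: "x = of_int r / of_int m" and y: "y = of_int s / of_int m"
    using * by (simp_all add: m_def r_def s_def)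
  have xy: "x + y = of_int (r + s) / of_int m" using x y by (simp add: add_divide_distrib)
  have nz: "r \<noteq> 0" "s \<noteq> 0" "r + s \<noteq> 0" using False x y xy by auto
  have vx: "padic_abs p x = real p powi (int (multiplicity (int p) m) - int (multiplicity (int p) r))"
    and vy: "padic_abs p y = real p powi (int (multiplicity (int p) m) - int (multiplicity (int p) s))"
    and vxy: "padic_abs p (x + y) = real p powi (int (multiplicity (int p) m) - int (multiplicity (int p) (r + s)))"
    unfolding xy unfolding x y using nz m by (simp_all only: padic_abs_frac not_False_eq_True)
  define k where "k = min (multiplicity (int p) r) (multiplicity (int p) s)"
  have "int p ^ k dvd r + s"
    by (intro dvd_add; rule multiplicity_dvd'; simp add: k_def)
  hence k: "k \<le> multiplicity (int p) (r + s)"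
    using nz p_int by (intro multiplicity_geI) (auto simp: prime_elem_def)
  have mono: "real p powi (M - int v) \<le> real p powi (M - int u)" if "u \<le> v" for u v M
    using that p_gt1 by (intro power_int_increasing) auto
  show ?thesis
  proof (cases "multiplicity (int p) r \<le> multiplicity (int p) s")
    case True
    hence "padic_abs p (x + y) \<le> padic_abs p x"
      unfolding vxy vx using k by (intro mono) (simp add: k_def)
    thus ?thesis by simp
  next
    case False
    hence "padic_abs p (x + y) \<le> padic_abs p y"
      unfolding vxy vy using k by (intro mono) (simp add: k_def)
    thus ?thesis by simp
  qed
qed

lemma padic_abs_triangle: "padic_abs p (x + y) \<le> padic_abs p x + padic_abs p y"
  using padic_abs_ultra[of x y] padic_abs_ge0[of x] padic_abs_ge0[of y] by linarith

lemma padic_abs_triangle3: "\<bar>padic_abs p x - padic_abs p y\<bar> \<le> padic_abs p (x - y)"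
  using padic_abs_triangle[of "x - y" y] padic_abs_triangle[of "y - x" x]
    padic_abs_minus_commute[of x y] by auto

end


section \<open>The field of \<open>p\<close>-adic numbers\<close>

definition padic_Cauchy :: "nat \<Rightarrow> (nat \<Rightarrow> rat) \<Rightarrow> bool" where
  "padic_Cauchy p s \<longleftrightarrow> (\<forall>e>0. \<exists>N. \<forall>m\<ge>N. \<forall>n\<ge>N. padic_abs p (s m - s n) < e)"

definition padic_null :: "nat \<Rightarrow> (nat \<Rightarrow> rat) \<Rightarrow> bool" where
  "padic_null p s \<longleftrightarrow> (\<lambda>n. padic_abs p (s n)) \<longlonglongrightarrow> 0"

context
  fixes p :: nat
  assumes p: "prime p"
begin

lemma padic_CauchyD_real: "padic_Cauchy p s \<Longrightarrow> Cauchy (\<lambda>n. padic_abs p (s n))"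
  unfolding Cauchy_def padic_Cauchy_def dist_real_def
  by (meson le_less_trans padic_abs_triangle3[OF p])

lemma padic_Cauchy_convergent: "padic_Cauchy p s \<Longrightarrow> convergent (\<lambda>n. padic_abs p (s n))"
  using padic_CauchyD_real by (simp add: Cauchy_convergent_iff)

lemma padic_Cauchy_bound:
  assumes "padic_Cauchy p s"
  obtains B where "B > 0" "\<And>n. padic_abs p (s n) < B"
proof -
  have "Bseq (\<lambda>n. padic_abs p (s n))"
    using padic_CauchyD_real[OF assms] by (rule Cauchy_Bseq)
  then obtain K where K: "K > 0" "\<And>n. norm (padic_abs p (s n)) \<le> K"
    by (auto simp: Bseq_def)
  show ?thesis
  proof (rule that[of "K + 1"])
    show "padic_abs p (s n) < K + 1" for n using K(2)[of n] by simp
  qed (use K in simp)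
qed

lemma padic_Cauchy_const [simp]: "padic_Cauchy p (\<lambda>_. c)"
  by (simp add: padic_Cauchy_def)

lemma padic_Cauchy_minus: "padic_Cauchy p s \<Longrightarrow> padic_Cauchy p (\<lambda>n. - s n)"
  unfolding padic_Cauchy_def using padic_abs_minus_commute[OF p]
  by (simp add: minus_diff_commute)

lemma padic_Cauchy_add:
  assumes "padic_Cauchy p s" "padic_Cauchy p t"
  shows "padic_Cauchy p (\<lambda>n. s n + t n)"
  unfolding padic_Cauchy_def
proof (intro allI impI)
  fix e :: real assume e: "e > 0"
  obtain M where M: "\<And>m n. m \<ge> M \<Longrightarrow> n \<ge> M \<Longrightarrow> padic_abs p (s m - s n) < e"
    using assms(1) e unfolding padic_Cauchy_def by meson
  obtain N where N: "\<And>m n. m \<ge> N \<Longrightarrow> n \<ge> N \<Longrightarrow> padic_abs p (t m - t n) < e"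
    using assms(2) e unfolding padic_Cauchy_def by meson
  have "padic_abs p (s m + t m - (s n + t n)) < e" if "m \<ge> max M N" "n \<ge> max M N" for m n
    using padic_abs_ultra[OF p, of "s m - s n" "t m - t n"] M[of m n] N[of m n] that
    by (simp add: algebra_simps)
  thus "\<exists>N. \<forall>m\<ge>N. \<forall>n\<ge>N. padic_abs p (s m + t m - (s n + t n)) < e" by blast
qed

lemma padic_Cauchy_diff:
  "padic_Cauchy p s \<Longrightarrow> padic_Cauchy p t \<Longrightarrow> padic_Cauchy p (\<lambda>n. s n - t n)"
  using padic_Cauchy_add[OF _ padic_Cauchy_minus, of s t] by simp

lemma padic_Cauchy_mult:
  assumes "padic_Cauchy p s" "padic_Cauchy p t"
  shows "padic_Cauchy p (\<lambda>n. s n * t n)"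
  unfolding padic_Cauchy_def
proof (intro allI impI)
  fix e :: real assume e: "e > 0"
  obtain A where A: "A > 0" "\<And>n. padic_abs p (s n) < A" using padic_Cauchy_bound[OF assms(1)] by blast
  obtain B where B: "B > 0" "\<And>n. padic_abs p (t n) < B" using padic_Cauchy_bound[OF assms(2)] by blast
  obtain M where M: "\<And>m n. m \<ge> M \<Longrightarrow> n \<ge> M \<Longrightarrow> padic_abs p (s m - s n) < e / B"
    using assms(1) e B unfolding padic_Cauchy_def by (meson divide_pos_pos)
  obtain N where N: "\<And>m n. m \<ge> N \<Longrightarrow> n \<ge> N \<Longrightarrow> padic_abs p (t m - t n) < e / A"
    using assms(2) e A unfolding padic_Cauchy_def by (meson divide_pos_pos)
  have "padic_abs p (s m * t m - s n * t n) < e" if "m \<ge> max M N" "n \<ge> max M N" for m n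
  proof -
    have "s m * t m - s n * t n = s m * (t m - t n) + (s m - s n) * t n"
      by (simp add: algebra_simps)
    moreover have "padic_abs p (s m) * padic_abs p (t m - t n) < A * (e / A)"
      using A N[of m n] that padic_abs_ge0[OF p] by (intro mult_strict_mono') auto
    moreover have "padic_abs p (s m - s n) * padic_abs p (t n) < e / B * B"
      using B M[of m n] that padic_abs_ge0[OF p] by (intro mult_strict_mono') auto
    ultimately show ?thesis
      using padic_abs_ultra[OF p, of "s m * (t m - t n)" "(s m - s n) * t n"] A B
      by (simp add: padic_abs_mult[OF p])
  qed
  thus "\<exists>N. \<forall>m\<ge>N. \<forall>n\<ge>N. padic_abs p (s m * t m - s n * t n) < e" by blast
qed

lemma padic_null_const_iff [simp]: "padic_null p (\<lambda>_. c) \<longleftrightarrow> c = 0"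
  by (simp add: padic_null_def LIMSEQ_const_iff p)

lemma padic_null_minus: "padic_null p s \<Longrightarrow> padic_null p (\<lambda>n. - s n)"
  by (simp add: padic_null_def padic_abs_minus[OF p])

lemma padic_null_add:
  assumes "padic_null p s" "padic_null p t" shows "padic_null p (\<lambda>n. s n + t n)"
  unfolding padic_null_def
proof (rule tendsto_sandwich[OF _ _ tendsto_const])
  show "(\<lambda>n. padic_abs p (s n) + padic_abs p (t n)) \<longlonglongrightarrow> 0"
    using tendsto_add[OF assms[unfolded padic_null_def]] by simp
qed (auto simp: padic_abs_triangle[OF p] padic_abs_ge0[OF p])

lemma padic_null_diff:
  "padic_null p s \<Longrightarrow> padic_null p t \<Longrightarrow> padic_null p (\<lambda>n. s n - t n)"
  using padic_null_add[OF _ padic_null_minus, of s t] by simp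

lemma padic_null_mult:
  assumes "padic_Cauchy p s" "padic_null p t" shows "padic_null p (\<lambda>n. s n * t n)"
proof -
  obtain A where A: "A > 0" "\<And>n. padic_abs p (s n) < A" using padic_Cauchy_bound[OF assms(1)] by blast
  show ?thesis unfolding padic_null_def
  proof (rule tendsto_sandwich[OF _ _ tendsto_const])
    show "(\<lambda>n. A * padic_abs p (t n)) \<longlonglongrightarrow> 0"
      using tendsto_mult_left[OF assms(2)[unfolded padic_null_def], of A] by simp
    show "\<forall>\<^sub>F n in sequentially. padic_abs p (s n * t n) \<le> A * padic_abs p (t n)"
      using A(2) by (intro always_eventually allI)
        (simp add: padic_abs_mult[OF p] mult_right_mono less_imp_le padic_abs_ge0[OF p])
  qed (auto simp: padic_abs_ge0[OF p])
qed

text \<open>A Cauchy sequence that is not null is eventually bounded away from zero.\<close>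

lemma padic_not_null_bound:
  assumes "padic_Cauchy p s" "\<not> padic_null p s"
  obtains b N where "b > 0" "\<And>n. n \<ge> N \<Longrightarrow> padic_abs p (s n) > b"
proof -
  obtain l where l: "(\<lambda>n. padic_abs p (s n)) \<longlonglongrightarrow> l"
    using padic_Cauchy_convergent[OF assms(1)] by (auto simp: convergent_def)
  have "l \<ge> 0" using l by (rule LIMSEQ_le_const) (simp add: padic_abs_ge0[OF p])
  moreover have "l \<noteq> 0" using l assms(2) by (auto simp: padic_null_def)
  ultimately have "l / 2 < l" "l / 2 > 0" by auto
  from order_tendstoD(1)[OF l this(1)] obtain N where "\<And>n. n \<ge> N \<Longrightarrow> padic_abs p (s n) > l / 2"
    by (auto simp: eventually_sequentially)
  thus ?thesis using that \<open>l / 2 > 0\<close> by blast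
qed

lemma padic_Cauchy_inverse:
  assumes "padic_Cauchy p s" "\<not> padic_null p s"
  shows "padic_Cauchy p (\<lambda>n. inverse (s n))"
  unfolding padic_Cauchy_def
proof (intro allI impI)
  fix e :: real assume e: "e > 0"
  obtain b M where b: "b > 0" "\<And>n. n \<ge> M \<Longrightarrow> padic_abs p (s n) > b"
    using padic_not_null_bound[OF assms] by blast
  have "e * (b * b) > 0" using e b by simp
  then obtain N where N: "\<And>m n. m \<ge> N \<Longrightarrow> n \<ge> N \<Longrightarrow> padic_abs p (s m - s n) < e * (b * b)"
    using assms(1) unfolding padic_Cauchy_def by meson
  have "padic_abs p (inverse (s m) - inverse (s n)) < e" if "m \<ge> max M N" "n \<ge> max M N" for m n
  proof -
    have s: "padic_abs p (s m) > b" "padic_abs p (s n) > b" using b that by auto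
    hence nz: "s m \<noteq> 0" "s n \<noteq> 0" using b by auto
    have "inverse (s m) - inverse (s n) = (s n - s m) * inverse (s m * s n)"
      using nz by (simp add: field_simps)
    hence "padic_abs p (inverse (s m) - inverse (s n)) =
           padic_abs p (s m - s n) / (padic_abs p (s m) * padic_abs p (s n))"
      by (simp add: padic_abs_mult[OF p] padic_abs_inverse[OF p] padic_abs_minus_commute[OF p, of "s n"]
            divide_inverse del: inverse_mult_distrib)
    also have "\<dots> < e"
    proof -
      have bb: "b * b < padic_abs p (s m) * padic_abs p (s n)"
        using s b by (intro mult_strict_mono') auto
      have "padic_abs p (s m - s n) < e * (b * b)" using N that by auto
      also have "\<dots> \<le> e * (padic_abs p (s m) * padic_abs p (s n))"
        using bb e by (intro mult_left_mono) auto
      finally show ?thesis using bb b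
        by (subst pos_divide_less_eq) (auto intro: less_trans[OF mult_pos_pos[OF b(1) b(1)]])
    qed
    finally show ?thesis .
  qed
  thus "\<exists>N. \<forall>m\<ge>N. \<forall>n\<ge>N. padic_abs p (inverse (s m) - inverse (s n)) < e" by blast
qed

end

definition padic_rel :: "'p::prime_card itself \<Rightarrow> (nat \<Rightarrow> rat) \<Rightarrow> (nat \<Rightarrow> rat) \<Rightarrow> bool" where
  "padic_rel _ s t \<longleftrightarrow> padic_Cauchy CARD('p) s \<and> padic_Cauchy CARD('p) t \<and>
                        padic_null CARD('p) (\<lambda>n. s n - t n)"

lemma part_equivp_padic_rel: "part_equivp (padic_rel TYPE('p::prime_card))"
proof (rule part_equivpI)
  show "\<exists>s. padic_rel TYPE('p) s s"
    by (rule exI[of _ "\<lambda>_. 0"]) (simp add: padic_rel_def prime_card)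
  show "symp (padic_rel TYPE('p))"
    using padic_null_minus[OF prime_card[where ?'a = 'p]]
    by (fastforce intro!: sympI simp: padic_rel_def)
  show "transp (padic_rel TYPE('p))"
  proof (rule transpI)
    fix s t u assume "padic_rel TYPE('p) s t" "padic_rel TYPE('p) t u"
    thus "padic_rel TYPE('p) s u"
      using padic_null_add[OF prime_card[where ?'a = 'p], of "\<lambda>n. s n - t n" "\<lambda>n. t n - u n"]
      by (auto simp: padic_rel_def)
  qed
qed

text \<open>
  The completion of the rationals for the \<open>p\<close>-adic absolute value: Cauchy sequences modulo null
  sequences. The prime is carried by the type argument: \<open>p = CARD('p)\<close>.
\<close>

typedef (overloaded) ('p::prime_card) padic =
  "{c. \<exists>s. padic_rel TYPE('p) s s \<and> c = {t. padic_rel TYPE('p) s t}}"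
  by (rule part_equivp_typedef[OF part_equivp_padic_rel])

definition abs_padic :: "(nat \<Rightarrow> rat) \<Rightarrow> 'p::prime_card padic" where
  "abs_padic s = Abs_padic {t. padic_rel TYPE('p) s t}"

definition rep_padic :: "'p::prime_card padic \<Rightarrow> nat \<Rightarrow> rat" where
  "rep_padic x = (SOME s. s \<in> Rep_padic x)"

definition cr_padic :: "(nat \<Rightarrow> rat) \<Rightarrow> 'p::prime_card padic \<Rightarrow> bool" where
  "cr_padic s x \<longleftrightarrow> padic_rel TYPE('p) s s \<and> abs_padic s = x"

lemma Quotient_padic:
  "Quotient (padic_rel TYPE('p::prime_card)) (abs_padic :: _ \<Rightarrow> 'p padic) rep_padic cr_padic"
proof -
  have qt: "quot_type (padic_rel TYPE('p)) Abs_padic (Rep_padic :: 'p padic \<Rightarrow> _)"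
  proof (rule quot_type.intro)
    show "part_equivp (padic_rel TYPE('p))" by (rule part_equivp_padic_rel)
    show "\<exists>s. padic_rel TYPE('p) s s \<and> Rep_padic x = Collect (padic_rel TYPE('p) s)" for x :: "'p padic"
      using Rep_padic[of x] by simp
    show "Abs_padic (Rep_padic x) = x" for x :: "'p padic" by (rule Rep_padic_inverse)
    show "Rep_padic (Abs_padic c :: 'p padic) = c"
      if "\<exists>s. padic_rel TYPE('p) s s \<and> c = Collect (padic_rel TYPE('p) s)" for c
      using that by (intro Abs_padic_inverse) simp
    show "(Rep_padic x = Rep_padic y) = (x = y)" for x y :: "'p padic" by (rule Rep_padic_inject)
  qed
  have "quot_type.abs (padic_rel TYPE('p)) Abs_padic = (abs_padic :: _ \<Rightarrow> 'p padic)"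
    by (auto simp: fun_eq_iff quot_type.abs_def[OF qt] abs_padic_def)
  moreover have "quot_type.rep Rep_padic = (rep_padic :: 'p padic \<Rightarrow> _)"
    by (auto simp: fun_eq_iff quot_type.rep_def[OF qt] rep_padic_def)
  ultimately have q: "Quotient3 (padic_rel TYPE('p)) (abs_padic :: _ \<Rightarrow> 'p padic) rep_padic"
    using quot_type.Quotient[OF qt] by simp
  have "cr_padic \<equiv> \<lambda>s (x :: 'p padic). padic_rel TYPE('p) s s \<and> abs_padic s = x"
    by (rule eq_reflection) (simp add: fun_eq_iff cr_padic_def)
  from Quotient3_to_Quotient[OF q this] show ?thesis .
qed

lemma padic_cases:
  fixes x :: "'p::prime_card padic"
  obtains s where "padic_Cauchy CARD('p) s" "x = abs_padic s"
  using Quotient_abs_rep[OF Quotient_padic, of x] Quotient_rep_reflp[OF Quotient_padic, of x]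
  by (metis padic_rel_def)

lemma abs_padic_eq_iff:
  "padic_Cauchy CARD('p::prime_card) s \<Longrightarrow> padic_Cauchy CARD('p) t \<Longrightarrow>
    (abs_padic s = (abs_padic t :: 'p padic)) \<longleftrightarrow> padic_null CARD('p) (\<lambda>n. s n - t n)"
  using Quotient_rel[OF Quotient_padic[where ?'p = 'p], of s t]
  by (simp add: padic_rel_def prime_card)

setup_lifting Quotient_padic

instantiation padic :: (prime_card) field
begin

lift_definition zero_padic :: "'a padic" is "\<lambda>_. 0"
  by (simp add: padic_rel_def prime_card)

lift_definition one_padic :: "'a padic" is "\<lambda>_. 1"
  by (simp add: padic_rel_def prime_card)

lift_definition plus_padic :: "'a padic \<Rightarrow> 'a padic \<Rightarrow> 'a padic" is "\<lambda>s t n. s n + t n"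
proof -
  fix s s' t t' assume *: "padic_rel TYPE('a) s s'" "padic_rel TYPE('a) t t'"
  have "(\<lambda>n. s n + t n - (s' n + t' n)) = (\<lambda>n. (s n - s' n) + (t n - t' n))" by auto
  with * show "padic_rel TYPE('a) (\<lambda>n. s n + t n) (\<lambda>n. s' n + t' n)"
    by (simp add: padic_rel_def padic_Cauchy_add[OF prime_card] padic_null_add[OF prime_card])
qed

lift_definition minus_padic :: "'a padic \<Rightarrow> 'a padic \<Rightarrow> 'a padic" is "\<lambda>s t n. s n - t n"
proof -
  fix s s' t t' assume *: "padic_rel TYPE('a) s s'" "padic_rel TYPE('a) t t'"
  have "(\<lambda>n. s n - t n - (s' n - t' n)) = (\<lambda>n. (s n - s' n) - (t n - t' n))" by auto
  with * show "padic_rel TYPE('a) (\<lambda>n. s n - t n) (\<lambda>n. s' n - t' n)"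
    by (simp add: padic_rel_def padic_Cauchy_diff[OF prime_card] padic_null_diff[OF prime_card])
qed

lift_definition uminus_padic :: "'a padic \<Rightarrow> 'a padic" is "\<lambda>s n. - s n"
proof -
  fix s s' assume *: "padic_rel TYPE('a) s s'"
  have "(\<lambda>n. - s n - (- s' n)) = (\<lambda>n. - (s n - s' n))" by auto
  with * show "padic_rel TYPE('a) (\<lambda>n. - s n) (\<lambda>n. - s' n)"
    by (simp only: padic_rel_def padic_Cauchy_minus[OF prime_card] padic_null_minus[OF prime_card] simp_thms)
qed

lift_definition times_padic :: "'a padic \<Rightarrow> 'a padic \<Rightarrow> 'a padic" is "\<lambda>s t n. s n * t n"
proof -
  fix s s' t t' assume *: "padic_rel TYPE('a) s s'" "padic_rel TYPE('a) t t'"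
  have "(\<lambda>n. s n * t n - s' n * t' n) = (\<lambda>n. s n * (t n - t' n) + t' n * (s n - s' n))"
    by (auto simp: algebra_simps)
  with * show "padic_rel TYPE('a) (\<lambda>n. s n * t n) (\<lambda>n. s' n * t' n)"
    by (simp add: padic_rel_def padic_Cauchy_mult[OF prime_card] padic_null_add[OF prime_card]
          padic_null_mult[OF prime_card])
qed

lift_definition inverse_padic :: "'a padic \<Rightarrow> 'a padic" is
  "\<lambda>s. if padic_null CARD('a) s then (\<lambda>_. 0) else (\<lambda>n. inverse (s n))"
proof -
  fix s t assume *: "padic_rel TYPE('a) s t"
  note pc = prime_card[where ?'a = 'a]
  have s: "padic_Cauchy CARD('a) s" and t: "padic_Cauchy CARD('a) t"
    and XY: "padic_null CARD('a) (\<lambda>n. s n - t n)" using * by (auto simp: padic_rel_def)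
  have iff: "padic_null CARD('a) s \<longleftrightarrow> padic_null CARD('a) t"
    using padic_null_add[OF pc XY, of t] padic_null_diff[OF pc _ XY, of s] by auto
  show "padic_rel TYPE('a)
          (if padic_null CARD('a) s then (\<lambda>_. 0) else (\<lambda>n. inverse (s n)))
          (if padic_null CARD('a) t then (\<lambda>_. 0) else (\<lambda>n. inverse (t n)))"
  proof (cases "padic_null CARD('a) s")
    case True
    with iff show ?thesis by (simp add: padic_rel_def pc)
  next
    case False
    with iff have nn: "\<not> padic_null CARD('a) t" by simp
    have iX: "padic_Cauchy CARD('a) (\<lambda>n. inverse (s n))" by (rule padic_Cauchy_inverse[OF pc s False])
    have iY: "padic_Cauchy CARD('a) (\<lambda>n. inverse (t n))" by (rule padic_Cauchy_inverse[OF pc t nn])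
    obtain b M where b: "b > 0" "\<And>n. n \<ge> M \<Longrightarrow> padic_abs CARD('a) (s n) > b"
      using padic_not_null_bound[OF pc s False] by blast
    obtain c N where c: "c > 0" "\<And>n. n \<ge> N \<Longrightarrow> padic_abs CARD('a) (t n) > c"
      using padic_not_null_bound[OF pc t nn] by blast
    have "padic_null CARD('a) (\<lambda>n. (- (inverse (s n) * inverse (t n))) * (s n - t n))"
      by (intro padic_null_mult[OF pc] padic_Cauchy_minus[OF pc] padic_Cauchy_mult[OF pc] iX iY XY)
    moreover have "\<forall>\<^sub>F n in sequentially.
      padic_abs CARD('a) ((- (inverse (s n) * inverse (t n))) * (s n - t n)) =
      padic_abs CARD('a) (inverse (s n) - inverse (t n))"
      unfolding eventually_sequentially
    proof (intro exI[of _ "max M N"] allI impI)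
      fix n assume "n \<ge> max M N"
      hence "padic_abs CARD('a) (s n) > b" "padic_abs CARD('a) (t n) > c" using b c by auto
      hence "s n \<noteq> 0" "t n \<noteq> 0" using b c by auto
      hence "(- (inverse (s n) * inverse (t n))) * (s n - t n) = inverse (s n) - inverse (t n)"
        by (simp add: field_simps)
      thus "padic_abs CARD('a) ((- (inverse (s n) * inverse (t n))) * (s n - t n)) =
            padic_abs CARD('a) (inverse (s n) - inverse (t n))" by simp
    qed
    ultimately have "padic_null CARD('a) (\<lambda>n. inverse (s n) - inverse (t n))"
      unfolding padic_null_def by (rule Lim_transform_eventually)
    thus ?thesis using False nn iX iY by (simp add: padic_rel_def)
  qed
qed

definition divide_padic :: "'a padic \<Rightarrow> 'a padic \<Rightarrow> 'a padic" where
  "divide_padic x y = x * inverse y"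

lemma padic_rel_refl_iff: "padic_rel TYPE('p::prime_card) s s \<longleftrightarrow> padic_Cauchy CARD('p) s"
  by (simp add: padic_rel_def prime_card)

instance
proof
  note pc = prime_card[where ?'a = 'a]
  note C = padic_Cauchy_add[OF pc] padic_Cauchy_diff[OF pc] padic_Cauchy_minus[OF pc]
    padic_Cauchy_mult[OF pc] padic_Cauchy_const[OF pc]
  note ops = plus_padic.abs_eq minus_padic.abs_eq
    uminus_padic.abs_eq times_padic.abs_eq
    zero_padic.abs_eq one_padic.abs_eq
    inverse_padic.abs_eq padic_rel_refl_iff C
  fix a b c :: "'a padic"
  obtain s where s: "padic_Cauchy CARD('a) s" "a = abs_padic s" by (rule padic_cases)
  obtain t where t: "padic_Cauchy CARD('a) t" "b = abs_padic t" by (rule padic_cases)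
  obtain u where u: "padic_Cauchy CARD('a) u" "c = abs_padic u" by (rule padic_cases)
  show "a + b + c = a + (b + c)" using s t u by (simp add: ops add_ac)
  show "a + b = b + a" using s t by (simp add: ops add_ac)
  show "0 + a = a" using s by (simp add: ops)
  show "- a + a = 0" using s by (simp add: ops)
  show "a - b = a + - b" using s t by (simp add: ops)
  show "a * b * c = a * (b * c)" using s t u by (simp add: ops mult_ac)
  show "a * b = b * a" using s t by (simp add: ops mult_ac)
  show "1 * a = a" using s by (simp add: ops)
  show "(a + b) * c = a * c + b * c" using s t u by (simp add: ops distrib_right)
  show "(0::'a padic) \<noteq> 1"
    by (simp add: ops abs_padic_eq_iff padic_null_const_iff[OF pc])
  show "a div b = a * inverse b"
    by (rule divide_padic_def)
  show "inverse (0::'a padic) = 0"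
    by (simp add: ops padic_null_const_iff[OF pc])
  show "inverse a * a = 1" if "a \<noteq> 0"
  proof -
    have nn: "\<not> padic_null CARD('a) s"
      using that s by (simp add: ops abs_padic_eq_iff)
    obtain e M where e: "e > 0" "\<And>n. n \<ge> M \<Longrightarrow> padic_abs CARD('a) (s n) > e"
      using padic_not_null_bound[OF pc s(1) nn] by blast
    have "\<forall>\<^sub>F n in sequentially. 0 = padic_abs CARD('a) (inverse (s n) * s n - 1)"
      unfolding eventually_sequentially
    proof (intro exI[of _ M] allI impI)
      fix n assume "n \<ge> M"
      hence "s n \<noteq> 0" using e(1) e(2)[of n] by auto
      thus "0 = padic_abs CARD('a) (inverse (s n) * s n - 1)" by simp
    qed
    hence "padic_null CARD('a) (\<lambda>n. inverse (s n) * s n - 1)"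
      unfolding padic_null_def by (rule Lim_transform_eventually[OF tendsto_const])
    thus ?thesis
      using nn s padic_Cauchy_inverse[OF pc s(1) nn] by (simp add: ops abs_padic_eq_iff)
  qed
qed

end

lift_definition padic_norm :: "'p::prime_card padic \<Rightarrow> real" is
  "\<lambda>s. lim (\<lambda>n. padic_abs CARD('p) (s n))"
proof -
  fix s t assume *: "padic_rel TYPE('p) s t"
  note pc = prime_card[where ?'a = 'p]
  have XY: "(\<lambda>n. padic_abs CARD('p) (s n - t n)) \<longlonglongrightarrow> 0"
    using * by (auto simp: padic_rel_def padic_null_def)
  obtain l where l: "(\<lambda>n. padic_abs CARD('p) (s n)) \<longlonglongrightarrow> l"
    using * padic_Cauchy_convergent[OF pc, of s] by (auto simp: padic_rel_def convergent_def)
  have "(\<lambda>n. padic_abs CARD('p) (s n) - padic_abs CARD('p) (t n)) \<longlonglongrightarrow> 0"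
    by (rule tendsto_0_le[OF XY, where K = 1]) (simp add: padic_abs_triangle3[OF pc] padic_abs_ge0[OF pc])
  from tendsto_diff[OF l this] have "(\<lambda>n. padic_abs CARD('p) (t n)) \<longlonglongrightarrow> l" by simp
  with l show "lim (\<lambda>n. padic_abs CARD('p) (s n)) = lim (\<lambda>n. padic_abs CARD('p) (t n))"
    by (simp add: limI)
qed

lemma padic_rel_LIMSEQ:
  assumes "padic_rel TYPE('p::prime_card) s s"
  shows "(\<lambda>n. padic_abs CARD('p) (s n)) \<longlonglongrightarrow> lim (\<lambda>n. padic_abs CARD('p) (s n))"
  using assms padic_Cauchy_convergent[OF prime_card[where ?'a = 'p], of s]
  by (simp add: padic_rel_def convergent_LIMSEQ_iff)

lemma padic_norm_eq_0_iff [simp]: "padic_norm x = 0 \<longleftrightarrow> x = 0"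
proof transfer
  fix s assume s: "padic_rel TYPE('a) s s"
  from padic_rel_LIMSEQ[OF s] show "lim (\<lambda>n. padic_abs CARD('a) (s n)) = 0 \<longleftrightarrow> padic_rel TYPE('a) s (\<lambda>_. 0)"
    using s by (auto simp: padic_rel_def prime_card padic_null_def intro: limI)
qed

lemma padic_norm_ultra: "padic_norm (x + y) \<le> max (padic_norm x) (padic_norm y)"
proof transfer
  fix s t assume s: "padic_rel TYPE('a) s s" and t: "padic_rel TYPE('a) t t"
  hence XY: "padic_rel TYPE('a) (\<lambda>n. s n + t n) (\<lambda>n. s n + t n)"
    by (simp add: padic_rel_def padic_Cauchy_add[OF prime_card] prime_card)
  show "lim (\<lambda>n. padic_abs CARD('a) (s n + t n)) \<le>
          max (lim (\<lambda>n. padic_abs CARD('a) (s n))) (lim (\<lambda>n. padic_abs CARD('a) (t n)))"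
    by (rule LIMSEQ_le[OF padic_rel_LIMSEQ[OF XY]
          tendsto_max[OF padic_rel_LIMSEQ[OF s] padic_rel_LIMSEQ[OF t]]])
      (simp add: padic_abs_ultra[OF prime_card])
qed

lemma padic_norm_minus [simp]: "padic_norm (- x) = padic_norm x"
proof -
  obtain s where "padic_Cauchy CARD('a) s" "x = abs_padic s" by (rule padic_cases)
  thus ?thesis
    by (simp add: uminus_padic.abs_eq padic_norm.abs_eq padic_rel_refl_iff
        padic_Cauchy_minus[OF prime_card] padic_abs_minus[OF prime_card])
qed

lemma padic_norm_0 [simp]: "padic_norm 0 = 0"
  using padic_norm_eq_0_iff by blast

lemma padic_norm_ge0 [simp]: "padic_norm x \<ge> 0"
  using padic_norm_ultra[of x "- x"] by simp

instantiation padic :: (prime_card) metric_space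
begin

definition dist_padic :: "'a padic \<Rightarrow> 'a padic \<Rightarrow> real" where
  "dist_padic x y = padic_norm (x - y)"

definition uniformity_padic :: "('a padic \<times> 'a padic) filter" where
  "uniformity_padic = (INF e\<in>{0 <..}. principal {(x, y). dist x y < e})"

definition open_padic :: "'a padic set \<Rightarrow> bool" where
  "open_padic U \<longleftrightarrow> (\<forall>x\<in>U. eventually (\<lambda>(x', y). x' = x \<longrightarrow> y \<in> U) uniformity)"

instance
proof
  fix x y z :: "'a padic"
  show "(dist x y = 0) = (x = y)" by (simp add: dist_padic_def)
  have "dist x y \<le> max (padic_norm (x - z)) (padic_norm (z - y))"
    using padic_norm_ultra[of "x - z" "z - y"] by (simp add: dist_padic_def)
  also have "\<dots> \<le> padic_norm (x - z) + padic_norm (z - y)" by simp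
  also have "padic_norm (z - y) = padic_norm (y - z)" using padic_norm_minus[of "z - y"] by simp
  finally show "dist x y \<le> dist x z + dist y z" by (simp add: dist_padic_def)
qed (rule uniformity_padic_def open_padic_def)+

end


section \<open>Central division algebras, reduced norm and topology\<close>

locale central_division_algebra =
  finite_dimensional_vector_space smul Basis
  for smul :: "'k::field \<Rightarrow> 'd::division_ring \<Rightarrow> 'd" and Basis :: "'d set" +
  assumes smul_mult_left: "smul c x * y = smul c (x * y)"
    and smul_mult_right: "x * smul c y = smul c (x * y)"
    and center: "{z. \<forall>x. z * x = x * z} = range (\<lambda>c. smul c 1)"

text \<open>
  Let \<open>L\<close> be an algebraic closure of \<open>k\<close>. An isomorphism of \<open>L\<close>-algebras from
  \<open>D \<otimes>\<^sub>k L\<close> onto \<open>M\<^sub>n(L)\<close> is the same thing as a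
  homomorphism of \<open>k\<close>-algebras \<open>f\<close> from \<open>D\<close> to \<open>M\<^sub>n(L)\<close> whose \<open>L\<close>-linear extension is
  bijective; the last condition says that \<open>f\<close> maps the \<open>k\<close>-basis \<open>B\<close> of \<open>D\<close> to an
  \<open>L\<close>-basis of \<open>M\<^sub>n(L)\<close>.
\<close>

definition splitting ::
  "('k::field \<Rightarrow> 'd::ring_1 \<Rightarrow> 'd) \<Rightarrow> 'd set \<Rightarrow> nat \<Rightarrow> ('d \<Rightarrow> 'k alg_closure mat) \<Rightarrow> bool" where
  "splitting smul B n f \<longleftrightarrow>
     (\<forall>x. f x \<in> carrier_mat n n) \<and>
     f 1 = 1\<^sub>m n \<and>
     (\<forall>x y. f (x + y) = f x + f y) \<and>
     (\<forall>x y. f (x * y) = f x * f y) \<and>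
     (\<forall>c x. f (smul c x) = to_ac c \<cdot>\<^sub>m f x) \<and>
     (\<forall>M \<in> carrier_mat n n. \<exists>!a. a \<in> extensional B \<and>
        M = mat n n (\<lambda>(i, j). \<Sum>b\<in>B. a b * f b $$ (i, j)))"

definition reduced_norm ::
  "('k::field \<Rightarrow> 'd::ring_1 \<Rightarrow> 'd) \<Rightarrow> 'd set \<Rightarrow> 'd \<Rightarrow> 'k" where
  "reduced_norm smul B x = (THE c. \<exists>n f. splitting smul B n f \<and> to_ac c = det (f x))"

definition SL1 :: "('k::field \<Rightarrow> 'd::ring_1 \<Rightarrow> 'd) \<Rightarrow> 'd set \<Rightarrow> 'd monoid" where
  "SL1 smul B = \<lparr>carrier = {x. reduced_norm smul B x = 1}, monoid.mult = (*), one = 1\<rparr>"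

text \<open>The product topology on \<open>k\<close>-coordinates; it does not depend on the finite basis \<open>B\<close>.\<close>

definition coord_topology ::
  "('k::{field,topological_space} \<Rightarrow> 'd::ab_group_add \<Rightarrow> 'd) \<Rightarrow> 'd set \<Rightarrow> 'd topology" where
  "coord_topology smul B =
     pullback_topology UNIV (\<lambda>x. \<lambda>b\<in>B. module.representation smul B x b)
       (product_topology (\<lambda>_. euclidean) B)"


section \<open>Self-similar groups\<close>

text \<open>
  Words over \<open>{..<d}\<close> are the vertices of the \<open>d\<close>-ary rooted tree; the root is \<open>[]\<close>
  and the parent of a nonempty word \<open>w\<close> is \<open>butlast w\<close>.
\<close>

definition tree_automorphism :: "nat \<Rightarrow> (nat list \<Rightarrow> nat list) \<Rightarrow> bool" where
  "tree_automorphism d g \<longleftrightarrow>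
     bij_betw g (lists {..<d}) (lists {..<d}) \<and>
     g [] = [] \<and>
     (\<forall>w \<in> lists {..<d}. w \<noteq> [] \<longrightarrow> g w \<noteq> [] \<and> butlast (g w) = g (butlast w))"

definition self_similar_of_index :: "('a, 'b) monoid_scheme \<Rightarrow> nat \<Rightarrow> bool" where
  "self_similar_of_index G d \<longleftrightarrow> (\<exists>\<phi>.
     faithful_action G (lists {..<d}) \<phi> \<and>
     (\<forall>g \<in> carrier G. tree_automorphism d (\<phi> g)) \<and>
     (\<forall>g \<in> carrier G. \<forall>x<d. \<exists>h \<in> carrier G. \<exists>y<d.
        \<forall>w \<in> lists {..<d}. \<phi> g (x # w) = y # \<phi> h w) \<and>
     (\<forall>x<d. \<forall>y<d. \<exists>g \<in> carrier G. \<phi> g [x] = [y]))"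

definition self_similar :: "('a, 'b) monoid_scheme \<Rightarrow> bool" where
  "self_similar G \<longleftrightarrow> (\<exists>d\<ge>1. self_similar_of_index G d)"

end

theory Submission
  imports Defs "HOL-Analysis.Elementary_Metric_Spaces"
begin

text \<open>
  A self-similar action yields a homomorphism \<open>\<theta>\<close> from a subgroup \<open>H\<close> of finite index to \<open>G\<close> such that no
  nontrivial subset of \<open>H\<close> is stable under \<open>\<theta>\<close> and under conjugation by \<open>G\<close>. Modulo scalars \<open>G\<close> contains
  a neighbourhood of 1 in \<open>D\<close>, so \<open>\<theta>\<close> extends to a homomorphism from such a neighbourhood to the units of \<open>D\<close>.
  Since elements close to 1 have roots of high \<open>p\<close>-power order and elements of norm one form a compact group,
  this homomorphism is automatically Lipschitz and has a differential \<open>\<sigma>\<close>, a Lie algebra endomorphism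
  with \<open>log (\<theta> g) = \<sigma> (log g)\<close>. The Lie algebra of trace zero elements is simple, so there \<open>\<sigma>\<close> is zero or an
  automorphism. All Lie automorphisms preserve the functions \<open>tr (ad y ^ j)\<close>. These do not vanish
  simultaneously for \<open>y \<noteq> 0\<close>, because a division algebra has no nilpotent \<open>ad y\<close> other than 0, and by
  compactness all Lie automorphisms are uniformly bounded. The small elements whose logarithm has
  trace zero and stays small under every Lie automorphism are therefore stable under \<open>\<theta>\<close>
  and under conjugation, and so are their commutators, which lie in \<open>H\<close> and are not all trivial.
\<close>

section \<open>Topology of the \<open>p\<close>-adic numbers\<close>

text \<open>The virtual endomorphism is an abstract homomorphism with no continuity given, and this
  shapes the analytic half: divisibility by \<open>p + 1\<close> forces the regular norm of its
  values to have absolute value 1, compactness then brings their powers with one common exponent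
  \<open>M\<close> close to 1, and only after that do \<open>p ^ k\<close>-th roots yield an
  estimate at scale \<open>p ^ (-k)\<close>. The argument runs in a ball of \<open>D\<close> rather
  than in \<open>SL1\<close>, because there the logarithm is a bijection onto a ball of a vector
  space. The price is a scalar factor \<open>\<mu>\<close>, which is multiplicative near 1 and
  cancels in commutators; therefore commutators of the invariant set, not its elements, are tested
  against simplicity. The invariants \<open>tr (ad y ^ j)\<close> stand in for a description of the
  Lie automorphisms, since a uniform bound is all that is asked of them. Nilpotency is deduced from
  vanishing traces over the base field itself, through an idempotent polynomial in the operator. The
  reduced norm enters through its relation to the determinant of left multiplication.\<close>

lemma padic_norm_abs_padic:
  "padic_Cauchy CARD('p::prime_card) s \<Longrightarrow>
     (\<lambda>n. padic_abs CARD('p) (s n)) \<longlonglongrightarrow> padic_norm (abs_padic s :: 'p padic)"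
  using padic_rel_LIMSEQ[of s] by (simp add: padic_norm.abs_eq padic_rel_refl_iff)

lemma padic_norm_mult: "padic_norm (x * y) = padic_norm x * padic_norm (y :: 'p::prime_card padic)"
proof -
  obtain s where s: "padic_Cauchy CARD('p) s" "x = abs_padic s" by (rule padic_cases)
  obtain t where t: "padic_Cauchy CARD('p) t" "y = abs_padic t" by (rule padic_cases)
  have st: "padic_Cauchy CARD('p) (\<lambda>n. s n * t n)"
    by (rule padic_Cauchy_mult[OF prime_card s(1) t(1)])
  have xy: "x * y = abs_padic (\<lambda>n. s n * t n)"
    using s t by (simp add: times_padic.abs_eq padic_rel_refl_iff)
  have "(\<lambda>n. padic_abs CARD('p) (s n * t n)) \<longlonglongrightarrow> padic_norm x * padic_norm y"
    using tendsto_mult[OF padic_norm_abs_padic[OF s(1)] padic_norm_abs_padic[OF t(1)]]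
    by (simp add: padic_abs_mult[OF prime_card] s t)
  with padic_norm_abs_padic[OF st] show ?thesis
    unfolding xy by (rule LIMSEQ_unique)
qed

lemma padic_norm_1 [simp]: "padic_norm (1 :: 'p::prime_card padic) = 1"
  using padic_norm_mult[of 1 "1 :: 'p padic"] by simp

lemma padic_norm_power: "padic_norm (x ^ n) = padic_norm (x :: 'p::prime_card padic) ^ n"
  by (induction n) (simp_all add: padic_norm_mult)

lemma padic_norm_inverse: "padic_norm (inverse x) = inverse (padic_norm (x :: 'p::prime_card padic))"
proof (cases "x = 0")
  case False
  hence "padic_norm x * padic_norm (inverse x) = 1" by (simp flip: padic_norm_mult)
  thus ?thesis by (metis inverse_unique)
qed auto

lemma padic_norm_diff: "padic_norm (x - y) \<le> max (padic_norm x) (padic_norm (y :: 'p::prime_card padic))"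
  using padic_norm_ultra[of x "- y"] by simp

lemma of_int_eq_abs_padic: "(of_int a :: 'p::prime_card padic) = abs_padic (\<lambda>_. of_int a)"
proof (induction a rule: int_induct[of _ 0])
  case base
  show ?case by (simp add: zero_padic.abs_eq)
next
  case (step1 i)
  thus ?case
    by (simp add: plus_padic.abs_eq one_padic.abs_eq padic_rel_refl_iff padic_Cauchy_const[OF prime_card])
next
  case (step2 i)
  thus ?case
    by (simp add: minus_padic.abs_eq one_padic.abs_eq padic_rel_refl_iff padic_Cauchy_const[OF prime_card])
qed

instance padic :: (prime_card) field_char_0
proof
  show "inj (of_nat :: nat \<Rightarrow> 'a padic)"
  proof (rule injI)
    fix m n assume "(of_nat m :: 'a padic) = of_nat n"
    hence "(of_int (int m) :: 'a padic) = of_int (int n)" by simp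
    hence "padic_null CARD('a) (\<lambda>_. of_int (int m) - of_int (int n))"
      unfolding of_int_eq_abs_padic by (simp add: abs_padic_eq_iff padic_Cauchy_const[OF prime_card])
    thus "m = n" by (simp add: padic_null_const_iff[OF prime_card])
  qed
qed

lemma of_rat_eq_abs_padic: "(of_rat q :: 'p::prime_card padic) = abs_padic (\<lambda>_. q)"
proof -
  obtain a b where q: "quotient_of q = (a, b)" by (cases "quotient_of q")
  have b: "b > 0" using quotient_of_denom_pos[OF q] .
  have qe: "q = of_int a / of_int b" using quotient_of_div[OF q] .
  have "abs_padic (\<lambda>_. q) * (of_int b :: 'p padic) = of_int a"
    using b qe by (simp add: of_int_eq_abs_padic times_padic.abs_eq padic_rel_refl_iff
        padic_Cauchy_const[OF prime_card])
  moreover have "of_rat q * (of_int b :: 'p padic) = of_int a"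
    using b qe by (simp add: of_rat_divide)
  moreover have "(of_int b :: 'p padic) \<noteq> 0" using b by simp
  ultimately show ?thesis by (metis mult_cancel_right)
qed

lemma padic_norm_of_rat: "padic_norm (of_rat q :: 'p::prime_card padic) = padic_abs CARD('p) q"
  using padic_norm_abs_padic[OF padic_Cauchy_const[OF prime_card[where ?'a = 'p]], of q]
  by (simp add: of_rat_eq_abs_padic LIMSEQ_const_iff)

lemma padic_norm_of_int_le1: "padic_norm (of_int a :: 'p::prime_card padic) \<le> 1"
proof (induction a rule: int_induct[of _ 0])
  case (step1 i)
  thus ?case using padic_norm_ultra[of "of_int i :: 'p padic" 1] by simp
next
  case (step2 i)
  thus ?case using padic_norm_diff[of "of_int i :: 'p padic" 1] by simp
qed simp

lemma padic_norm_of_nat_le1: "padic_norm (of_nat a :: 'p::prime_card padic) \<le> 1"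
  using padic_norm_of_int_le1[of "int a"] by simp

lemma padic_norm_p: "padic_norm (of_nat CARD('p) :: 'p::prime_card padic) = 1 / real CARD('p)"
proof -
  have "padic_abs CARD('p) (of_int (int CARD('p)) / of_int 1) =
          real CARD('p) powi (int (multiplicity (int CARD('p)) 1) - int (multiplicity (int CARD('p)) (int CARD('p))))"
    by (rule padic_abs_frac[OF prime_card]) auto
  also have "\<dots> = 1 / real CARD('p)"
    using prime_card[where ?'a = 'p] prime_gt_1_nat[OF prime_card[where ?'a = 'p]]
    by (simp add: power_int_minus field_simps)
  finally show ?thesis
    using padic_norm_of_rat[of "of_nat CARD('p)", where ?'p = 'p] by simp
qed

lemma one_less_card: "1 < real CARD('p::prime_card)"
  using prime_gt_1_nat[OF prime_card[where ?'a = 'p]] by simp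

lemma padic_norm_unit_ball_add:
  assumes "padic_norm (x :: 'p::prime_card padic) < 1"
  shows "padic_norm (1 + x) = 1"
  using padic_norm_ultra[of 1 x] padic_norm_diff[of "1 + x" x] assms by simp

lemma padic_rat_dense:
  assumes "e > 0" obtains q where "padic_norm (x - of_rat q :: 'p::prime_card padic) < e"
proof -
  obtain s where s: "padic_Cauchy CARD('p) s" "x = abs_padic s" by (rule padic_cases)
  obtain N where N: "\<And>m n. m \<ge> N \<Longrightarrow> n \<ge> N \<Longrightarrow> padic_abs CARD('p) (s m - s n) < e / 2"
    using s(1) assms unfolding padic_Cauchy_def by (meson half_gt_zero)
  have C: "padic_Cauchy CARD('p) (\<lambda>n. s n - s N)"
    by (rule padic_Cauchy_diff[OF prime_card s(1) padic_Cauchy_const[OF prime_card]])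
  have "x - of_rat (s N) = abs_padic (\<lambda>n. s n - s N)"
    using s by (simp add: of_rat_eq_abs_padic minus_padic.abs_eq padic_rel_refl_iff padic_Cauchy_const[OF prime_card])
  hence "padic_norm (x - of_rat (s N)) \<le> e / 2"
    using padic_norm_abs_padic[OF C] N
    by (intro LIMSEQ_le_const2[where X = "\<lambda>n. padic_abs CARD('p) (s n - s N)"])
       (auto intro!: exI[of _ N] less_imp_le)
  thus ?thesis using that[of "s N"] assms by auto
qed

text \<open>Isosceles principle: in an ultrametric a perturbation smaller than \<open>x\<close>
  cannot change its norm.\<close>

lemma padic_norm_eqI: "padic_norm (x - y :: 'p::prime_card padic) < padic_norm x \<Longrightarrow> padic_norm y = padic_norm x"
  using padic_norm_diff[of x "x - y"] padic_norm_diff[of y "y - x"] padic_norm_minus[of "x - y"]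
    padic_norm_ultra[of y "x - y"] by (auto simp: max_def split: if_splits)

text \<open>By density and the isosceles principle the norm of \<open>x\<close> is already that of a
  rational number, so completion leaves the value group discrete.\<close>

lemma padic_norm_powi:
  assumes "x \<noteq> 0" obtains m where "padic_norm (x :: 'p::prime_card padic) = real CARD('p) powi m"
proof -
  have "padic_norm x > 0" using assms padic_norm_ge0[of x] padic_norm_eq_0_iff[of x] by linarith
  then obtain q where q: "padic_norm (x - of_rat q) < padic_norm x" by (rule padic_rat_dense)
  have n: "padic_norm x = padic_abs CARD('p) q"
    using padic_norm_eqI[OF q] by (simp add: padic_norm_of_rat)
  hence "q \<noteq> 0" using \<open>padic_norm x > 0\<close> by auto
  thus ?thesis using that n by (auto simp: padic_abs_def)
qed

lemma dist_padic_0: "dist x 0 = padic_norm (x :: 'p::prime_card padic)"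
  by (simp add: dist_padic_def)

instance padic :: (prime_card) topological_ab_group_add
proof
  fix a b :: "'a padic"
  show "((\<lambda>x. fst x + snd x) \<longlongrightarrow> a + b) (nhds a \<times>\<^sub>F nhds b)"
    unfolding tendsto_iff
  proof (intro allI impI)
    fix e :: real assume e: "e > 0"
    have "\<forall>\<^sub>F x in nhds a \<times>\<^sub>F nhds b. dist (fst x) a < e \<and> dist (snd x) b < e"
      using e by (intro eventually_prodI) (auto simp: eventually_nhds_metric)
    thus "\<forall>\<^sub>F x in nhds a \<times>\<^sub>F nhds b. dist (fst x + snd x) (a + b) < e"
    proof eventually_elim
      case (elim x)
      thus ?case using padic_norm_ultra[of "fst x - a" "snd x - b"]
        by (auto simp: dist_padic_def add_diff_add)
    qed
  qed
  show "(uminus \<longlongrightarrow> - a) (nhds a)"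
    unfolding tendsto_iff eventually_nhds_metric dist_padic_def
    using padic_norm_minus[of "_ - a"] by (metis minus_diff_minus)
qed

instance padic :: (prime_card) topological_comm_monoid_mult
proof
  fix a b :: "'a padic"
  show "((\<lambda>x. fst x * snd x) \<longlongrightarrow> a * b) (nhds a \<times>\<^sub>F nhds b)"
    unfolding tendsto_iff
  proof (intro allI impI)
    fix e :: real assume e: "e > 0"
    define M where "M = max 1 (max (padic_norm a) (padic_norm b))"
    define r where "r = min 1 (e / M)"
    have M: "M \<ge> 1" "padic_norm a \<le> M" "padic_norm b \<le> M" by (auto simp: M_def)
    hence r: "r > 0" "r \<le> 1" "r * M \<le> e" using e by (auto simp: r_def min_def field_simps)
    have "\<forall>\<^sub>F x in nhds a \<times>\<^sub>F nhds b. dist (fst x) a < r \<and> dist (snd x) b < r"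
      using r by (intro eventually_prodI) (auto simp: eventually_nhds_metric)
    thus "\<forall>\<^sub>F x in nhds a \<times>\<^sub>F nhds b. dist (fst x * snd x) (a * b) < e"
    proof eventually_elim
      case (elim x)
      define u v where "u = fst x - a" and "v = snd x - b"
      have uv: "padic_norm u < r" "padic_norm v < r" using elim by (auto simp: u_def v_def dist_padic_def)
      have eq: "fst x * snd x - a * b = u * v + (u * b + a * v)"
        by (simp add: u_def v_def algebra_simps)
      have "padic_norm u * padic_norm v < r * 1"
        using uv r by (intro mult_strict_mono') auto
      moreover have "padic_norm u * padic_norm b < r * M"
        using uv M r by (intro le_less_trans[OF mult_left_mono mult_strict_right_mono]) auto
      moreover have "padic_norm a * padic_norm v < r * M"
        using uv M r by (subst mult.commute, intro le_less_trans[OF mult_left_mono mult_strict_right_mono]) auto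
      moreover have "r * 1 \<le> r * M" using M r by (intro mult_left_mono) auto
      ultimately have "padic_norm (u * v) < e" "padic_norm (u * b) < e" "padic_norm (a * v) < e"
        using r(3) unfolding padic_norm_mult by linarith+
      thus ?case
        using padic_norm_ultra[of "u * v" "u * b + a * v"] padic_norm_ultra[of "u * b" "a * v"]
        unfolding dist_padic_def eq by linarith
    qed
  qed
qed

lemma continuous_on_padic_norm [continuous_intros]:
  "continuous_on S f \<Longrightarrow> continuous_on S (\<lambda>x. padic_norm (f x :: 'p::prime_card padic))"
  unfolding dist_padic_0[symmetric] by (intro continuous_intros)

text \<open>Replacing each \<open>u n\<close> by a rational within \<open>1 / (n + 1)\<close> gives
  a rational Cauchy sequence, and the element represented by it is the limit.\<close>

lemma padic_Cauchy_convergent_metric: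
  fixes u :: "nat \<Rightarrow> 'p::prime_card padic"
  assumes "Cauchy u" shows "convergent u"
proof -
  have "\<exists>q. padic_norm (u n - of_rat q) < 1 / real (Suc n)" for n
    using padic_rat_dense[of "1 / real (Suc n)" "u n"] by auto
  then obtain q where q: "\<And>n. padic_norm (u n - of_rat (q n)) < 1 / real (Suc n)" by metis
  have small: "\<exists>N. \<forall>n\<ge>N. padic_norm (u n - of_rat (q n)) < e" if "e > 0" for e
  proof -
    obtain N where N: "1 / real (Suc N) < e" using \<open>e > 0\<close> by (metis nat_approx_posE)
    have "padic_norm (u n - of_rat (q n)) < e" if "n \<ge> N" for n
    proof -
      have "1 / real (Suc n) \<le> 1 / real (Suc N)" using that by (simp add: field_simps)
      thus ?thesis using q[of n] N by linarith
    qed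
    thus ?thesis by blast
  qed
  have C: "padic_Cauchy CARD('p) q"
    unfolding padic_Cauchy_def
  proof (intro allI impI)
    fix e :: real assume e: "e > 0"
    obtain N where N: "\<forall>n\<ge>N. padic_norm (u n - of_rat (q n)) < e" using small[OF e] by blast
    obtain M where M: "\<And>m n. m \<ge> M \<Longrightarrow> n \<ge> M \<Longrightarrow> padic_norm (u m - u n) < e"
      using assms e unfolding Cauchy_def dist_padic_def by blast
    have "padic_abs CARD('p) (q m - q n) < e" if "m \<ge> max M N" "n \<ge> max M N" for m n
    proof -
      have "of_rat (q m - q n) = (u m - u n) - ((u m - of_rat (q m)) - (u n - of_rat (q n)))"
        by (simp add: of_rat_diff)
      moreover have "padic_norm (u m - u n) < e" "padic_norm (u m - of_rat (q m)) < e"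
        "padic_norm (u n - of_rat (q n)) < e" using M N that by auto
      ultimately have "padic_norm (of_rat (q m - q n) :: 'p padic) < e"
        using padic_norm_diff[of "u m - u n" "(u m - of_rat (q m)) - (u n - of_rat (q n))"]
          padic_norm_diff[of "u m - of_rat (q m)" "u n - of_rat (q n)"] by simp
      thus ?thesis by (simp add: padic_norm_of_rat)
    qed
    thus "\<exists>N. \<forall>m\<ge>N. \<forall>n\<ge>N. padic_abs CARD('p) (q m - q n) < e" by blast
  qed
  have "u \<longlonglongrightarrow> abs_padic q"
    unfolding LIMSEQ_def
  proof (intro allI impI)
    fix e :: real assume e: "e > 0"
    obtain N where N: "\<forall>n\<ge>N. padic_norm (u n - of_rat (q n)) < e" using small[OF e] by blast
    obtain M where M: "\<And>m n. m \<ge> M \<Longrightarrow> n \<ge> M \<Longrightarrow> padic_abs CARD('p) (q m - q n) < e / 2"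
      using C e unfolding padic_Cauchy_def by (meson half_gt_zero)
    have "dist (u n) (abs_padic q) < e" if n: "n \<ge> max M N" for n
    proof -
      have C': "padic_Cauchy CARD('p) (\<lambda>m. q m - q n)"
        by (rule padic_Cauchy_diff[OF prime_card C padic_Cauchy_const[OF prime_card]])
      have "abs_padic q - (of_rat (q n) :: 'p padic) = abs_padic (\<lambda>m. q m - q n)"
        using C by (simp add: of_rat_eq_abs_padic minus_padic.abs_eq padic_rel_refl_iff padic_Cauchy_const[OF prime_card])
      hence "padic_norm (abs_padic q - (of_rat (q n) :: 'p padic)) \<le> e / 2"
        using padic_norm_abs_padic[OF C'] M n
        by (intro LIMSEQ_le_const2[where X = "\<lambda>m. padic_abs CARD('p) (q m - q n)"])
           (auto intro!: exI[of _ M] less_imp_le)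
      moreover have eq: "u n - abs_padic q = (u n - of_rat (q n)) - (abs_padic q - of_rat (q n))" by simp
      moreover have "padic_norm (u n - of_rat (q n)) < e" using N n by simp
      ultimately show ?thesis unfolding dist_padic_def eq
        by (intro le_less_trans[OF padic_norm_diff]) (use e in auto)
    qed
    thus "\<exists>no. \<forall>n\<ge>no. dist (u n) (abs_padic q) < e" by blast
  qed
  thus ?thesis by (auto simp: convergent_def)
qed

instance padic :: (prime_card) complete_space
  by standard (rule padic_Cauchy_convergent_metric)

text \<open>A rational close to \<open>x\<close> has norm at most 1, so its reduced denominator is
  prime to \<open>p\<close> and can be inverted modulo \<open>p ^ k\<close>. The ball thus has at
  most \<open>p ^ k\<close> classes at radius \<open>p ^ (-k)\<close>, the source of all compactness
  below.\<close>

lemma padic_unit_ball_approx: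
  assumes "padic_norm (x :: 'p::prime_card padic) \<le> 1"
  obtains a where "a < CARD('p) ^ k" "padic_norm (x - of_nat a) \<le> (1 / real CARD('p)) ^ k"
proof -
  define P where "P = int CARD('p)"
  have P: "prime P" using prime_card[where ?'a = 'p] by (simp add: P_def)
  have e: "(1 / real CARD('p)) ^ k > 0" using one_less_card[where ?'p = 'p] by simp
  then obtain q where q: "padic_norm (x - of_rat q) < (1 / real CARD('p)) ^ k" by (rule padic_rat_dense)
  have "(1 / real CARD('p)) ^ k \<le> 1" using one_less_card[where ?'p = 'p] by (intro power_le_one) auto
  hence nq: "padic_norm (of_rat q :: 'p padic) \<le> 1"
    using padic_norm_diff[of x "x - of_rat q"] assms q by simp
  obtain a b where ab: "quotient_of q = (a, b)" by (cases "quotient_of q")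
  have b: "b > 0" and qe: "q = of_int a / of_int b" and cop: "coprime a b"
    using quotient_of_denom_pos[OF ab] quotient_of_div[OF ab] quotient_of_coprime[OF ab] by auto
  have nb: "\<not> P dvd b"
  proof
    assume d: "P dvd b"
    hence na: "\<not> P dvd a" using cop P not_prime_unit by (metis coprime_common_divisor)
    hence a0: "a \<noteq> 0" by auto
    have "multiplicity P b \<ge> 1" using d b P
      by (intro multiplicity_geI) (auto dest: not_prime_unit)
    moreover have "multiplicity P a = 0" using na by (rule not_dvd_imp_multiplicity_0)
    ultimately have "real CARD('p) powi (int (multiplicity P b) - int (multiplicity P a)) > 1"
      using one_less_card[where ?'p = 'p] by (simp add: power_int_def)
    moreover have "padic_norm (of_rat q :: 'p padic) =
        real CARD('p) powi (int (multiplicity P b) - int (multiplicity P a))"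
      unfolding padic_norm_of_rat qe P_def using a0 b by (intro padic_abs_frac[OF prime_card]) auto
    ultimately show False using nq by linarith
  qed
  hence "coprime b (P ^ k)" using P by (simp add: prime_imp_coprime coprime_commute)
  then obtain c where c: "[b * c = 1] (mod P ^ k)" using cong_solve_coprime_int by blast
  define n where "n = nat ((a * c) mod P ^ k)"
  have Pk: "P ^ k > 0" using P by (simp add: prime_gt_0_int)
  have n: "int n = (a * c) mod P ^ k" using Pk by (simp add: n_def)
  have "int n < P ^ k" using n Pk by simp
  hence lt: "n < CARD('p) ^ k" unfolding P_def by (metis of_nat_less_iff of_nat_power)
  have "[b * int n = a] (mod P ^ k)"
  proof -
    have "[b * int n = b * (a * c)] (mod P ^ k)" unfolding n by (intro cong_scalar_left) (simp add: cong_def)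
    also have "b * (a * c) = a * (b * c)" by simp
    also have "[a * (b * c) = a * 1] (mod P ^ k)" by (intro cong_scalar_left c)
    finally show ?thesis by simp
  qed
  then obtain t where t: "a - b * int n = P ^ k * t"
    by (metis cong_iff_dvd_diff cong_sym dvdE)
  have nb1: "padic_norm (of_int b :: 'p padic) = 1"
  proof -
    have "padic_norm (of_int b :: 'p padic) = padic_abs CARD('p) (of_int b / of_int 1)"
      using padic_norm_of_rat[of "of_int b", where ?'p = 'p] by simp
    also have "\<dots> = real CARD('p) powi (int (multiplicity P 1) - int (multiplicity P b))"
      unfolding P_def using b by (intro padic_abs_frac[OF prime_card]) auto
    also have "\<dots> = 1" using nb by (simp add: not_dvd_imp_multiplicity_0)
    finally show ?thesis .
  qed
  have "(of_rat q - of_nat n :: 'p padic) * of_int b = of_int (a - b * int n)"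
    using b by (simp add: qe of_rat_divide field_simps)
  hence "padic_norm (of_rat q - of_nat n :: 'p padic) = padic_norm (of_int (P ^ k * t) :: 'p padic)"
    unfolding t using nb1 padic_norm_mult[of "of_rat q - of_nat n" "of_int b :: 'p padic"] by simp
  also have "\<dots> = (1 / real CARD('p)) ^ k * padic_norm (of_int t :: 'p padic)"
    using padic_norm_p[where ?'p = 'p] by (simp add: padic_norm_mult padic_norm_power P_def)
  also have "\<dots> \<le> (1 / real CARD('p)) ^ k"
    using padic_norm_of_int_le1[of t, where ?'p = 'p] e by (simp add: mult_left_le)
  finally have "padic_norm (x - of_nat n) \<le> (1 / real CARD('p)) ^ k"
    using q padic_norm_ultra[of "x - of_rat q" "of_rat q - of_nat n :: 'p padic"] by simp
  with lt show ?thesis using that by blast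
qed

lemma compact_padic_unit_ball: "compact {x :: 'p::prime_card padic. padic_norm x \<le> 1}"
  unfolding compact_eq_totally_bounded
proof (intro conjI allI impI)
  have "closed {x :: 'p padic. padic_norm x \<le> 1}"
    by (intro closed_Collect_le continuous_intros)
  thus "complete {x :: 'p padic. padic_norm x \<le> 1}" by (simp add: complete_eq_closed)
next
  fix e :: real assume "e > 0"
  then obtain k where k: "(1 / real CARD('p)) ^ k < e"
    using real_arch_pow_inv[of e "1 / real CARD('p)"] one_less_card[where ?'p = 'p] by auto
  have "{x :: 'p padic. padic_norm x \<le> 1} \<subseteq> (\<Union>x\<in>of_nat ` {..<CARD('p) ^ k}. ball x e)"
  proof
    fix x :: "'p padic" assume "x \<in> {x. padic_norm x \<le> 1}"
    then obtain a where a: "a < CARD('p) ^ k" "padic_norm (x - of_nat a) \<le> (1 / real CARD('p)) ^ k"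
      using padic_unit_ball_approx[of x k] by auto
    hence "x \<in> ball (of_nat a) e" using k padic_norm_minus[of "x - of_nat a"] by (simp add: dist_padic_def)
    thus "x \<in> (\<Union>x\<in>of_nat ` {..<CARD('p) ^ k}. ball x e)" using a(1) by auto
  qed
  thus "\<exists>K. finite K \<and> {x :: 'p padic. padic_norm x \<le> 1} \<subseteq> (\<Union>x\<in>K. ball x e)" by blast
qed

section \<open>Traces and Lie ideals in central division algebras\<close>

text \<open>Characteristic 0 lets ranks be read off from traces and keeps the dimension, the trace
  of left multiplication by 1, nonzero in the base field.\<close>

locale central_division_algebra_char_0 = central_division_algebra smul Basis
  for smul :: "'k::field_char_0 \<Rightarrow> 'd::division_ring \<Rightarrow> 'd" and Basis :: "'d set"
begin

abbreviation lin :: "('d \<Rightarrow> 'd) \<Rightarrow> bool" where "lin \<equiv> Vector_Spaces.linear smul smul"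
abbreviation coord :: "'d \<Rightarrow> 'd \<Rightarrow> 'k" where "coord \<equiv> representation Basis"

lemma lin_iff: "lin f \<longleftrightarrow> (\<forall>x y. f (x + y) = f x + f y) \<and> (\<forall>c x. f (smul c x) = smul c (f x))"
  unfolding Vector_Spaces.linear_iff using vector_space_axioms by blast

lemma lin_add: "lin f \<Longrightarrow> f (x + y) = f x + f y"
  and lin_smul: "lin f \<Longrightarrow> f (smul c x) = smul c (f x)"
  by (simp_all add: lin_iff)

lemma lin_0: "lin f \<Longrightarrow> f 0 = 0"
  using lin_smul[of f 0 0] by simp

lemma lin_diff: "lin f \<Longrightarrow> f (x - y) = f x - f y"
  using lin_add[of f "x - y" y] by (simp add: algebra_simps)

lemma lin_minus: "lin f \<Longrightarrow> f (- x) = - f x"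
  using lin_diff[of f 0 x] by (simp add: lin_0)

lemma lin_sum: "lin f \<Longrightarrow> f (sum g I) = (\<Sum>i\<in>I. f (g i))"
  by (induction I rule: infinite_finite_induct) (simp_all add: lin_0 lin_add)

lemma lin_comp: "lin f \<Longrightarrow> lin g \<Longrightarrow> lin (\<lambda>x. f (g x))"
  by (simp add: lin_iff)

lemma lin_pow: "lin f \<Longrightarrow> lin (f ^^ n)"
  by (induction n) (simp_all add: lin_iff)

lemma in_span_Basis [simp]: "x \<in> span Basis"
  using span_Basis by auto

lemma coord_add: "coord (x + y) b = coord x b + coord y b"
  by (simp add: representation_add independent_Basis)

lemma coord_smul: "coord (smul c x) b = c * coord x b"
  by (simp add: representation_scale independent_Basis)

lemma coord_0 [simp]: "coord 0 b = 0"
  using coord_smul[of 0 0 b] by simp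

lemma coord_minus: "coord (- x) b = - coord x b"
  using coord_add[of x "- x" b] by (simp add: eq_neg_iff_add_eq_0 add.commute)

lemma coord_diff: "coord (x - y) b = coord x b - coord y b"
  using coord_add[of x "- y" b] by (simp add: coord_minus)

lemma coord_sum: "coord (sum f I) b = (\<Sum>i\<in>I. coord (f i) b)"
  by (induction I rule: infinite_finite_induct) (simp_all add: coord_add)

lemma coord_Basis: "b \<in> Basis \<Longrightarrow> coord b c = (if b = c then 1 else 0)"
  by (simp add: representation_basis independent_Basis)

lemma coord_expand: "(\<Sum>b\<in>Basis. smul (coord x b) b) = x"
  by (rule sum_representation_eq) (simp_all add: independent_Basis finite_Basis)

lemma coord_eqI: "(\<And>b. b \<in> Basis \<Longrightarrow> coord x b = coord y b) \<Longrightarrow> x = y"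
  by (metis (no_types, lifting) coord_expand sum.cong)

lemma lin_expand: "lin f \<Longrightarrow> f x = (\<Sum>b\<in>Basis. smul (coord x b) (f b))"
  by (subst coord_expand[of x, symmetric]) (simp add: lin_sum lin_smul del: coord_expand)

lemma Basis_nonempty: "Basis \<noteq> {}"
  using coord_expand[of 1] by auto

lemma card_Basis_ne_0: "of_nat (card Basis) \<noteq> (0 :: 'k)"
  using Basis_nonempty finite_Basis by simp

section \<open>Traces of linear maps and a trace criterion for nilpotency\<close>

definition tr :: "('d \<Rightarrow> 'd) \<Rightarrow> 'k" where
  "tr f = (\<Sum>b\<in>Basis. coord (f b) b)"

lemma tr_add: "tr (\<lambda>x. f x + g x) = tr f + tr g"
  by (simp add: tr_def coord_add sum.distrib)

lemma tr_diff: "tr (\<lambda>x. f x - g x) = tr f - tr g"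
  by (simp add: tr_def coord_diff sum_subtractf)

lemma tr_smul: "tr (\<lambda>x. smul c (f x)) = c * tr f"
  by (simp add: tr_def coord_smul sum_distrib_left)

lemma tr_zero: "tr (\<lambda>x. 0) = 0"
  by (simp add: tr_def)

lemma tr_comp_commute:
  assumes "lin f" "lin g"
  shows "tr (\<lambda>x. f (g x)) = tr (\<lambda>x. g (f x))"
proof -
  have e: "tr (\<lambda>x. f (g x)) = (\<Sum>b\<in>Basis. \<Sum>c\<in>Basis. coord (g b) c * coord (f c) b)" if "lin f" for f g
    unfolding tr_def by (subst lin_expand[OF that]) (simp add: coord_sum coord_smul)
  show ?thesis
    unfolding e[OF assms(1)] e[OF assms(2)] by (subst sum.swap) (simp add: mult.commute)
qed

text \<open>Both sides are the same double sum over pairs from \<open>Basis\<close> and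
  \<open>C\<close>, read once by expanding \<open>b\<close> in \<open>C\<close> and once by
  expanding \<open>f c\<close> in \<open>Basis\<close>. An idempotent calls for a basis adapted to
  its range.\<close>

lemma tr_other_basis:
  assumes C: "independent C" "span C = UNIV" and f: "lin f"
  shows "tr f = (\<Sum>c\<in>C. representation C (f c) c)"
proof -
  have fin: "finite C" using C(1) by (rule finiteI_independent)
  have CE: "(\<Sum>c\<in>C. smul (representation C x c) c) = x" for x
    by (rule sum_representation_eq) (simp_all add: C fin)
  have "tr f = (\<Sum>b\<in>Basis. \<Sum>c\<in>C. representation C b c * coord (f c) b)"
  proof -
    have "f b = (\<Sum>c\<in>C. smul (representation C b c) (f c))" for b
      by (subst CE[of b, symmetric]) (simp only: lin_sum[OF f] lin_smul[OF f])
    thus ?thesis unfolding tr_def by (metis (no_types, lifting) coord_smul coord_sum sum.cong)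
  qed
  also have "\<dots> = (\<Sum>c\<in>C. \<Sum>b\<in>Basis. coord (f c) b * representation C b c)"
    by (subst sum.swap) (simp add: mult.commute)
  also have "\<dots> = (\<Sum>c\<in>C. representation C (f c) c)"
  proof (rule sum.cong[OF refl])
    fix c
    have "representation C (f c) c = representation C (\<Sum>b\<in>Basis. smul (coord (f c) b) b) c"
      by (simp only: coord_expand)
    also have "\<dots> = (\<Sum>b\<in>Basis. coord (f c) b * representation C b c)"
      by (simp add: representation_sum representation_scale C)
    finally show "(\<Sum>b\<in>Basis. coord (f c) b * representation C b c) = representation C (f c) c" by simp
  qed
  finally show ?thesis .
qed

text \<open>The trace of a projection is its rank. In a basis \<open>C\<close> extending a basis
  \<open>C1\<close> of the range, \<open>f\<close> fixes \<open>C1\<close> and sends the other basis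
  vectors into the span of \<open>C1\<close>, so the diagonal sums to \<open>card C1\<close>;
  characteristic 0 then forces \<open>C1\<close> to be empty.\<close>

lemma idempotent_tr_0:
  assumes f: "lin f" and idem: "\<And>x. f (f x) = f x" and tr0: "tr f = 0"
  shows "f x = 0"
proof (rule ccontr)
  assume x: "f x \<noteq> 0"
  obtain C1 where C1: "C1 \<subseteq> range f" "independent C1" "range f \<subseteq> span C1"
    using maximal_independent_subset[of "range f"] by auto
  obtain C where C: "C1 \<subseteq> C" "independent C" "UNIV \<subseteq> span C"
    using maximal_independent_subset_extend[of C1 UNIV] C1 by auto
  have fin: "finite C" using C(2) by (rule finiteI_independent)
  have sC: "span C = UNIV" using C by auto
  have "representation C (f c) c = (if c \<in> C1 then 1 else 0)" if c: "c \<in> C" for c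
  proof (cases "c \<in> C1")
    case True
    hence "f c = c" using C1 idem by auto
    thus ?thesis using True c C by (simp add: representation_basis)
  next
    case False
    have "representation C (f c) = representation C1 (f c)"
      using C C1 by (intro representation_extend) auto
    thus ?thesis using False representation_ne_zero by auto
  qed
  hence "tr f = (\<Sum>c\<in>C. if c \<in> C1 then 1 else 0)"
    using tr_other_basis[OF C(2) sC f] by simp
  also have "\<dots> = of_nat (card C1)"
    using fin C by (simp add: sum.If_cases Int_absorb1)
  finally have "card C1 = 0" using tr0 by simp
  hence "C1 = {}" using fin C finite_subset by fastforce
  with C1(3) x show False by auto
qed

text \<open>The polynomials in the operator \<open>A\<close>, generated by Horner's scheme; as plain
  functions they can be composed and traced directly.\<close>

inductive pol :: "('d \<Rightarrow> 'd) \<Rightarrow> ('d \<Rightarrow> 'd) \<Rightarrow> bool" for A :: "'d \<Rightarrow> 'd" where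
  pol_0: "pol A (\<lambda>x. 0)"
| pol_Horner: "pol A f \<Longrightarrow> pol A (\<lambda>x. smul c x + A (f x))"

context
  fixes A :: "'d \<Rightarrow> 'd" assumes A: "lin A"
begin

lemma pol_lin: "pol A f \<Longrightarrow> lin f"
  by (induction rule: pol.induct)
     (auto simp: lin_iff lin_add[OF A] lin_smul[OF A] scale_right_distrib mult.commute)

lemma pol_commute: "pol A f \<Longrightarrow> f (A x) = A (f x)"
  by (induction arbitrary: x rule: pol.induct) (auto simp: lin_0[OF A] lin_add[OF A] lin_smul[OF A])

lemma pol_commute_pow: "pol A f \<Longrightarrow> f ((A ^^ n) x) = (A ^^ n) (f x)"
  by (induction n) (auto simp: pol_commute)

lemma pol_A: "pol A f \<Longrightarrow> pol A (\<lambda>x. A (f x))"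
  using pol_Horner[of A f 0] by simp

lemma pol_id: "pol A (\<lambda>x. x)"
  using pol_Horner[OF pol_0, of A 1] by (simp add: lin_0[OF A])

lemma pol_smul: "pol A f \<Longrightarrow> pol A (\<lambda>x. smul c (f x))"
proof (induction rule: pol.induct)
  case (pol_Horner f a)
  have "(\<lambda>x. smul c (smul a x + A (f x))) = (\<lambda>x. smul (c * a) x + A (smul c (f x)))"
    by (simp add: scale_right_distrib lin_smul[OF A])
  thus ?case using pol.pol_Horner[OF pol_Horner.IH, of "c * a"] by simp
qed (simp add: pol.pol_0)

lemma pol_add: "pol A f \<Longrightarrow> pol A g \<Longrightarrow> pol A (\<lambda>x. f x + g x)"
proof (induction arbitrary: g rule: pol.induct)
  case (pol_Horner f a)
  note IH = pol_Horner.IH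
  from pol_Horner.prems show ?case
  proof (cases rule: pol.cases)
    case pol_0
    thus ?thesis using pol.pol_Horner[OF pol_Horner.hyps, of a] by simp
  next
    case (pol_Horner h b)
    have "(\<lambda>x. smul a x + A (f x) + g x) = (\<lambda>x. smul (a + b) x + A (f x + h x))"
      by (simp add: pol_Horner(1) lin_add[OF A] scale_left_distrib add_ac)
    thus ?thesis using pol.pol_Horner[OF IH[OF pol_Horner(2)], of "a + b"] by simp
  qed
qed simp

lemma pol_diff: "pol A f \<Longrightarrow> pol A g \<Longrightarrow> pol A (\<lambda>x. f x - g x)"
  using pol_add[of f "\<lambda>x. smul (-1) (g x)"] pol_smul[of g "-1"] by simp

lemma pol_comp: "pol A f \<Longrightarrow> pol A g \<Longrightarrow> pol A (\<lambda>x. f (g x))"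
  by (induction rule: pol.induct) (auto intro: pol_0 pol_add pol_smul pol_A)

lemma pol_sum: "(\<And>i. i \<in> I \<Longrightarrow> pol A (f i)) \<Longrightarrow> pol A (\<lambda>x. \<Sum>i\<in>I. f i x)"
  by (induction I rule: infinite_finite_induct) (auto intro: pol_0 pol_add)

lemma pol_pow: "pol A f \<Longrightarrow> pol A (f ^^ n)"
  by (induction n) (auto simp: comp_def id_def intro: pol_comp pol_id)

lemma pol_commutes: "pol A f \<Longrightarrow> pol A g \<Longrightarrow> f (g x) = g (f x)"
  by (induction arbitrary: x rule: pol.induct)
     (auto simp: lin_0[OF pol_lin] lin_add[OF pol_lin] lin_smul[OF pol_lin] pol_commute)

text \<open>With at least one factor \<open>A\<close> in front, a polynomial in \<open>A\<close> is
  a combination of powers of positive exponent; the trace of the identity never occurs.\<close>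

lemma tr_pol:
  assumes tr: "\<And>j. j \<ge> 1 \<Longrightarrow> tr (A ^^ j) = 0"
  shows "pol A f \<Longrightarrow> j \<ge> 1 \<Longrightarrow> tr (\<lambda>x. (A ^^ j) (f x)) = 0"
proof (induction arbitrary: j rule: pol.induct)
  case pol_0
  thus ?case by (simp add: lin_0[OF lin_pow[OF A]] tr_zero)
next
  case (pol_Horner f c)
  have "(\<lambda>x. (A ^^ j) (smul c x + A (f x))) = (\<lambda>x. smul c ((A ^^ j) x) + (A ^^ Suc j) (f x))"
    by (simp add: lin_add[OF lin_pow[OF A]] lin_smul[OF lin_pow[OF A]] funpow_Suc_right del: funpow.simps)
  thus ?case using tr[OF pol_Horner.prems] pol_Horner.IH[of "Suc j"]
    by (simp add: tr_add tr_smul del: funpow.simps)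
qed

text \<open>The first relation between the iterates of \<open>v\<close> under \<open>A\<close>, solved for its lowest term.\<close>

lemma cyclic_relation: "\<exists>m s. pol A s \<and> (A ^^ m) v = (A ^^ Suc m) (s v)"
proof (cases "inj_on (\<lambda>i. (A ^^ i) v) {..card Basis}")
  case False
  then obtain i j where ij: "i < j" "(A ^^ i) v = (A ^^ j) v"
    unfolding inj_on_def by (metis linorder_neqE_nat)
  have "(A ^^ (Suc i + (j - Suc i))) v = (A ^^ Suc i) ((A ^^ (j - Suc i)) v)"
    by (simp only: funpow_add comp_apply)
  hence "(A ^^ Suc i) ((A ^^ (j - Suc i)) v) = (A ^^ j) v" using ij(1) by simp
  moreover have "pol A (A ^^ (j - Suc i))"
    using pol_pow[OF pol_A[OF pol_id]] by simp
  ultimately show ?thesis using ij(2) by metis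
next
  \<comment> \<open>The dimension bound applies to sets of vectors, so repeated iterates are dealt
    with separately; here the \<open>card Basis + 1\<close> iterates are distinct, hence
    dependent.\<close>
  case True
  define S where "S = (\<lambda>i. (A ^^ i) v) ` {..card Basis}"
  have "card S = Suc (card Basis)" unfolding S_def using card_image[OF True] by simp
  hence "\<not> independent S" using independent_card_le_dim[of S UNIV] by auto
  then obtain u w where u: "(\<Sum>x\<in>S. smul (u x) x) = 0" "w \<in> S" "u w \<noteq> 0"
    using independent_explicit[of S] by (auto simp: S_def)
  define c where "c i = u ((A ^^ i) v)" for i
  have sum0: "(\<Sum>i\<le>card Basis. smul (c i) ((A ^^ i) v)) = 0"
    using u(1) unfolding S_def by (subst (asm) sum.reindex[OF True]) (simp add: c_def)
  obtain i0 where i0: "i0 \<le> card Basis" "c i0 \<noteq> 0" using u unfolding S_def c_def by auto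
  define m where "m = (LEAST i. c i \<noteq> 0)"
  have m: "c m \<noteq> 0" "m \<le> card Basis"
    unfolding m_def using LeastI[of "\<lambda>i. c i \<noteq> 0", OF i0(2)] Least_le[of "\<lambda>i. c i \<noteq> 0", OF i0(2)] i0(1)
    by (blast intro: order.trans)+
  have m0: "c i = 0" if "i < m" for i
    using not_less_Least[of i "\<lambda>i. c i \<noteq> 0"] that unfolding m_def by blast
  define s where "s = (\<lambda>x. \<Sum>i\<in>{m<..card Basis}. smul (- c i / c m) ((A ^^ (i - Suc m)) x))"
  have s: "pol A s" unfolding s_def
    by (intro pol_sum pol_smul) (use pol_pow[OF pol_A[OF pol_id]] in simp)
  have "{..card Basis} = {..<m} \<union> ({m} \<union> {m<..card Basis})" using m by auto
  hence "0 = (\<Sum>i\<in>{..<m} \<union> ({m} \<union> {m<..card Basis}). smul (c i) ((A ^^ i) v))" using sum0 by simp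
  also have "\<dots> = smul (c m) ((A ^^ m) v) + (\<Sum>i\<in>{m<..card Basis}. smul (c i) ((A ^^ i) v))"
    using m0 by (subst sum.union_disjoint; (subst sum.union_disjoint)?) auto
  finally have "smul (c m) ((A ^^ m) v) = (\<Sum>i\<in>{m<..card Basis}. smul (- c i) ((A ^^ i) v))"
    by (simp add: sum_negf eq_neg_iff_add_eq_0)
  hence "smul (inverse (c m)) (smul (c m) ((A ^^ m) v)) =
      smul (inverse (c m)) (\<Sum>i\<in>{m<..card Basis}. smul (- c i) ((A ^^ i) v))" by simp
  hence "(A ^^ m) v = (\<Sum>i\<in>{m<..card Basis}. smul (- c i / c m) ((A ^^ i) v))"
    using m(1) by (simp add: scale_sum_right field_simps)
  also have "\<dots> = (A ^^ Suc m) (s v)"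
  proof -
    have "(A ^^ Suc m) ((A ^^ (i - Suc m)) v) = (A ^^ i) v" if "i \<in> {m<..card Basis}" for i
    proof -
      have "(A ^^ (Suc m + (i - Suc m))) v = (A ^^ Suc m) ((A ^^ (i - Suc m)) v)"
        by (simp only: funpow_add comp_apply)
      moreover have "Suc m + (i - Suc m) = i" using that by simp
      ultimately show ?thesis by (simp only:)
    qed
    thus ?thesis unfolding s_def
      by (simp add: lin_sum[OF lin_pow[OF A]] lin_minus[OF lin_pow[OF A]] lin_smul[OF lin_pow[OF A]]
        del: funpow.simps)
  qed
  finally show ?thesis using s by blast
qed

text \<open>Relations combine by multiplication: \<open>1 - A h = (1 - A t) (1 - A s)\<close> for
  the \<open>h\<close> below. Polynomials in \<open>A\<close> commute, so a vector killed by
  \<open>A ^^ m\<close> after one factor, or by \<open>A ^^ n\<close> after the other, is killed by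
  \<open>A ^^ (m + n)\<close> after the product.\<close>

lemma pol_relation:
  "finite S \<Longrightarrow> \<exists>m s. pol A s \<and> (\<forall>v\<in>S. (A ^^ m) v = (A ^^ Suc m) (s v))"
proof (induction S rule: finite_induct)
  case empty
  show ?case using pol_id by blast
next
  case (insert w S)
  obtain m s where s: "pol A s" "\<forall>v\<in>S. (A ^^ m) v = (A ^^ Suc m) (s v)" using insert.IH by blast
  obtain n t where t: "pol A t" "(A ^^ n) w = (A ^^ Suc n) (t w)" using cyclic_relation by blast
  define f where "f x = x - A (s x)" for x
  define g where "g x = x - A (t x)" for x
  define h where "h x = s x + (t x - t (A (s x)))" for x
  have pf: "pol A f" and pg: "pol A g" and ph: "pol A h"
    unfolding f_def g_def h_def by (intro pol_diff pol_add pol_A pol_comp[OF t(1)] pol_id s t)+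
  have fg: "v - A (h v) = g (f v)" for v
    by (simp add: f_def g_def h_def lin_diff[OF A] lin_add[OF A] lin_diff[OF pol_lin[OF t(1)]])
  have pw: "(A ^^ k) (v - A u) = 0 \<longleftrightarrow> (A ^^ k) v = (A ^^ Suc k) u" for k u v
    by (simp add: lin_diff[OF lin_pow[OF A]] funpow_Suc_right del: funpow.simps)
  have "(A ^^ (m + n)) (v - A (h v)) = 0" if v: "v \<in> insert w S" for v
  proof (cases "v \<in> S")
    case True
    hence "(A ^^ m) (f v) = 0" using s(2) by (simp add: f_def pw)
    hence "g ((A ^^ (n + m)) (f v)) = 0"
      by (simp add: funpow_add lin_0[OF lin_pow[OF A]] lin_0[OF pol_lin[OF pg]])
    thus ?thesis unfolding fg by (simp add: pol_commute_pow[OF pg] add.commute)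
  next
    case False
    hence "(A ^^ n) (g v) = 0" using t(2) v by (simp add: g_def pw)
    hence "f ((A ^^ (m + n)) (g v)) = 0"
      by (simp add: funpow_add lin_0[OF lin_pow[OF A]] lin_0[OF pol_lin[OF pf]])
    thus ?thesis unfolding fg pol_commutes[OF pg pf] by (simp add: pol_commute_pow[OF pf])
  qed
  thus ?case using ph unfolding pw by blast
qed

text \<open>Fitting's idempotent: since \<open>A ^^ m\<close> is unchanged by composition with
  \<open>A s\<close>, the operator \<open>E = (A s) ^^ Suc m\<close> is idempotent and is absorbed
  by \<open>A ^^ m\<close>. As a polynomial without constant term \<open>E\<close> has trace 0, so
  it vanishes, and \<open>A ^^ m\<close> with it.\<close>

lemma nilpotent_if_tr_0:
  assumes tr: "\<And>j. j \<ge> 1 \<Longrightarrow> tr (A ^^ j) = 0"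
  shows "\<exists>m. \<forall>x. (A ^^ m) x = 0"
proof -
  obtain m s where s: "pol A s" "\<forall>v\<in>Basis. (A ^^ m) v = (A ^^ Suc m) (s v)"
    using pol_relation[OF finite_Basis] by blast
  have eq: "(A ^^ m) x = (A ^^ m) (A (s x))" for x
  proof -
    have l: "lin (A ^^ m)" "lin (\<lambda>x. (A ^^ m) (A (s x)))"
      using lin_pow[OF A] A pol_lin[OF s(1)] by (auto simp: lin_iff)
    show ?thesis
      by (subst lin_expand[OF l(1)], subst lin_expand[OF l(2)])
         (use s(2) in \<open>simp add: funpow_Suc_right del: funpow.simps\<close>)
  qed
  define g where "g x = A (s x)" for x
  have g: "pol A g" unfolding g_def by (intro pol_A s)
  have eqj: "(A ^^ m) ((g ^^ j) x) = (A ^^ m) x" for j x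
    by (induction j) (simp_all add: g_def eq[symmetric])
  have gj: "(g ^^ j) x = (A ^^ j) ((s ^^ j) x)" for j x
    by (induction j arbitrary: x)
      (simp_all add: g_def pol_commute_pow[OF s(1)])
  define E where "E = g ^^ Suc m"
  have E: "lin E" unfolding E_def using pol_lin[OF g] by (rule lin_pow)
  have "E (E x) = E x" for x
  proof -
    have "E (E x) = (s ^^ Suc m) ((A ^^ Suc m) (E x))"
      unfolding E_def by (subst gj) (simp add: pol_commute_pow[OF pol_pow[OF s(1)]] del: funpow.simps)
    also have "(A ^^ Suc m) (E x) = (A ^^ Suc m) x"
      using eqj[of "Suc m" x] by (simp add: E_def)
    also have "(s ^^ Suc m) ((A ^^ Suc m) x) = E x"
      unfolding E_def by (subst gj) (simp add: pol_commute_pow[OF pol_pow[OF s(1)]] del: funpow.simps)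
    finally show ?thesis .
  qed
  moreover have "tr E = 0"
  proof -
    have "E = (\<lambda>x. (A ^^ Suc m) ((s ^^ Suc m) x))" unfolding E_def using gj by blast
    thus ?thesis using tr_pol[OF tr pol_pow[OF s(1)], of "Suc m" "Suc m"] by simp
  qed
  ultimately have "E x = 0" for x using idempotent_tr_0[OF E] by blast
  hence "(A ^^ m) x = 0" for x
    using eqj[of "Suc m" x] by (simp add: E_def lin_0[OF lin_pow[OF A]])
  thus ?thesis by blast
qed

end

section \<open>Commutators and the trace of left multiplication\<close>

definition ad :: "'d \<Rightarrow> 'd \<Rightarrow> 'd" where "ad a x = a * x - x * a"

lemma lin_mult_left: "lin (\<lambda>x. a * x)" and lin_mult_right: "lin (\<lambda>x. x * a)"
  by (simp_all add: lin_iff distrib_left distrib_right smul_mult_left smul_mult_right)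

lemma lin_ad: "lin (ad a)"
  by (simp add: lin_iff ad_def algebra_simps smul_mult_left smul_mult_right scale_right_diff_distrib)

lemma ad_Leibniz: "ad a (x * y) = ad a x * y + x * ad a y"
  by (simp add: ad_def algebra_simps)

lemma center_iff: "(\<forall>x. z * x = x * z) \<longleftrightarrow> z \<in> range (\<lambda>c. smul c 1)"
  using center by blast

lemma smul_eq_mult: "smul c x = smul c 1 * x"
  by (simp add: smul_mult_left)

text \<open>The trace of the regular representation. For a central simple algebra it is the degree
  times the reduced trace, so in characteristic 0 both have the same kernel.\<close>

definition ltr :: "'d \<Rightarrow> 'k" where "ltr a = tr (\<lambda>x. a * x)"

lemma ltr_add: "ltr (a + b) = ltr a + ltr b"
  by (simp add: ltr_def distrib_right tr_add)

lemma ltr_diff: "ltr (a - b) = ltr a - ltr b"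
  by (simp add: ltr_def left_diff_distrib tr_diff)

lemma ltr_smul: "ltr (smul c a) = c * ltr a"
  by (simp add: ltr_def smul_mult_left tr_smul)

lemma ltr_commute: "ltr (a * b) = ltr (b * a)"
  using tr_comp_commute[OF lin_mult_left[of a] lin_mult_left[of b]] by (simp add: ltr_def mult.assoc)

lemma ltr_1: "ltr 1 = of_nat (card Basis)"
  by (simp add: ltr_def tr_def coord_Basis)

lemma ltr_ad: "ltr (ad a b) = 0"
  by (simp add: ad_def ltr_diff ltr_commute[of a b])

text \<open>Commutators have trace 0, while 1 has trace \<open>card Basis\<close>, which is nonzero
  in characteristic 0.\<close>

lemma ad_ne_1: "ad a b \<noteq> 1"
  using ltr_ad[of a b] ltr_1 card_Basis_ne_0 by auto

text \<open>Invertibility is decisive: if the nilpotency index is at least 2, some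
  \<open>z = ad a u\<close> is nonzero and commutes with \<open>a\<close>. Then
  \<open>inverse z\<close> commutes with \<open>a\<close> as well, and the derivation
  \<open>ad a\<close> sends \<open>u * inverse z\<close> to 1, which is not a commutator.\<close>

lemma central_if_ad_nilpotent:
  assumes "\<And>x. (ad a ^^ m) x = 0"
  shows "a \<in> range (\<lambda>c. smul c 1)"
proof -
  have "\<exists>m. \<forall>x. (ad a ^^ m) x = 0" using assms by blast
  then obtain n where n: "\<forall>x. (ad a ^^ n) x = 0" "\<And>k. k < n \<Longrightarrow> \<not> (\<forall>x. (ad a ^^ k) x = 0)"
    using exists_least_iff[of "\<lambda>m. \<forall>x. (ad a ^^ m) x = 0"] by auto
  have "n \<le> 1"
  proof (rule ccontr)
    assume "\<not> n \<le> 1"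
    then obtain k where k: "n = Suc (Suc k)" by (metis Suc_le_D not_less_eq_eq One_nat_def)
    obtain x where x: "(ad a ^^ Suc k) x \<noteq> 0" using n(2)[of "Suc k"] k by auto
    define u z where "u = (ad a ^^ k) x" and "z = ad a u"
    have z: "z \<noteq> 0" "ad a z = 0" using x n(1) by (auto simp: u_def z_def k)
    have "ad a z * inverse z + z * ad a (inverse z) = ad a 1"
      using z(1) by (simp flip: ad_Leibniz)
    hence "ad a (inverse z) = 0" using z by (simp add: ad_def)
    hence "ad a (u * inverse z) = 1" using z by (simp add: ad_Leibniz flip: z_def)
    thus False using ad_ne_1 by blast
  qed
  hence "ad a x = 0" for x
  proof (cases n)
    case 0
    thus ?thesis using n(1) by (metis funpow_0)
  next
    case (Suc k)
    thus ?thesis using n(1) \<open>n \<le> 1\<close> by simp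
  qed
  thus ?thesis unfolding center_iff[symmetric] ad_def by simp
qed

lemma central_if_tr_ad_0:
  assumes "\<And>j. j \<ge> 1 \<Longrightarrow> tr (ad a ^^ j) = 0"
  shows "a \<in> range (\<lambda>c. smul c 1)"
proof -
  obtain m where "\<forall>x. (ad a ^^ m) x = 0"
    using nilpotent_if_tr_0[OF lin_ad assms] by blast
  thus ?thesis by (intro central_if_ad_nilpotent[where m = m]) simp
qed

text \<open>Every element acting into \<open>K\<close> lies in the subring \<open>R\<close> below. If \<open>R\<close> contains a nonzero commutator,
  then \<open>x * [b, a] = [x * b, a] - [x, a] * b\<close> shows that \<open>R\<close> is everything.\<close>

lemma Lie_ideal_dichotomy:
  assumes K: "\<And>x y. x \<in> K \<Longrightarrow> y \<in> K \<Longrightarrow> x + y \<in> K" and ideal: "\<And>a x. a \<in> K \<Longrightarrow> ad a x \<in> K"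
    and neg: "\<And>x. x \<in> K \<Longrightarrow> - x \<in> K"
  shows "K \<subseteq> range (\<lambda>c. smul c 1) \<or> (\<forall>x y. ad x y \<in> K)"
proof -
  \<comment> \<open>\<open>R\<close> contains \<open>K\<close> because \<open>K\<close> is a Lie
    ideal, and it is closed under products, which \<open>K\<close> need not be, because
    \<open>ad (a * b) x = ad a (b * x) + ad b (x * a)\<close>.\<close>
  define R where "R = {a. \<forall>x. ad a x \<in> K}"
  have KR: "K \<subseteq> R" using ideal by (auto simp: R_def)
  have Rmult: "a * b \<in> R" if "a \<in> R" "b \<in> R" for a b
  proof -
    have "ad (a * b) x = ad a (b * x) + ad b (x * a)" for x by (simp add: ad_def algebra_simps)
    thus ?thesis using that K by (simp add: R_def)
  qed
  have Rdiff: "a - b \<in> R" if "a \<in> R" "b \<in> R" for a b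
  proof -
    have "ad (a - b) x = ad a x + - ad b x" for x by (simp add: ad_def algebra_simps)
    moreover have "ad a x + - ad b x \<in> K" for x using that by (intro K neg) (auto simp: R_def)
    ultimately show ?thesis by (simp add: R_def)
  qed
  have Rad: "ad x a \<in> R" if "a \<in> R" for a x
  proof -
    have "ad x a = - ad a x" by (simp add: ad_def)
    thus ?thesis using that KR neg by (auto simp: R_def)
  qed
  show ?thesis
  proof (cases "\<exists>a\<in>R. \<exists>b\<in>R. ad b a \<noteq> 0")
    case True
    then obtain a b where ab: "a \<in> R" "b \<in> R" "ad b a \<noteq> 0" by blast
    have "x \<in> R" for x
    proof -
      define y where "y = x * inverse (ad b a)"
      have "y * ad b a = ad (y * b) a - ad y a * b" by (simp add: ad_def algebra_simps)
      also have "\<dots> \<in> R" by (intro Rdiff Rmult Rad ab)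
      finally show ?thesis using ab(3) by (simp add: y_def mult.assoc)
    qed
    thus ?thesis by (auto simp: R_def)
  next
    case False
    \<comment> \<open>All commutators inside \<open>R\<close> vanish here. For \<open>a\<close> in
      \<open>K\<close> both \<open>a\<close> and \<open>ad a x\<close> lie in \<open>R\<close>,
      hence \<open>ad a\<close> squares to 0.\<close>
    have "a \<in> range (\<lambda>c. smul c 1)" if a: "a \<in> K" for a
    proof (rule central_if_ad_nilpotent[where m = 2])
      fix x
      have "ad a (ad a x) = 0" using False a ideal KR by blast
      thus "(ad a ^^ 2) x = 0" by (simp add: numeral_2_eq_2)
    qed
    thus ?thesis by blast
  qed
qed

text \<open>The trace form is nondegenerate: for \<open>z \<noteq> w\<close> the argument
  \<open>inverse (z - w)\<close> separates the functionals of \<open>z\<close> and \<open>w\<close>,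
  since \<open>ltr 1 \<noteq> 0\<close>. The map \<open>h\<close> encodes the functional of
  \<open>z\<close> by its values on \<open>Basis\<close>, so injectivity gives surjectivity.\<close>

lemma functional_eq_ltr:
  assumes add: "\<And>x y. l (x + y) = l x + l y" and scale: "\<And>c x. l (smul c x) = c * l x"
  obtains z where "\<And>x. l x = ltr (z * x)"
proof -
  define h where "h z = (\<Sum>b\<in>Basis. smul (ltr (z * b)) b)" for z
  have ch: "coord (h z) b = ltr (z * b)" if "b \<in> Basis" for z b
    using that finite_Basis by (simp add: h_def coord_sum coord_smul coord_Basis if_distrib sum.delta cong: if_cong)
  have h: "lin h"
    by (simp add: lin_iff h_def distrib_right ltr_add scale_left_distrib sum.distrib smul_mult_left
        ltr_smul scale_sum_right)
  have expand: "f x = (\<Sum>b\<in>Basis. coord x b * f b)"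
    if "\<And>x y. f (x + y) = f x + f y" "\<And>c x. f (smul c x) = c * f x" for f :: "'d \<Rightarrow> 'k" and x
  proof -
    have "f 0 = 0" using that(2)[of 0 0] by simp
    hence "f (sum g S) = (\<Sum>i\<in>S. f (g i))" for g :: "'d \<Rightarrow> 'd" and S
      by (induction S rule: infinite_finite_induct) (simp_all add: that)
    hence "f (\<Sum>b\<in>Basis. smul (coord x b) b) = (\<Sum>b\<in>Basis. coord x b * f b)" by (simp add: that)
    thus ?thesis by (simp add: coord_expand)
  qed
  have exl: "ltr (z * x) = (\<Sum>b\<in>Basis. coord x b * ltr (z * b))" for z x
    by (rule expand[of "\<lambda>x. ltr (z * x)"]) (simp_all add: distrib_left ltr_add smul_mult_right ltr_smul)
  have "inj h"
  proof (rule injI)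
    fix z w assume "h z = h w"
    hence "ltr (z * b) = ltr (w * b)" if "b \<in> Basis" for b using ch that by metis
    hence e: "ltr (z * x) = ltr (w * x)" for x unfolding exl[of z x] exl[of w x] by simp
    show "z = w"
    proof (rule ccontr)
      assume "z \<noteq> w"
      hence "ltr ((z - w) * inverse (z - w)) \<noteq> 0" using ltr_1 card_Basis_ne_0 by simp
      moreover have "ltr ((z - w) * inverse (z - w)) = 0" using e by (simp add: left_diff_distrib ltr_diff)
      ultimately show False by blast
    qed
  qed
  hence "surj h" using linear_inj_imp_surj[OF h] by blast
  then obtain z where "h z = (\<Sum>b\<in>Basis. smul (l b) b)" by (metis surj_def)
  hence "ltr (z * b) = l b" if "b \<in> Basis" for b
    using that finite_Basis ch[OF that, of z]
    by (simp add: coord_sum coord_smul coord_Basis if_distrib sum.delta cong: if_cong)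
  hence "l x = ltr (z * x)" for x unfolding exl[of z x] expand[of l x, OF add scale] by simp
  thus ?thesis using that by blast
qed

text \<open>Otherwise some functional vanishes on \<open>K\<close> and is 1 at \<open>y\<close>. It
  has the form \<open>ltr (z * x)\<close>, and vanishing on all commutators makes \<open>z\<close>
  central, so its value at \<open>y\<close> is a multiple of \<open>ltr y\<close>. Hence commutators
  span the trace zero space.\<close>

lemma ltr_0_in_subspace:
  assumes K: "subspace K" and ad: "\<And>x y. ad x y \<in> K" and y: "ltr y = 0"
  shows "y \<in> K"
proof (rule ccontr)
  assume yK: "y \<notin> K"
  obtain S where S: "S \<subseteq> K" "independent S" "K \<subseteq> span S"
    using maximal_independent_subset[of K] by auto
  have sS: "span S = K" using S K by (metis span_minimal subset_antisym)
  have "independent (insert y S)" using S yK sS by (intro independent_insertI) auto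
  then obtain C where C: "insert y S \<subseteq> C" "independent C" "UNIV \<subseteq> span C"
    using maximal_independent_subset_extend[of "insert y S" UNIV] by auto
  define l where "l x = representation C x y" for x
  have sC: "x \<in> span C" for x using C by auto
  have l: "l (a + b) = l a + l b" "l (smul c a) = c * l a" for a b c
    by (simp_all add: l_def representation_add representation_scale C sC)
  obtain z where z: "\<And>x. l x = ltr (z * x)" using functional_eq_ltr[of l] l by blast
  have lK: "l x = 0" if "x \<in> K" for x
  proof -
    have "representation C x = representation S x"
      using C S that by (intro representation_extend) auto
    moreover have "y \<notin> S" using yK S by auto
    ultimately show ?thesis using representation_ne_zero unfolding l_def by metis
  qed
  have "z \<in> range (\<lambda>c. smul c 1)"
    unfolding center_iff[symmetric]
  proof
    fix b
    have "ltr (ad z b * a) = 0" for a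
    proof -
      have "ltr (ad z b * a) = ltr (z * ad b a)"
        using ltr_commute[of b "z * a"] by (simp add: ad_def algebra_simps ltr_diff)
      also have "\<dots> = 0" using lK[OF ad] z by metis
      finally show ?thesis .
    qed
    from this[of "inverse (ad z b)"] have "ad z b = 0" using ltr_1 card_Basis_ne_0 by (cases "ad z b = 0") auto
    thus "z * b = b * z" by (simp add: ad_def)
  qed
  then obtain c where "z = smul c 1" by auto
  hence "l y = 0" using y z by (simp add: smul_mult_left ltr_smul)
  moreover have "l y = 1" using C by (simp add: l_def representation_basis)
  ultimately show False by simp
qed

end

section \<open>Normed division algebras over the \<open>p\<close>-adic numbers\<close>

locale padic_division_algebra = central_division_algebra_char_0 smul Basis
  for smul :: "'p::prime_card padic \<Rightarrow> 'd::division_ring \<Rightarrow> 'd" and Basis :: "'d set"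
begin

section \<open>Ultrametric norms from coordinates\<close>

definition mnorm :: "'d \<Rightarrow> real" where "mnorm x = Max ((\<lambda>b. padic_norm (coord x b)) ` Basis)"

lemma coord_le_mnorm: "b \<in> Basis \<Longrightarrow> padic_norm (coord x b) \<le> mnorm x"
  unfolding mnorm_def using finite_Basis by (intro Max_ge) auto

lemma mnorm_le_iff: "mnorm x \<le> r \<longleftrightarrow> (\<forall>b\<in>Basis. padic_norm (coord x b) \<le> r)"
  unfolding mnorm_def using finite_Basis Basis_nonempty by (subst Max_le_iff) auto

lemma mnorm_attained: obtains b where "b \<in> Basis" "mnorm x = padic_norm (coord x b)"
proof -
  have "mnorm x \<in> (\<lambda>b. padic_norm (coord x b)) ` Basis"
    unfolding mnorm_def using finite_Basis Basis_nonempty by (intro Max_in) auto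
  thus ?thesis using that by auto
qed

lemma mnorm_ge0 [simp]: "mnorm x \<ge> 0"
  by (rule mnorm_attained[of x]) simp

lemma mnorm_eq_0_iff [simp]: "mnorm x = 0 \<longleftrightarrow> x = 0"
proof
  assume "mnorm x = 0"
  hence "coord x b = 0" if "b \<in> Basis" for b
    using coord_le_mnorm[OF that, of x] padic_norm_ge0[of "coord x b"] padic_norm_eq_0_iff[of "coord x b"]
    by linarith
  thus "x = 0" by (intro coord_eqI) simp
next
  assume "x = 0"
  thus "mnorm x = 0" using mnorm_le_iff[of x 0] mnorm_ge0[of x] by (simp add: order_antisym)
qed

lemma mnorm_0 [simp]: "mnorm 0 = 0" by simp

lemma mnorm_smul: "mnorm (smul c x) = padic_norm c * mnorm x"
proof (rule antisym)
  show "mnorm (smul c x) \<le> padic_norm c * mnorm x"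
    by (simp add: mnorm_le_iff coord_smul padic_norm_mult mult_left_mono coord_le_mnorm)
  obtain b where b: "b \<in> Basis" "mnorm x = padic_norm (coord x b)" by (rule mnorm_attained)
  show "padic_norm c * mnorm x \<le> mnorm (smul c x)"
    using coord_le_mnorm[OF b(1), of "smul c x"] by (simp add: b(2) coord_smul padic_norm_mult)
qed

lemma mnorm_ultra: "mnorm (x + y) \<le> max (mnorm x) (mnorm y)"
  unfolding mnorm_le_iff
proof
  fix b assume b: "b \<in> Basis"
  show "padic_norm (coord (x + y) b) \<le> max (mnorm x) (mnorm y)"
    using padic_norm_ultra[of "coord x b" "coord y b"] coord_le_mnorm[OF b, of x] coord_le_mnorm[OF b, of y]
    unfolding coord_add by linarith
qed

lemma mnorm_sum_le: "r \<ge> 0 \<Longrightarrow> (\<And>i. i \<in> I \<Longrightarrow> mnorm (f i) \<le> r) \<Longrightarrow> mnorm (sum f I) \<le> r"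
proof (induction I rule: infinite_finite_induct)
  case (insert i I)
  thus ?case using mnorm_ultra[of "f i" "sum f I"] by fastforce
qed auto

definition mult_bound :: real where
  "mult_bound = Max (insert 1 ((\<lambda>(b, c). mnorm (b * c)) ` (Basis \<times> Basis)))"

lemma mult_bound_ge1: "mult_bound \<ge> 1"
  unfolding mult_bound_def using finite_Basis by (intro Max_ge) auto

lemma mult_boundD: "b \<in> Basis \<Longrightarrow> c \<in> Basis \<Longrightarrow> mnorm (b * c) \<le> mult_bound"
  unfolding mult_bound_def using finite_Basis by (intro Max_ge) auto

lemma mult_expand:
  "x * y = (\<Sum>b\<in>Basis. \<Sum>c\<in>Basis. smul (coord x b * coord y c) (b * c))"
proof -
  have "x * y = (\<Sum>b\<in>Basis. smul (coord x b) b) * (\<Sum>c\<in>Basis. smul (coord y c) c)"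
    by (simp only: coord_expand)
  thus ?thesis by (simp add: sum_product smul_mult_left smul_mult_right mult.commute)
qed

lemma mnorm_mult: "mnorm (x * y) \<le> mult_bound * mnorm x * mnorm y"
  unfolding mult_expand[of x y]
proof (intro mnorm_sum_le)
  fix b c assume bc: "b \<in> Basis" "c \<in> Basis"
  have "mnorm (smul (coord x b * coord y c) (b * c)) =
      mnorm (b * c) * padic_norm (coord x b) * padic_norm (coord y c)"
    by (simp add: mnorm_smul padic_norm_mult)
  also have "\<dots> \<le> mult_bound * mnorm x * mnorm y"
    using bc mult_bound_ge1 by (intro mult_mono mult_boundD coord_le_mnorm mult_nonneg_nonneg) auto
  finally show "mnorm (smul (coord x b * coord y c) (b * c)) \<le> mult_bound * mnorm x * mnorm y" .
qed (use mult_bound_ge1 in auto)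

text \<open>The factor makes the coordinate norm submultiplicative. In general this is not the
  valuation of the division algebra: conjugation need not preserve it, and \<open>nm 1\<close> may
  exceed 1, which accounts for the factors \<open>nm 1\<close> in later bounds.\<close>

definition nm :: "'d \<Rightarrow> real" where "nm x = mult_bound * mnorm x"

lemma nm_ge0 [simp]: "nm x \<ge> 0" and nm_eq_0_iff [simp]: "nm x = 0 \<longleftrightarrow> x = 0"
  using mult_bound_ge1 by (auto simp: nm_def)

lemma nm_0 [simp]: "nm 0 = 0" by simp

lemma nm_pos: "x \<noteq> 0 \<Longrightarrow> nm x > 0"
  using nm_ge0[of x] nm_eq_0_iff[of x] by linarith

lemma nm_smul: "nm (smul c x) = padic_norm c * nm x"
  by (simp add: nm_def mnorm_smul)

lemma nm_minus [simp]: "nm (- x) = nm x"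
  using nm_smul[of "-1" x] by simp

lemma nm_minus_commute: "nm (x - y) = nm (y - x)"
  using nm_minus[of "x - y"] by simp

lemma nm_ultra: "nm (x + y) \<le> max (nm x) (nm y)"
  using mnorm_ultra[of x y] mult_bound_ge1 by (auto simp: nm_def le_max_iff_disj)

lemma nm_add_le: "nm x \<le> r \<Longrightarrow> nm y \<le> r \<Longrightarrow> nm (x + y) \<le> r"
  using nm_ultra[of x y] by linarith

lemma nm_diff_le: "nm x \<le> r \<Longrightarrow> nm y \<le> r \<Longrightarrow> nm (x - y) \<le> r"
  using nm_ultra[of x "- y"] by simp

lemma nm_mult: "nm (x * y) \<le> nm x * nm y"
  using mnorm_mult[of x y] mult_bound_ge1 by (simp add: nm_def mult_left_mono mult_ac)

lemma nm_mult_le: "nm x \<le> r \<Longrightarrow> nm y \<le> s \<Longrightarrow> nm (x * y) \<le> r * s"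
  by (rule order.trans[OF nm_mult mult_mono]) (auto intro: order.trans[OF nm_ge0])

lemma nm_1_ge1: "nm 1 \<ge> 1"
  using nm_mult[of 1 1] nm_pos[of 1] by simp

lemma nm_eqI: "nm (x - y) < nm x \<Longrightarrow> nm y = nm x"
  using nm_ultra[of y "x - y"] nm_diff_le[of x "max (nm x) (nm (x - y))" "x - y"] by fastforce

text \<open>The norm is the absolute value of some coordinate, so division by this coordinate
  reaches the unit sphere. Homogeneous functions can then be studied on the compact sphere.\<close>

lemma mnorm_normalize:
  assumes "x \<noteq> 0" obtains c where "c \<noteq> 0" "mnorm (smul c x) = 1"
proof -
  obtain b where b: "b \<in> Basis" "mnorm x = padic_norm (coord x b)" by (rule mnorm_attained)
  have "coord x b \<noteq> 0" using assms b mnorm_eq_0_iff[of x] by auto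
  thus ?thesis
    by (intro that[of "inverse (coord x b)"]) (auto simp: mnorm_smul b padic_norm_inverse)
qed

section \<open>Convergence, completeness and fixed points\<close>

definition conv :: "(nat \<Rightarrow> 'd) \<Rightarrow> 'd \<Rightarrow> bool" where
  "conv s l \<longleftrightarrow> (\<lambda>n. nm (s n - l)) \<longlonglongrightarrow> 0"

lemma null_mono:
  fixes f g :: "nat \<Rightarrow> real"
  assumes "g \<longlonglongrightarrow> 0" "\<And>n. 0 \<le> f n" "\<forall>\<^sub>F n in sequentially. f n \<le> g n" shows "f \<longlonglongrightarrow> 0"
  by (rule tendsto_sandwich[OF _ _ tendsto_const assms(1)]) (use assms in auto)

lemma null_mono_all:
  fixes f g :: "nat \<Rightarrow> real"
  assumes "g \<longlonglongrightarrow> 0" "\<And>n. 0 \<le> f n" "\<And>n. f n \<le> g n" shows "f \<longlonglongrightarrow> 0"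
  by (rule null_mono[OF assms(1,2)]) (use assms in auto)

lemma conv_add: assumes "conv s x" "conv t y" shows "conv (\<lambda>n. s n + t n) (x + y)"
  unfolding conv_def
proof (rule null_mono_all)
  show "(\<lambda>n. nm (s n - x) + nm (t n - y)) \<longlonglongrightarrow> 0"
    using tendsto_add[OF assms[unfolded conv_def]] by simp
  show "nm (s n + t n - (x + y)) \<le> nm (s n - x) + nm (t n - y)" for n
    using nm_ultra[of "s n - x" "t n - y"] nm_ge0[of "s n - x"] nm_ge0[of "t n - y"]
    unfolding add_diff_add by linarith
qed simp

lemma conv_mult_left: assumes "conv s x" shows "conv (\<lambda>n. a * s n) (a * x)"
  unfolding conv_def
proof (rule null_mono_all)
  show "(\<lambda>n. nm a * nm (s n - x)) \<longlonglongrightarrow> 0"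
    using tendsto_mult_left[OF assms[unfolded conv_def], of "nm a"] by simp
qed (simp_all add: nm_mult flip: right_diff_distrib)

lemma conv_mult_right: assumes "conv s x" shows "conv (\<lambda>n. s n * a) (x * a)"
  unfolding conv_def
proof (rule null_mono_all)
  show "(\<lambda>n. nm (s n - x) * nm a) \<longlonglongrightarrow> 0"
    using tendsto_mult_right[OF assms[unfolded conv_def], of "nm a"] by simp
qed (simp_all add: nm_mult flip: left_diff_distrib)

lemma conv_smul: "conv s x \<Longrightarrow> conv (\<lambda>n. smul c (s n)) (smul c x)"
  using conv_mult_left[of s x "smul c 1"] by (simp add: smul_mult_left)

lemma conv_diff: "conv s x \<Longrightarrow> conv t y \<Longrightarrow> conv (\<lambda>n. s n - t n) (x - y)"
  using conv_add[of s x "\<lambda>n. smul (-1) (t n)" "smul (-1) y"] conv_smul[of t y "-1"] by simp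

lemma conv_unique: assumes "conv s x" "conv s y" shows "x = y"
proof -
  have "conv (\<lambda>n. s n - s n) (x - y)" using assms by (rule conv_diff)
  hence "nm (- (x - y)) = 0" unfolding conv_def by (simp add: LIMSEQ_const_iff del: minus_diff_eq nm_minus)
  thus ?thesis by simp
qed

lemma conv_bound:
  assumes "conv s x" "\<forall>\<^sub>F n in sequentially. nm (s n - y) \<le> e" shows "nm (x - y) \<le> e"
proof (rule ccontr)
  assume "\<not> nm (x - y) \<le> e"
  define d where "d = nm (x - y)"
  have e0: "e < d" using \<open>\<not> nm (x - y) \<le> e\<close> by (simp add: d_def)
  obtain n where "nm (s n - y) \<le> e" using eventually_happens'[OF _ assms(2)] by auto
  hence d: "d > 0" using e0 nm_ge0[of "s n - y"] by linarith
  have "\<forall>\<^sub>F n in sequentially. nm (s n - x) < d"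
    using assms(1) d unfolding conv_def by (rule order_tendstoD)
  with assms(2) have "\<forall>\<^sub>F n in sequentially. False"
  proof eventually_elim
    case (elim n)
    have "nm (x - y) \<le> max (nm (s n - y)) (nm (s n - x))"
      using nm_diff_le[of "s n - y" "max (nm (s n - y)) (nm (s n - x))" "s n - x"] by simp
    thus False using elim e0 unfolding d_def by linarith
  qed
  thus False by simp
qed

lemma nm_chain:
  assumes "\<And>k. k \<ge> n \<Longrightarrow> nm (s (Suc k) - s k) \<le> e" "m \<ge> n" "e \<ge> 0" shows "nm (s m - s n) \<le> e"
  using assms(2)
proof (induction m rule: dec_induct)
  case (step m)
  thus ?case using nm_add_le[of "s (Suc m) - s m" e "s m - s n"] assms(1)[of m] by simp
qed (use assms(3) in simp)

lemma conv_bound_steps: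
  assumes "conv s x" "\<And>k. k \<ge> n \<Longrightarrow> nm (s (Suc k) - s k) \<le> e" "e \<ge> 0" shows "nm (x - s n) \<le> e"
  using nm_chain[of n s e] assms
  by (intro conv_bound[OF assms(1)]) (auto simp: eventually_sequentially)

text \<open>In an ultrametric a chain of steps is no longer than its longest step, so vanishing
  steps already make every coordinate sequence Cauchy.\<close>

lemma convI:
  assumes "(\<lambda>n. nm (s (Suc n) - s n)) \<longlonglongrightarrow> 0" obtains l where "conv s l"
proof -
  have "\<exists>l. (\<lambda>n. coord (s n) b) \<longlonglongrightarrow> l" if b: "b \<in> Basis" for b
  proof -
    have "Cauchy (\<lambda>n. coord (s n) b)"
      unfolding Cauchy_altdef
    proof (intro allI impI)
      fix e :: real assume e: "e > 0"
      have "\<forall>\<^sub>F n in sequentially. nm (s (Suc n) - s n) < e / 2"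
        using assms e by (intro order_tendstoD) auto
      then obtain N where N: "\<And>n. n \<ge> N \<Longrightarrow> nm (s (Suc n) - s n) < e / 2"
        by (auto simp: eventually_sequentially)
      have "dist (coord (s m) b) (coord (s n) b) < e" if "m \<ge> N" "m < n" for m n
      proof -
        have "nm (s n - s m) \<le> e / 2"
          using N that e by (intro nm_chain[of m]) (auto intro: less_imp_le)
        moreover have "padic_norm (coord (s n - s m) b) \<le> nm (s n - s m)"
          using coord_le_mnorm[OF b, of "s n - s m"] mult_bound_ge1
            mult_right_mono[OF mult_bound_ge1, of "mnorm (s n - s m)"] by (simp add: nm_def)
        ultimately show ?thesis
          using e by (subst dist_commute) (simp add: dist_padic_def coord_diff)
      qed
      thus "\<exists>M. \<forall>m\<ge>M. \<forall>n>m. dist (coord (s m) b) (coord (s n) b) < e" by blast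
    qed
    thus ?thesis using Cauchy_convergent by (auto simp: convergent_def)
  qed
  then obtain L where L: "\<And>b. b \<in> Basis \<Longrightarrow> (\<lambda>n. coord (s n) b) \<longlonglongrightarrow> L b" by metis
  define l where "l = (\<Sum>b\<in>Basis. smul (L b) b)"
  have cl: "coord l b = L b" if "b \<in> Basis" for b
    using that finite_Basis
    by (simp add: l_def coord_sum coord_smul coord_Basis if_distrib sum.delta cong: if_cong)
  have "conv s l"
    unfolding conv_def
  proof (rule null_mono_all)
    have "(\<lambda>n. padic_norm (coord (s n - l) b)) \<longlonglongrightarrow> 0" if "b \<in> Basis" for b
      using iffD1[OF tendsto_dist_iff L[OF that]] by (simp add: dist_padic_def coord_diff cl that)
    hence "(\<lambda>n. mult_bound * (\<Sum>b\<in>Basis. padic_norm (coord (s n - l) b))) \<longlonglongrightarrow> mult_bound * (\<Sum>b\<in>Basis. 0)"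
      by (intro tendsto_intros)
    thus "(\<lambda>n. mult_bound * (\<Sum>b\<in>Basis. padic_norm (coord (s n - l) b))) \<longlonglongrightarrow> 0" by simp
    show "nm (s n - l) \<le> mult_bound * (\<Sum>b\<in>Basis. padic_norm (coord (s n - l) b))" for n
      unfolding nm_def using mult_bound_ge1 finite_Basis
      by (intro mult_left_mono) (auto simp: mnorm_le_iff intro!: member_le_sum)
  qed simp
  thus ?thesis using that by blast
qed

lemma contraction_fixed_point:
  assumes r: "r \<ge> 0" and ball: "\<And>x. nm x \<le> r \<Longrightarrow> nm (f x) \<le> r"
    and theta: "0 \<le> \<theta>" "\<theta> < 1"
    and contr: "\<And>x y. nm x \<le> r \<Longrightarrow> nm y \<le> r \<Longrightarrow> nm (f x - f y) \<le> \<theta> * nm (x - y)"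
  obtains x where "nm x \<le> r" "f x = x"
proof -
  define s where "s n = (f ^^ n) 0" for n
  have s: "s (Suc n) = f (s n)" for n by (simp add: s_def)
  have b: "nm (s n) \<le> r" for n by (induction n) (auto simp: s ball r s_def[of 0])
  have d: "nm (s (Suc n) - s n) \<le> \<theta> ^ n * r" for n
  proof (induction n)
    case 0
    show ?case using b[of 1] by (simp add: s_def[of 0])
  next
    case (Suc n)
    have "nm (s (Suc (Suc n)) - s (Suc n)) \<le> \<theta> * nm (s (Suc n) - s n)"
      unfolding s[of "Suc n"] s[of n] using b[of n] b[of "Suc n"] by (intro contr) (auto simp: s)
    also have "\<dots> \<le> \<theta> * (\<theta> ^ n * r)" using theta Suc by (intro mult_left_mono)
    finally show ?case by simp
  qed
  have "(\<lambda>n. \<theta> ^ n * r) \<longlonglongrightarrow> 0 * r" using theta by (intro tendsto_mult LIMSEQ_power_zero) auto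
  hence n0: "(\<lambda>n. nm (s (Suc n) - s n)) \<longlonglongrightarrow> 0"
    by (intro null_mono_all[OF _ _ d]) auto
  then obtain x where x: "conv s x" by (rule convI)
  have nx: "nm x \<le> r" using conv_bound[OF x, of 0 r] b by simp
  have "conv (\<lambda>n. s (Suc n)) (f x)"
    unfolding conv_def
  proof (rule null_mono_all)
    show "(\<lambda>n. nm (s n - x)) \<longlonglongrightarrow> 0" using x by (simp add: conv_def)
    show "nm (s (Suc n) - f x) \<le> nm (s n - x)" for n
      using contr[OF b[of n] nx] theta mult_right_mono[of \<theta> 1 "nm (s n - x)"] unfolding s by simp
  qed simp
  moreover have "conv (\<lambda>n. s (Suc n)) x" using x unfolding conv_def by (rule LIMSEQ_Suc)
  ultimately have "f x = x" by (rule conv_unique)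
  thus ?thesis using that nx by blast
qed

section \<open>Continuity in coordinates and compactness of the unit sphere\<close>

definition elt :: "('d \<Rightarrow> 'p padic) \<Rightarrow> 'd" where "elt v = (\<Sum>b\<in>Basis. smul (v b) b)"

text \<open>The type of \<open>D\<close> carries no topology, so continuity is expressed on
  coordinate families indexed by the whole type, of which \<open>elt\<close> reads the entries in
  \<open>Basis\<close>.\<close>

definition cf :: "('d \<Rightarrow> 'p padic) \<Rightarrow> bool" where "cf F \<longleftrightarrow> continuous_on UNIV (\<lambda>v. F (elt v))"
definition cfv :: "('d \<Rightarrow> 'd) \<Rightarrow> bool" where "cfv g \<longleftrightarrow> (\<forall>b\<in>Basis. cf (\<lambda>x. coord (g x) b))"

lemma coord_elt: "b \<in> Basis \<Longrightarrow> coord (elt v) b = v b"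
  using finite_Basis
  by (simp add: elt_def coord_sum coord_smul coord_Basis if_distrib sum.delta cong: if_cong)

lemma elt_coord: "elt (coord x) = x"
  by (simp add: elt_def coord_expand)

lemma cf_const: "cf (\<lambda>x. c)" by (simp add: cf_def)
lemma cf_coord: "b \<in> Basis \<Longrightarrow> cf (\<lambda>x. coord x b)" by (simp add: cf_def coord_elt)
lemma cf_mult: "cf F \<Longrightarrow> cf G \<Longrightarrow> cf (\<lambda>x. F x * G x)"
  unfolding cf_def by (rule continuous_on_mult')
lemma cf_diff: "cf F \<Longrightarrow> cf G \<Longrightarrow> cf (\<lambda>x. F x - G x)" unfolding cf_def by (intro continuous_intros)
lemma cf_sum: "(\<And>i. i \<in> I \<Longrightarrow> cf (F i)) \<Longrightarrow> cf (\<lambda>x. \<Sum>i\<in>I. F i x)"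
  unfolding cf_def by (intro continuous_intros)
lemma cf_prod: "(\<And>i. i \<in> I \<Longrightarrow> cf (F i)) \<Longrightarrow> cf (\<lambda>x. \<Prod>i\<in>I. F i x)"
  unfolding cf_def by (intro continuous_on_prod')

lemma cfv_const: "cfv (\<lambda>x. c)" by (simp add: cfv_def cf_const)
lemma cfv_id: "cfv (\<lambda>x. x)" by (simp add: cfv_def cf_coord)
lemma cfv_diff: "cfv g \<Longrightarrow> cfv h \<Longrightarrow> cfv (\<lambda>x. g x - h x)" by (simp add: cfv_def coord_diff cf_diff)
lemma cfv_mult: "cfv g \<Longrightarrow> cfv h \<Longrightarrow> cfv (\<lambda>x. g x * h x)"
  unfolding cfv_def mult_expand[of "g _"] coord_sum coord_smul by (intro ballI cf_sum cf_mult cf_const) auto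

lemma cf_ltr: "cf ltr"
proof -
  have "cfv (\<lambda>x. x * b)" for b by (intro cfv_mult cfv_id cfv_const)
  thus ?thesis unfolding ltr_def tr_def by (intro cf_sum) (simp add: cfv_def)
qed

lemma cf_tr_ad: "cf (\<lambda>a. tr (ad a ^^ j))"
proof -
  have "cfv (\<lambda>a. (ad a ^^ j) b)" for b
  proof (induction j)
    case (Suc j)
    thus ?case by (simp add: ad_def cfv_diff cfv_mult cfv_id)
  qed (simp add: cfv_const)
  thus ?thesis unfolding tr_def by (intro cf_sum) (simp add: cfv_def)
qed

text \<open>Coordinates outside \<open>Basis\<close> are pinned to 0, so that the product over the
  whole type is compact by Tychonoff; the finite union of closed conditions says that some
  coordinate has absolute value 1.\<close>

definition sphere_coords :: "('d \<Rightarrow> 'p padic) set" where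
  "sphere_coords = (\<Pi>\<^sub>E b\<in>UNIV. if b \<in> Basis then {c. padic_norm c \<le> 1} else {0}) \<inter>
     (\<Union>b\<in>Basis. {v. padic_norm (v b) \<ge> 1})"

lemma compact_sphere_coords: "compact sphere_coords"
proof -
  have c: "compactin euclidean (\<Pi>\<^sub>E b\<in>UNIV. if b \<in> Basis then {c :: 'p padic. padic_norm c \<le> 1} else {0})"
    unfolding euclidean_product_topology[symmetric]
    by (subst compactin_PiE) (auto simp: compactin_euclidean_iff compact_padic_unit_ball)
  have "closed (\<Union>b\<in>Basis. {v :: 'd \<Rightarrow> 'p padic. padic_norm (v b) \<ge> 1})"
    by (intro closed_UN ballI finite_Basis closed_Collect_le continuous_intros) auto
  with c show ?thesis unfolding sphere_coords_def compactin_euclidean_iff by (rule compact_Int_closed)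
qed

lemma coord_in_sphere_coords: "mnorm x = 1 \<Longrightarrow> coord x \<in> sphere_coords"
proof -
  assume x: "mnorm x = 1"
  obtain b where "b \<in> Basis" "mnorm x = padic_norm (coord x b)" by (rule mnorm_attained)
  moreover have "coord x b = 0" if "b \<notin> Basis" for b
    using that representation_ne_zero by blast
  ultimately show ?thesis using x coord_le_mnorm[of _ x]
    by (auto simp: sphere_coords_def PiE_def Pi_def extensional_def intro!: bexI[of _ b])
qed

lemma cf_bounded: assumes "cf F" obtains C where "C > 0" "\<And>x. mnorm x = 1 \<Longrightarrow> padic_norm (F x) \<le> C"
proof -
  have "compact ((\<lambda>v. padic_norm (F (elt v))) ` sphere_coords)"
    using assms unfolding cf_def
    by (intro compact_continuous_image compact_sphere_coords continuous_intros)
       (auto intro: continuous_on_subset)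
  hence "bounded ((\<lambda>v. padic_norm (F (elt v))) ` sphere_coords)" by (rule compact_imp_bounded)
  then obtain C where C: "\<And>v. v \<in> sphere_coords \<Longrightarrow> padic_norm (F (elt v)) \<le> C"
    unfolding bounded_iff by force
  have "padic_norm (F x) \<le> max 1 C" if "mnorm x = 1" for x
    using C[OF coord_in_sphere_coords[OF that]] by (simp add: elt_coord)
  thus ?thesis using that[of "max 1 C"] by simp
qed

text \<open>The sets \<open>Q m\<close>, on which some \<open>F j\<close> with
  \<open>1 \<le> j \<le> m\<close> exceeds \<open>1 / m\<close>, are open, increase with
  \<open>m\<close> and cover the zero set of \<open>L\<close> on the sphere. One \<open>m\<close>
  from a finite subcover bounds the index from above and the value from below.\<close>

lemma cf_bounded_below:
  fixes F :: "nat \<Rightarrow> 'd \<Rightarrow> 'p padic"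
  assumes F: "\<And>j. cf (F j)" and L: "cf L"
    and ne: "\<And>x. mnorm x = 1 \<Longrightarrow> L x = 0 \<Longrightarrow> \<exists>j\<ge>1. F j x \<noteq> 0"
  obtains m :: nat where "m \<ge> 1"
    "\<And>x. mnorm x = 1 \<Longrightarrow> L x = 0 \<Longrightarrow> \<exists>j. 1 \<le> j \<and> j \<le> m \<and> 1 / real m \<le> padic_norm (F j x)"
proof -
  define S where "S = sphere_coords \<inter> {v. L (elt v) = 0}"
  define Q where "Q m = (\<Union>j\<in>{1..m}. {v. padic_norm (F j (elt v)) > 1 / real m})" for m :: nat
  have "closed {v. L (elt v) = 0}"
    using L unfolding cf_def by (intro closed_Collect_eq continuous_intros)
  hence S: "compact S" unfolding S_def by (intro compact_Int_closed compact_sphere_coords)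
  have mono: "Q m \<subseteq> Q n" if mn: "m \<le> n" for m n
  proof
    fix v assume "v \<in> Q m"
    then obtain j where j: "1 \<le> j" "j \<le> m" "padic_norm (F j (elt v)) > 1 / real m" by (auto simp: Q_def)
    have "1 / real n \<le> 1 / real m" using j mn by (simp add: frac_le)
    hence "1 \<le> j" "j \<le> n" "padic_norm (F j (elt v)) > 1 / real n" using j mn by linarith+
    thus "v \<in> Q n" by (auto simp: Q_def)
  qed
  have Qo: "open (Q m)" for m
    using F unfolding Q_def cf_def by (intro open_UN ballI open_Collect_less continuous_intros) auto
  have cover: "S \<subseteq> (\<Union>m\<in>UNIV. Q m)"
  proof
    fix v assume v: "v \<in> S"
    have "mnorm (elt v) = 1"
    proof (rule antisym)
      show "mnorm (elt v) \<le> 1" using v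
        by (auto simp: mnorm_le_iff coord_elt S_def sphere_coords_def PiE_def Pi_def split: if_splits)
      obtain b where "b \<in> Basis" "padic_norm (v b) \<ge> 1" using v by (auto simp: S_def sphere_coords_def)
      thus "mnorm (elt v) \<ge> 1" using coord_le_mnorm[of b "elt v"] by (simp add: coord_elt)
    qed
    then obtain j where j: "j \<ge> 1" "F j (elt v) \<noteq> 0" using ne[of "elt v"] v by (auto simp: S_def)
    hence pos: "padic_norm (F j (elt v)) > 0"
      using padic_norm_ge0[of "F j (elt v)"] padic_norm_eq_0_iff[of "F j (elt v)"] by linarith
    then obtain n where n: "1 / real (Suc n) < padic_norm (F j (elt v))" by (metis nat_approx_posE)
    have "1 / real (max j (Suc n)) \<le> 1 / real (Suc n)" by (intro divide_left_mono) auto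
    hence "v \<in> Q (max j (Suc n))" using n j unfolding Q_def by (intro UN_I[of j]) auto
    thus "v \<in> (\<Union>m\<in>UNIV. Q m)" by blast
  qed
  obtain C where C: "finite C" "S \<subseteq> (\<Union>m\<in>C. Q m)"
    by (rule compactE_image[OF S Qo cover])
  define m where "m = Max (insert 1 C)"
  have m: "m \<ge> 1" "\<And>n. n \<in> C \<Longrightarrow> n \<le> m" using C(1) by (auto simp: m_def)
  have "S \<subseteq> Q m" using C(2) mono m(2) by blast
  hence "\<exists>j. 1 \<le> j \<and> j \<le> m \<and> 1 / real m \<le> padic_norm (F j x)" if "mnorm x = 1" "L x = 0" for x
  proof -
    have "coord x \<in> S" using coord_in_sphere_coords[OF that(1)] that(2) by (simp add: S_def elt_coord)
    hence "coord x \<in> Q m" using \<open>S \<subseteq> Q m\<close> by blast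
    then obtain j where "1 \<le> j" "j \<le> m" "1 / real m < padic_norm (F j x)"
      by (auto simp: Q_def elt_coord)
    thus ?thesis by (intro exI[of _ j]) simp
  qed
  thus ?thesis using that m(1) by blast
qed

text \<open>Pigeonhole on the residues of the coordinates modulo \<open>p ^ k\<close>; one bound
  serves all sequences at once.\<close>

lemma finite_classes:
  obtains M :: nat where "M > 0" "\<And>f. (\<And>i. i \<le> M \<Longrightarrow> mnorm (f i) \<le> 1) \<Longrightarrow>
     \<exists>i j. i < j \<and> j \<le> M \<and> mnorm (f i - f j) \<le> (1 / real CARD('p)) ^ k"
proof -
  define g where "g x = (\<lambda>b\<in>Basis. SOME a. a < CARD('p) ^ k \<and> padic_norm (coord x b - of_nat a) \<le> (1 / real CARD('p)) ^ k)" for x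
  have g: "g x b < CARD('p) ^ k \<and> padic_norm (coord x b - of_nat (g x b)) \<le> (1 / real CARD('p)) ^ k"
    if "mnorm x \<le> 1" "b \<in> Basis" for x b
  proof -
    have "padic_norm (coord x b) \<le> 1" using that coord_le_mnorm[of b x] by linarith
    hence "\<exists>a. a < CARD('p) ^ k \<and> padic_norm (coord x b - of_nat a) \<le> (1 / real CARD('p)) ^ k"
      by (rule padic_unit_ball_approx[of _ k]) blast
    hence "(\<lambda>a. a < CARD('p) ^ k \<and> padic_norm (coord x b - of_nat a) \<le> (1 / real CARD('p)) ^ k)
        (SOME a. a < CARD('p) ^ k \<and> padic_norm (coord x b - of_nat a) \<le> (1 / real CARD('p)) ^ k)"
      by (rule someI_ex)
    thus ?thesis unfolding g_def restrict_apply'[OF that(2)] .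
  qed
  define Z where "Z = (\<Pi>\<^sub>E b\<in>Basis. {..<CARD('p) ^ k})"
  have Z: "finite Z" unfolding Z_def using finite_Basis by (intro finite_PiE) auto
  have gZ: "g x \<in> Z" if "mnorm x \<le> 1" for x
    using g[OF that] by (auto simp: Z_def g_def)
  have H: "\<exists>i j. i < j \<and> j \<le> card Z \<and> mnorm (f i - f j) \<le> (1 / real CARD('p)) ^ k"
    if f: "\<And>i. i \<le> card Z \<Longrightarrow> mnorm (f i) \<le> 1" for f
  proof -
    have "card ((\<lambda>i. g (f i)) ` {..card Z}) \<le> card Z" using Z gZ f by (intro card_mono) auto
    hence "\<not> inj_on (\<lambda>i. g (f i)) {..card Z}" using card_image[of "\<lambda>i. g (f i)" "{..card Z}"] by auto
    then obtain i j where ij: "i < j" "j \<le> card Z" "g (f i) = g (f j)"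
      unfolding inj_on_def by (metis atMost_iff linorder_neqE_nat)
    have "padic_norm (coord (f i - f j) b) \<le> (1 / real CARD('p)) ^ k" if b: "b \<in> Basis" for b
      using padic_norm_diff[of "coord (f i) b - of_nat (g (f i) b)" "coord (f j) b - of_nat (g (f j) b)"]
        g[of "f i" b] g[of "f j" b] f[of i] f[of j] ij b by (auto simp: coord_diff)
    thus ?thesis using ij by (auto simp: mnorm_le_iff)
  qed
  have "card Z > 0"
    using Z gZ[of 0] by (auto simp: card_gt_0_iff)
  thus ?thesis using H by (rule that)
qed

end

section \<open>The regular norm, roots and the logarithm\<close>

context central_division_algebra_char_0
begin

section \<open>The regular norm\<close>

definition bs :: "'d list" where "bs = (SOME l. set l = Basis \<and> distinct l)"

lemma bs: "set bs = Basis" "distinct bs"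
proof -
  have "set bs = Basis \<and> distinct bs"
    unfolding bs_def by (rule someI_ex) (rule finite_distinct_list[OF finite_Basis])
  thus "set bs = Basis" "distinct bs" by auto
qed

lemma length_bs: "length bs = card Basis"
  using bs distinct_card by metis

lemma bs_nth_Basis: "i < card Basis \<Longrightarrow> bs ! i \<in> Basis"
  using bs length_bs nth_mem by metis

lemma sum_bs: "(\<Sum>i<card Basis. f (bs ! i)) = sum f Basis"
proof -
  have "bij_betw ((!) bs) {..<card Basis} Basis"
    by (rule bij_betw_nth[OF bs(2)]) (simp_all add: bs length_bs)
  thus ?thesis by (rule sum.reindex_bij_betw)
qed

definition lmat :: "'d \<Rightarrow> 'k mat" where
  "lmat x = mat (card Basis) (card Basis) (\<lambda>(i, j). coord (x * bs ! j) (bs ! i))"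

lemma lmat_carrier [simp]: "lmat x \<in> carrier_mat (card Basis) (card Basis)"
  by (simp add: lmat_def)

lemma lmat_mult: "lmat (x * y) = lmat x * lmat y"
proof (rule eq_matI)
  fix i j assume "i < dim_row (lmat x * lmat y)" "j < dim_col (lmat x * lmat y)"
  hence ij: "i < card Basis" "j < card Basis" by (simp_all add: lmat_def)
  have "coord (x * y * bs ! j) (bs ! i) = (\<Sum>b\<in>Basis. coord (y * bs ! j) b * coord (x * b) (bs ! i))"
    by (subst mult.assoc, subst lin_expand[OF lin_mult_left]) (simp add: coord_sum coord_smul)
  also have "\<dots> = (\<Sum>k<card Basis. coord (x * bs ! k) (bs ! i) * coord (y * bs ! j) (bs ! k))"
    by (subst sum_bs[symmetric]) (simp add: mult.commute)
  finally show "lmat (x * y) $$ (i, j) = (lmat x * lmat y) $$ (i, j)"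
    using ij by (simp add: lmat_def scalar_prod_def lessThan_atLeast0)
qed (simp_all add: lmat_def)

text \<open>The determinant of the regular representation: a power of the reduced norm, defined over
  the base field without reference to a splitting.\<close>

definition rnorm :: "'d \<Rightarrow> 'k" where "rnorm x = det (lmat x)"

lemma rnorm_mult: "rnorm (x * y) = rnorm x * rnorm y"
  unfolding rnorm_def lmat_mult by (rule det_mult[OF lmat_carrier lmat_carrier])

lemma rnorm_scalar: "rnorm (smul c 1) = c ^ card Basis"
proof -
  have "lmat (smul c 1) = c \<cdot>\<^sub>m 1\<^sub>m (card Basis)"
    using bs length_bs
    by (intro eq_matI) (auto simp: lmat_def smul_mult_left coord_smul coord_Basis bs_nth_Basis nth_eq_iff_index_eq)
  thus ?thesis by (simp add: rnorm_def)
qed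

lemma rnorm_1 [simp]: "rnorm 1 = 1"
  using rnorm_scalar[of 1] by simp

lemma rnorm_smul: "rnorm (smul c x) = c ^ card Basis * rnorm x"
  by (subst smul_eq_mult) (simp add: rnorm_mult rnorm_scalar)

lemma rnorm_power: "rnorm (x ^ n) = rnorm x ^ n"
  by (induction n) (simp_all add: rnorm_mult)

lemma rnorm_ne_0: "x \<noteq> 0 \<Longrightarrow> rnorm x \<noteq> 0"
  using rnorm_mult[of x "inverse x"] by auto

end

context padic_division_algebra
begin

lemma cf_rnorm: "cf rnorm"
proof -
  have e: "rnorm x = (\<Sum>\<pi>\<in>{\<pi>. \<pi> permutes {0..<card Basis}}. signof \<pi> *
      (\<Prod>i\<in>{0..<card Basis}. coord (x * bs ! \<pi> i) (bs ! i)))" for x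
  proof -
    have "rnorm x = (\<Sum>\<pi>\<in>{\<pi>. \<pi> permutes {0..<card Basis}}. signof \<pi> *
        (\<Prod>i\<in>{0..<card Basis}. lmat x $$ (i, \<pi> i)))"
      unfolding rnorm_def by (rule det_def'[OF lmat_carrier])
    also have "\<dots> = (\<Sum>\<pi>\<in>{\<pi>. \<pi> permutes {0..<card Basis}}. signof \<pi> *
        (\<Prod>i\<in>{0..<card Basis}. coord (x * bs ! \<pi> i) (bs ! i)))"
      by (intro sum.cong prod.cong arg_cong2[where f = "(*)"] refl) (auto simp: lmat_def)
    finally show ?thesis .
  qed
  have "cfv (\<lambda>x. x * b)" for b by (intro cfv_mult cfv_id cfv_const)
  hence "cf (\<lambda>x. coord (x * b) c)" if "c \<in> Basis" for b c using that by (auto simp: cfv_def)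
  thus ?thesis
    unfolding e by (intro cf_sum cf_mult cf_const cf_prod) (auto simp: bs_nth_Basis)
qed

text \<open>In a division algebra \<open>rnorm\<close> has no zero on the unit sphere, so
  compactness bounds it from below there, and homogeneity of degree \<open>card Basis\<close>
  spreads the bound. Consequently elements of norm one are bounded.\<close>

lemma rnorm_bounded_below: obtains c where "c > 0" "\<And>x. c * mnorm x ^ card Basis \<le> padic_norm (rnorm x)"
proof -
  \<comment> \<open>The index is a dummy: the family is constant, and the second function is taken
    to be 0 so that the whole sphere is considered.\<close>
  have *: "\<exists>j\<ge>1 :: nat. rnorm x \<noteq> 0" if "mnorm x = 1" for x
  proof -
    have "x \<noteq> 0" using that by auto
    thus ?thesis using rnorm_ne_0 by (intro exI[of _ "1 :: nat"]) simp
  qed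
  obtain m :: nat where m: "m \<ge> 1" "\<And>x. mnorm x = 1 \<Longrightarrow> 1 / real m \<le> padic_norm (rnorm x)"
    using cf_bounded_below[of "\<lambda>_. rnorm" "\<lambda>_. 0"] cf_rnorm cf_const * by metis
  have "1 / real m * mnorm x ^ card Basis \<le> padic_norm (rnorm x)" for x
  proof (cases "x = 0")
    case True
    thus ?thesis using finite_Basis Basis_nonempty by (simp add: card_gt_0_iff zero_power)
  next
    case False
    then obtain c where c: "c \<noteq> 0" "mnorm (smul c x) = 1" by (rule mnorm_normalize)
    have "(padic_norm c * mnorm x) ^ card Basis = 1" using c by (simp flip: mnorm_smul)
    hence e: "padic_norm c ^ card Basis * mnorm x ^ card Basis = 1" by (simp add: power_mult_distrib)
    have "1 / real m \<le> padic_norm c ^ card Basis * padic_norm (rnorm x)"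
      using m(2)[OF c(2)] by (simp add: rnorm_smul padic_norm_mult padic_norm_power)
    hence "1 / real m * mnorm x ^ card Basis \<le>
        padic_norm c ^ card Basis * padic_norm (rnorm x) * mnorm x ^ card Basis"
      by (intro mult_right_mono) auto
    also have "\<dots> = padic_norm (rnorm x) * (padic_norm c ^ card Basis * mnorm x ^ card Basis)" by simp
    finally show ?thesis by (simp only: e mult_1_right)
  qed
  thus ?thesis using that[of "1 / real m"] m(1) by simp
qed

text \<open>The remainder \<open>R M\<close> of the power map after its linear part is Lipschitz
  with constant \<open>e\<close> on the ball of radius \<open>e\<close>, uniformly in
  \<open>M\<close> because integers have norm at most 1. Roots, logarithm and differential all rest
  on this estimate.\<close>

lemma power_Lipschitz:
  assumes "nm x \<le> e" "nm y \<le> e" "e \<le> 1"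
  shows "nm ((1 + x) ^ M - (1 + y) ^ M - smul (of_nat M) (x - y)) \<le> e * nm (x - y)"
proof -
  define R where "R M x = (1 + x) ^ M - 1 - smul (of_nat M) x" for M x
  have R_Suc: "R (Suc M) x = R M x + R M x * x + smul (of_nat M) (x * x)" for M x
    by (simp add: R_def power_Suc2 algebra_simps smul_mult_left scale_left_distrib del: power_Suc)
  have R0: "R M 0 = 0" for M by (simp add: R_def)
  have e0: "e \<ge> 0" using assms nm_ge0 order.trans by blast
  have "nm (R M x - R M y) \<le> e * nm (x - y)" if "nm x \<le> e" "nm y \<le> e" for x y
    using that
  proof (induction M arbitrary: x y)
    case 0
    thus ?case using e0 by (simp add: R_def)
  next
    case (Suc M)
    have b: "nm (R M y) \<le> e"
    proof -
      have "nm (R M y) \<le> e * nm y" using Suc.IH[of y 0] Suc.prems e0 by (simp add: R0)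
      also have "\<dots> \<le> e * 1" using Suc.prems assms e0 by (intro mult_left_mono) auto
      finally show ?thesis by simp
    qed
    have IH: "nm (R M x - R M y) \<le> e * nm (x - y)" using Suc by blast
    have 1: "nm ((R M x - R M y) * x) \<le> e * nm (x - y)"
    proof -
      have "nm ((R M x - R M y) * x) \<le> e * nm (x - y) * 1"
        using IH Suc.prems assms by (intro nm_mult_le) auto
      thus ?thesis by simp
    qed
    have 2: "nm (R M y * (x - y)) \<le> e * nm (x - y)" by (intro nm_mult_le b order_refl)
    have 3: "nm (x * (x - y)) \<le> e * nm (x - y)" by (intro nm_mult_le Suc.prems order_refl)
    have 4: "nm ((x - y) * y) \<le> e * nm (x - y)"
      using nm_mult_le[of "x - y" "nm (x - y)" y e] Suc.prems by (simp add: mult.commute)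
    have 5: "nm (smul (of_nat M) (x * (x - y) + (x - y) * y)) \<le> e * nm (x - y)"
    proof -
      have "nm (smul (of_nat M) (x * (x - y) + (x - y) * y)) \<le> 1 * (e * nm (x - y))"
        unfolding nm_smul using padic_norm_of_nat_le1 nm_add_le[OF 3 4] by (intro mult_mono) auto
      thus ?thesis by simp
    qed
    \<comment> \<open>The factors do not commute, so \<open>x * x - y * y\<close> is split as
      \<open>x * (x - y) + (x - y) * y\<close>.\<close>
    have "R (Suc M) x - R (Suc M) y = (R M x - R M y) + (R M x - R M y) * x + R M y * (x - y)
        + smul (of_nat M) (x * (x - y) + (x - y) * y)"
      by (simp add: R_Suc algebra_simps)
    thus ?case using nm_add_le[OF nm_add_le[OF nm_add_le[OF IH 1] 2] 5] by simp
  qed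
  moreover have "(1 + x) ^ M - (1 + y) ^ M - smul (of_nat M) (x - y) = R M x - R M y"
    by (simp add: R_def algebra_simps scale_right_diff_distrib)
  ultimately show ?thesis using assms by metis
qed

text \<open>For \<open>0 \<le> e < 1\<close> this ball is a group, by \<open>U_mult\<close> and
  \<open>U_inverse\<close>.\<close>

definition U :: "real \<Rightarrow> 'd set" where "U e = {x. nm (x - 1) \<le> e}"

lemma U_mono: "x \<in> U e \<Longrightarrow> e \<le> e' \<Longrightarrow> x \<in> U e'"
  by (simp add: U_def)

lemma one_in_U: "e \<ge> 0 \<Longrightarrow> 1 \<in> U e"
  by (simp add: U_def)

lemma U_mult: assumes "x \<in> U e" "y \<in> U e" "e \<le> 1" shows "x * y \<in> U e"
proof -
  have e: "x * y - 1 = (x - 1) * (y - 1) + (x - 1) + (y - 1)" by (simp add: algebra_simps)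
  have "e \<ge> 0" using assms nm_ge0 order.trans unfolding U_def by blast
  hence "e * e \<le> e" using assms(3) by (simp add: mult_left_le)
  hence "nm ((x - 1) * (y - 1)) \<le> e"
    using nm_mult_le[of "x - 1" e "y - 1" e] assms by (simp add: U_def)
  thus ?thesis unfolding U_def mem_Collect_eq e using assms by (intro nm_add_le) (auto simp: U_def)
qed

lemma U_power: "x \<in> U e \<Longrightarrow> e \<le> 1 \<Longrightarrow> x ^ n \<in> U e"
proof (induction n)
  case 0
  hence "e \<ge> 0" using nm_ge0 order.trans unfolding U_def by blast
  thus ?case by (simp add: one_in_U)
qed (simp add: U_mult)

lemma U_ne_0: "x \<in> U e \<Longrightarrow> e < 1 \<Longrightarrow> x \<noteq> 0"
  using nm_1_ge1 by (auto simp: U_def)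

lemma nm_U: "x \<in> U e \<Longrightarrow> e \<le> 1 \<Longrightarrow> nm x \<le> nm 1"
  using nm_add_le[of "x - 1" "nm 1" 1] nm_1_ge1 by (simp add: U_def)

lemma U_inverse: assumes "x \<in> U e" "e < 1" shows "inverse x \<in> U e"
proof -
  have x0: "x \<noteq> 0" using assms by (rule U_ne_0)
  define z where "z = inverse x - 1"
  \<comment> \<open>The identity bounds \<open>z\<close> by the maximum of \<open>nm (x - 1)\<close>
    and \<open>e * nm z\<close>; as \<open>e < 1\<close>, the second term cannot dominate.\<close>
  have z: "z = - (x - 1) - (x - 1) * z" using x0 by (simp add: z_def algebra_simps)
  have "nm z \<le> max (nm (x - 1)) (nm ((x - 1) * z))"
    by (subst z, rule nm_diff_le) (simp_all add: nm_minus_commute[of 1 x])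
  moreover have "nm ((x - 1) * z) \<le> e * nm z" using assms by (intro nm_mult_le) (auto simp: U_def)
  moreover have "e * nm z < nm z" if "z \<noteq> 0" using assms(2) nm_pos[OF that] by simp
  moreover have "e \<ge> 0" using assms nm_ge0 order.trans unfolding U_def by blast
  ultimately have "nm z \<le> e" using assms by (cases "z = 0") (auto simp: U_def)
  thus ?thesis by (simp add: U_def z_def)
qed

lemma power_U_diff:
  assumes "x \<in> U e" "y \<in> U e" "e \<le> 1"
  shows "nm (x ^ M - y ^ M - smul (of_nat M) (x - y)) \<le> e * nm (x - y)"
  using power_Lipschitz[of "x - 1" e "y - 1" M] assms by (simp add: U_def)

text \<open>The equation \<open>(1 + y) ^ M = x\<close> is rewritten as
  \<open>y = (x - 1 - R y) / M\<close> with \<open>R\<close> the remainder of the power map. Since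
  \<open>R\<close> is Lipschitz with constant \<open>e\<close>, and division by \<open>M\<close>
  costs the inverse of its norm, the bound on \<open>e\<close> makes this a contraction of the ball
  of radius \<open>e\<close>.\<close>

lemma U_root:
  assumes x: "x \<in> U (e * padic_norm (of_nat M :: 'p padic))" and e: "0 \<le> e" "e < padic_norm (of_nat M :: 'p padic)"
  obtains v where "v \<in> U e" "v ^ M = x"
proof -
  define m where "m = padic_norm (of_nat M :: 'p padic)"
  have m: "e < m" "m > 0" "m \<le> 1" using e padic_norm_of_nat_le1[of M, where ?'p = 'p] by (auto simp: m_def)
  have M0: "(of_nat M :: 'p padic) \<noteq> 0" using m(2) unfolding m_def by (metis less_irrefl padic_norm_0)
  define f where "f y = smul (inverse (of_nat M)) (x - 1 - ((1 + y) ^ M - 1 - smul (of_nat M) y))" for y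
  have nf: "nm (smul (inverse (of_nat M)) z) = nm z / m" for z
    by (simp add: nm_smul padic_norm_inverse m_def divide_inverse)
  have R: "nm (((1 + y) ^ M - 1 - smul (of_nat M) y) - ((1 + z) ^ M - 1 - smul (of_nat M) z)) \<le> e * nm (y - z)"
    if "nm y \<le> e" "nm z \<le> e" for y z
    using power_Lipschitz[of y e z M] that m by (simp add: algebra_simps scale_right_diff_distrib)
  have "nm (f y) \<le> e" if y: "nm y \<le> e" for y
  proof -
    have "nm ((1 + y) ^ M - 1 - smul (of_nat M) y) \<le> e * nm y" using R[OF y, of 0] e by simp
    also have "\<dots> \<le> e * m" using y m e by (intro mult_left_mono) auto
    finally have R1: "nm ((1 + y) ^ M - 1 - smul (of_nat M) y) \<le> e * m" .
    have "nm (x - 1) \<le> e * m" using x by (simp add: U_def m_def)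
    from nm_diff_le[OF this R1] have "nm (x - 1 - ((1 + y) ^ M - 1 - smul (of_nat M) y)) \<le> e * m" .
    thus ?thesis unfolding f_def nf using m by (simp add: field_simps)
  qed
  moreover have "nm (f y - f z) \<le> e / m * nm (y - z)" if "nm y \<le> e" "nm z \<le> e" for y z
  proof -
    have "f y - f z = smul (inverse (of_nat M)) (((1 + z) ^ M - 1 - smul (of_nat M) z) - ((1 + y) ^ M - 1 - smul (of_nat M) y))"
      by (simp add: f_def algebra_simps)
    hence "nm (f y - f z) \<le> e * nm (z - y) / m"
      using R[OF that(2,1)] m by (simp add: nf divide_right_mono)
    thus ?thesis using nm_minus_commute[of y z] by simp
  qed
  moreover have "0 \<le> e / m" "e / m < 1" using e m by auto
  ultimately obtain y where y: "nm y \<le> e" "f y = y"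
    using contraction_fixed_point[of e f "e / m"] e by blast
  have "smul (of_nat M) (f y) = x - 1 - ((1 + y) ^ M - 1 - smul (of_nat M) y)"
    using M0 by (simp add: f_def)
  hence "(1 + y) ^ M = x" using y(2) by simp
  thus ?thesis using that[of "1 + y"] y(1) by (simp add: U_def)
qed

lemma pp_gt1: "real CARD('p) > 1" by (rule one_less_card)

text \<open>On the ball of radius \<open>1 / p\<close> a \<open>p\<close>-th power of
  \<open>b\<close> is \<open>1 + p (b - 1)\<close> up to an error of norm at most
  \<open>nm (b - 1) / p\<close>, so each step divides the distance to 1 by at least
  \<open>p\<close>.\<close>

lemma p_power_U:
  assumes "nm (a - 1) \<le> 1 / real CARD('p)"
  shows "nm (a ^ (CARD('p) ^ k) - 1) \<le> (1 / real CARD('p)) ^ k * nm (a - 1)"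
proof (induction k)
  case (Suc k)
  define b where "b = a ^ (CARD('p) ^ k)"
  have le: "(1 / real CARD('p)) ^ k \<le> 1" using pp_gt1 by (intro power_le_one) auto
  have "nm (b - 1) \<le> 1 * nm (a - 1)"
    using Suc le unfolding b_def by (meson mult_right_mono nm_ge0 order_trans)
  hence b: "nm (b - 1) \<le> 1 / real CARD('p)" using assms by simp
  have "nm (b ^ CARD('p) - 1 ^ CARD('p) - smul (of_nat CARD('p)) (b - 1)) \<le> 1 / real CARD('p) * nm (b - 1)"
    using b pp_gt1 by (intro power_U_diff) (auto simp: U_def)
  moreover have "nm (smul (of_nat CARD('p)) (b - 1)) \<le> 1 / real CARD('p) * nm (b - 1)"
    by (simp add: nm_smul padic_norm_p)
  ultimately have "nm (b ^ CARD('p) - 1) \<le> 1 / real CARD('p) * nm (b - 1)"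
    using nm_add_le[of "b ^ CARD('p) - 1 ^ CARD('p) - smul (of_nat CARD('p)) (b - 1)" _ "smul (of_nat CARD('p)) (b - 1)"]
    by simp
  also have "\<dots> \<le> 1 / real CARD('p) * ((1 / real CARD('p)) ^ k * nm (a - 1))"
    using Suc unfolding b_def by (intro mult_left_mono) auto
  finally show ?case by (simp add: b_def mult.commute[of "CARD('p)"] power_mult)
qed simp

section \<open>The logarithm\<close>

definition pinv :: "nat \<Rightarrow> 'd \<Rightarrow> 'd" where "pinv k x = smul (inverse (of_nat CARD('p)) ^ k) x"

lemma nm_pinv: "nm (pinv k x) = real CARD('p) ^ k * nm x"
  by (simp add: pinv_def nm_smul padic_norm_power padic_norm_inverse padic_norm_p)

lemma pinv_diff: "pinv k (x - y) = pinv k x - pinv k y"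
  by (simp add: pinv_def scale_right_diff_distrib)

lemma pinv_add: "pinv k (x + y) = pinv k x + pinv k y"
  by (simp add: pinv_def scale_right_distrib)

lemma pinv_Suc: "pinv (Suc k) (smul (of_nat CARD('p)) x) = pinv k x"
  using pp_gt1 by (simp add: pinv_def)

lemma pinv_pow: "pinv k (smul (of_nat CARD('p) ^ k) x) = x"
  using pp_gt1 by (simp add: pinv_def flip: power_mult_distrib)

lemma pinv_mult_left: "pinv k (a * x) = a * pinv k x" and pinv_mult_right: "pinv k (x * a) = pinv k x * a"
  by (simp_all add: pinv_def smul_mult_left smul_mult_right)

text \<open>The approximations \<open>(a ^ (p ^ k) - 1) / p ^ k\<close> to the logarithm.
  Conjugation and homomorphisms pass through powers, which makes this limit more convenient than the
  power series.\<close>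

definition lgs :: "'d \<Rightarrow> nat \<Rightarrow> 'd" where "lgs a k = pinv k (a ^ (CARD('p) ^ k) - 1)"

definition lg :: "'d \<Rightarrow> 'd" where "lg a = (SOME l. conv (lgs a) l)"

text \<open>On the ball of radius \<open>p ^ (-2)\<close> the logarithm is isometric for every prime \<open>p\<close>, including 2.\<close>

definition lrad :: real where "lrad = (1 / real CARD('p)) ^ 2"

lemma lrad: "lrad > 0" "lrad < 1" "lrad \<le> 1 / real CARD('p)" "real CARD('p) * lrad = 1 / real CARD('p)"
    "real CARD('p) * lrad < 1"
  using pp_gt1 less_1_mult[OF pp_gt1 pp_gt1] by (auto simp: lrad_def power2_eq_square field_simps)

text \<open>One step is a \<open>p\<close>-th power applied to \<open>A\<close> and
  \<open>B\<close>, which lie within \<open>e * p ^ (-k)\<close> of 1. The estimate for differences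
  of powers gains this factor, and the additional division by \<open>p\<close> loses one factor
  \<open>p\<close>.\<close>

lemma lgs_step:
  assumes a: "a \<in> U e" and b: "b \<in> U e" and e: "e \<le> lrad"
  shows "nm (lgs a (Suc k) - lgs b (Suc k) - (lgs a k - lgs b k)) \<le>
           real CARD('p) * e * (1 / real CARD('p)) ^ k * nm (lgs a k - lgs b k)"
proof -
  define A B where "A = a ^ (CARD('p) ^ k)" and "B = b ^ (CARD('p) ^ k)"
  define q where "q = real CARD('p)"
  have q: "q > 1" using pp_gt1 by (simp add: q_def)
  have ek: "z ^ (CARD('p) ^ k) \<in> U (e * (1 / q) ^ k)" if z: "z \<in> U e" for z
  proof -
    have "nm (z ^ (CARD('p) ^ k) - 1) \<le> (1 / q) ^ k * nm (z - 1)"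
      using p_power_U[of z k] z e lrad by (simp add: U_def q_def)
    also have "\<dots> \<le> (1 / q) ^ k * e" using z q by (intro mult_left_mono) (auto simp: U_def)
    finally show ?thesis by (simp add: U_def mult.commute)
  qed
  have e0: "e \<ge> 0" using a nm_ge0 order.trans unfolding U_def by blast
  have e1: "e \<le> 1" using e lrad(2) by linarith
  have "e * (1 / q) ^ k \<le> 1 * 1"
    using e1 e0 q by (intro mult_mono power_le_one) auto
  hence "nm (A ^ CARD('p) - B ^ CARD('p) - smul (of_nat CARD('p)) (A - B)) \<le> e * (1 / q) ^ k * nm (A - B)"
    unfolding A_def B_def using ek a b by (intro power_U_diff) auto
  hence "q ^ Suc k * nm (A ^ CARD('p) - B ^ CARD('p) - smul (of_nat CARD('p)) (A - B)) \<le>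
      q ^ Suc k * (e * (1 / q) ^ k * nm (A - B))" using q by (intro mult_left_mono) auto
  also have "q ^ Suc k * nm (A ^ CARD('p) - B ^ CARD('p) - smul (of_nat CARD('p)) (A - B)) =
      nm (lgs a (Suc k) - lgs b (Suc k) - (lgs a k - lgs b k))"
  proof -
    have L: "lgs z k = pinv (Suc k) (smul (of_nat CARD('p)) (z ^ (CARD('p) ^ k) - 1))" for z
      by (simp add: lgs_def pinv_Suc)
    have P: "z ^ (CARD('p) ^ Suc k) = (z ^ (CARD('p) ^ k)) ^ CARD('p)" for z :: 'd
      by (simp add: mult.commute flip: power_mult)
    have "lgs a (Suc k) - lgs b (Suc k) - (lgs a k - lgs b k) =
        pinv (Suc k) (A ^ CARD('p) - B ^ CARD('p) - smul (of_nat CARD('p)) (A - B))"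
      unfolding L lgs_def[of _ "Suc k"] P A_def B_def pinv_diff scale_right_diff_distrib
      by (simp add: algebra_simps)
    thus ?thesis by (simp add: nm_pinv q_def)
  qed
  also have "q ^ Suc k * (e * (1 / q) ^ k * nm (A - B)) = q * e * (1 / q) ^ k * nm (lgs a k - lgs b k)"
  proof -
    have "lgs a k - lgs b k = pinv k (A - B)" by (simp add: lgs_def A_def B_def pinv_diff)
    thus ?thesis by (simp add: nm_pinv q_def)
  qed
  finally show ?thesis unfolding q_def .
qed

lemma lgs_1: "lgs 1 k = 0"
  by (simp add: lgs_def pinv_def)

lemma nm_lgs: "a \<in> U lrad \<Longrightarrow> nm (lgs a k) \<le> nm (a - 1)"
proof -
  assume "a \<in> U lrad"
  hence "nm (a ^ (CARD('p) ^ k) - 1) \<le> (1 / real CARD('p)) ^ k * nm (a - 1)"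
    using lrad by (intro p_power_U) (auto simp: U_def)
  hence "real CARD('p) ^ k * nm (a ^ (CARD('p) ^ k) - 1) \<le> real CARD('p) ^ k * ((1 / real CARD('p)) ^ k * nm (a - 1))"
    using pp_gt1 by (intro mult_left_mono) auto
  thus ?thesis using pp_gt1 by (simp add: lgs_def nm_pinv power_divide)
qed

lemma lgs_step1:
  assumes "a \<in> U lrad"
  shows "nm (lgs a (Suc k) - lgs a k) \<le> real CARD('p) * (1 / real CARD('p)) ^ k * nm (a - 1) ^ 2"
proof -
  have "nm (lgs a (Suc k) - lgs 1 (Suc k) - (lgs a k - lgs 1 k)) \<le>
           real CARD('p) * nm (a - 1) * (1 / real CARD('p)) ^ k * nm (lgs a k - lgs 1 k)"
    using assms by (intro lgs_step) (auto simp: U_def)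
  also have "\<dots> \<le> real CARD('p) * nm (a - 1) * (1 / real CARD('p)) ^ k * nm (a - 1)"
    using nm_lgs[OF assms] pp_gt1 by (intro mult_left_mono) (auto simp: lgs_1)
  finally show ?thesis by (simp add: lgs_1 power2_eq_square mult_ac)
qed

lemma p_power_null: "(\<lambda>k. C * (1 / real CARD('p)) ^ k) \<longlonglongrightarrow> 0"
proof -
  have "(\<lambda>k. C * (1 / real CARD('p)) ^ k) \<longlonglongrightarrow> C * 0"
    using pp_gt1 by (intro tendsto_mult tendsto_const LIMSEQ_power_zero) auto
  thus ?thesis by simp
qed

lemma conv_lg: assumes "a \<in> U lrad" shows "conv (lgs a) (lg a)"
proof -
  have "(\<lambda>k. nm (lgs a (Suc k) - lgs a k)) \<longlonglongrightarrow> 0"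
    by (rule null_mono_all[OF p_power_null[of "real CARD('p) * nm (a - 1) ^ 2"]])
       (use lgs_step1[OF assms] in \<open>simp_all add: mult_ac\<close>)
  then obtain l where "conv (lgs a) l" by (rule convI)
  thus ?thesis unfolding lg_def by (rule someI)
qed

lemma lg_eqI: "a \<in> U lrad \<Longrightarrow> conv (lgs a) l \<Longrightarrow> lg a = l"
  using conv_lg conv_unique by blast

lemma p_pow_antimono: "n \<le> k \<Longrightarrow> (1 / real CARD('p)) ^ k \<le> (1 / real CARD('p)) ^ n"
  using pp_gt1 by (intro power_decreasing) auto

lemma lg_approx:
  assumes "a \<in> U lrad"
  shows "nm (lg a - lgs a k) \<le> real CARD('p) * (1 / real CARD('p)) ^ k * nm (a - 1) ^ 2"
proof (rule conv_bound_steps[OF conv_lg[OF assms]])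
  fix j assume "j \<ge> k"
  hence "real CARD('p) * (1 / real CARD('p)) ^ j * nm (a - 1) ^ 2 \<le> real CARD('p) * (1 / real CARD('p)) ^ k * nm (a - 1) ^ 2"
    using pp_gt1 p_pow_antimono by (intro mult_right_mono mult_left_mono) auto
  thus "nm (lgs a (Suc j) - lgs a j) \<le> real CARD('p) * (1 / real CARD('p)) ^ k * nm (a - 1) ^ 2"
    using lgs_step1[OF assms, of j] by linarith
qed simp

text \<open>The error is quadratic in \<open>p ^ (-k)\<close>, so it disappears after division by
  \<open>p ^ k\<close>. The powers of \<open>a\<close> thus form a sequence tangent to
  \<open>lg a\<close>, which the differential of a homomorphism can be tested on.\<close>

lemma lg_approx_power:
  assumes "a \<in> U lrad"
  shows "nm (a ^ (CARD('p) ^ k) - 1 - smul (of_nat CARD('p) ^ k) (lg a)) \<le>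
           real CARD('p) * nm (a - 1) ^ 2 * ((1 / real CARD('p)) ^ k) ^ 2"
proof -
  define w where "w = a ^ (CARD('p) ^ k) - 1 - smul (of_nat CARD('p) ^ k) (lg a)"
  have "pinv k w = - (lg a - lgs a k)" by (simp add: w_def pinv_diff pinv_pow lgs_def)
  hence "real CARD('p) ^ k * nm w = nm (lg a - lgs a k)"
    by (metis nm_pinv nm_minus)
  also have "\<dots> \<le> real CARD('p) * (1 / real CARD('p)) ^ k * nm (a - 1) ^ 2" by (rule lg_approx[OF assms])
  finally have "(1 / real CARD('p)) ^ k * (real CARD('p) ^ k * nm w) \<le>
     (1 / real CARD('p)) ^ k * (real CARD('p) * (1 / real CARD('p)) ^ k * nm (a - 1) ^ 2)"
    by (intro mult_left_mono) auto
  thus ?thesis using pp_gt1 by (simp add: w_def power_divide power2_eq_square mult_ac)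
qed

text \<open>The approximating differences start at \<open>s 0 = a - b\<close>, and all later steps
  are at most \<open>p * e\<close> times as large. At radius \<open>lrad\<close> the factor is
  \<open>1 / p\<close>: there \<open>lg\<close> is isometric, and the deviation of
  \<open>lg a\<close> from \<open>a - 1\<close> is a contraction.\<close>

lemma lg_diff:
  assumes a: "a \<in> U e" and b: "b \<in> U e" and e: "e \<le> lrad"
  shows "nm (lg a - lg b - (a - b)) \<le> real CARD('p) * e * nm (a - b)"
proof -
  define s where "s k = lgs a k - lgs b k" for k
  have e0: "e \<ge> 0" using a nm_ge0 order.trans unfolding U_def by blast
  have pe: "real CARD('p) * e \<le> 1"
  proof -
    have "real CARD('p) * e \<le> real CARD('p) * lrad" using e by (intro mult_left_mono) auto
    thus ?thesis using lrad(5) by linarith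
  qed
  have s0: "s 0 = a - b" by (simp add: s_def lgs_def pinv_def)
  have st: "nm (s (Suc k) - s k) \<le> real CARD('p) * e * nm (s k)" for k
  proof -
    have "real CARD('p) * e * (1 / real CARD('p)) ^ k * nm (lgs a k - lgs b k) \<le>
        real CARD('p) * e * 1 * nm (lgs a k - lgs b k)"
      using e0 pp_gt1 by (intro mult_right_mono mult_left_mono power_le_one) auto
    from order.trans[OF lgs_step[OF a b e, of k] this] show ?thesis by (simp add: s_def)
  qed
  have sb: "nm (s k) \<le> nm (a - b)" for k
  proof (induction k)
    case (Suc k)
    have "real CARD('p) * e * nm (s k) \<le> 1 * nm (s k)" using pe by (intro mult_right_mono) auto
    thus ?case using nm_add_le[of "s (Suc k) - s k" "nm (a - b)" "s k"] st[of k] Suc by simp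
  qed (simp add: s0)
  have "conv s (lg a - lg b)"
    unfolding s_def using a b e U_mono by (intro conv_diff) (auto intro: conv_lg)
  from conv_bound_steps[OF this, of 0 "real CARD('p) * e * nm (a - b)"] show ?thesis
    using order.trans[OF st mult_left_mono[OF sb]] e0 by (simp add: s0)
qed

lemma lg_1: "lg 1 = 0"
  using lrad by (intro lg_eqI) (auto simp: one_in_U lgs_1 conv_def)

lemma lg_dist: assumes "a \<in> U lrad" "b \<in> U lrad" shows "nm (lg a - lg b) = nm (a - b)"
proof (cases "a = b")
  case False
  have "nm (lg a - lg b - (a - b)) \<le> real CARD('p) * lrad * nm (a - b)"
    by (rule lg_diff[OF assms order_refl])
  also have "\<dots> < 1 * nm (a - b)" using False nm_pos[of "a - b"] lrad(5) by (intro mult_strict_right_mono) auto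
  finally have "nm (a - b - (lg a - lg b)) < nm (a - b)" by (subst nm_minus_commute) simp
  thus ?thesis by (rule nm_eqI)
qed simp

lemma nm_lg: "a \<in> U lrad \<Longrightarrow> nm (lg a) = nm (a - 1)"
  using lg_dist[of a 1] lrad by (simp add: lg_1 one_in_U)

text \<open>A solution of \<open>lg (1 + x) = y\<close> is a fixed point of the map from
  \<open>x\<close> to \<open>y - (lg (1 + x) - x)\<close>, which contracts by \<open>1 / p\<close>
  according to \<open>lg_diff\<close>.\<close>

lemma lg_surj: assumes "nm y \<le> lrad" obtains a where "a \<in> U lrad" "lg a = y"
proof -
  define f where "f x = y - (lg (1 + x) - x)" for x
  have Ux: "1 + x \<in> U lrad" if "nm x \<le> lrad" for x using that by (simp add: U_def)
  have c: "nm (f x - f z) \<le> 1 / real CARD('p) * nm (x - z)" if "nm x \<le> lrad" "nm z \<le> lrad" for x z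
  proof -
    have "nm (lg (1 + z) - lg (1 + x) - ((1 + z) - (1 + x))) \<le> real CARD('p) * lrad * nm ((1 + z) - (1 + x))"
      by (rule lg_diff) (auto intro: Ux that)
    moreover have "f x - f z = lg (1 + z) - lg (1 + x) - ((1 + z) - (1 + x))" by (simp add: f_def)
    ultimately show ?thesis using nm_minus_commute[of x z] by (simp add: lrad(4))
  qed
  have "nm (f x) \<le> lrad" if x: "nm x \<le> lrad" for x
  proof -
    have "nm (f x - f 0) \<le> 1 / real CARD('p) * nm (x - 0)" using x lrad by (intro c) auto
    also have "\<dots> \<le> 1 * nm (x - 0)" using pp_gt1 by (intro mult_right_mono) auto
    finally have "nm (f x - f 0) \<le> lrad" using x by simp
    moreover have "f 0 = y" by (simp add: f_def lg_1)
    ultimately show ?thesis using nm_add_le[of "f x - f 0" lrad "f 0"] assms by simp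
  qed
  then obtain x where x: "nm x \<le> lrad" "f x = x"
    using contraction_fixed_point[of lrad f "1 / real CARD('p)"] c lrad pp_gt1 by force
  have "lg (1 + x) = y" using x(2) by (simp add: f_def algebra_simps)
  thus ?thesis using that Ux x(1) by blast
qed

lemma conj_power: assumes "h \<noteq> 0" shows "(h * a * inverse h) ^ n = h * a ^ n * inverse (h :: 'd)"
proof (induction n)
  case (Suc n)
  have "(h * a * inverse h) ^ Suc n = (h * a * inverse h) * (h * a ^ n * inverse h)"
    by (simp only: power_Suc Suc.IH)
  also have "\<dots> = h * a * (inverse h * h) * a ^ n * inverse h"
    by (simp only: mult.assoc)
  also have "\<dots> = h * a ^ Suc n * inverse h" using assms by (simp add: mult.assoc)
  finally show ?case .
qed (use assms in simp)

lemma lg_conj: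
  assumes "a \<in> U lrad" "h * a * inverse h \<in> U lrad" "h \<noteq> 0"
  shows "lg (h * a * inverse h) = h * lg a * inverse h"
proof (rule lg_eqI[OF assms(2)])
  have "lgs (h * a * inverse h) = (\<lambda>k. h * lgs a k * inverse h)"
  proof
    fix k
    have "(h * a * inverse h) ^ n - 1 = h * (a ^ n - 1) * inverse h" for n
      unfolding conj_power[OF assms(3)] using assms(3) by (simp add: algebra_simps)
    thus "lgs (h * a * inverse h) k = h * lgs a k * inverse h"
      by (simp only: lgs_def pinv_mult_left[of k h] pinv_mult_right[of k _ "inverse h"])
  qed
  thus "conv (lgs (h * a * inverse h)) (h * lg a * inverse h)"
    using conv_mult_right[OF conv_mult_left[OF conv_lg[OF assms(1)], of h], of "inverse h"] by simp
qed

lemma lg_commute1: assumes "a \<in> U lrad" "a * b = b * a" shows "lg a * b = b * lg a"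
proof -
  have "a ^ n * b = b * a ^ n" for n by (rule power_commuting_commutes[OF assms(2)])
  hence "lgs a k * b = b * lgs a k" for k
    by (simp add: lgs_def algebra_simps flip: pinv_mult_left pinv_mult_right)
  thus ?thesis
    using conv_mult_left[OF conv_lg[OF assms(1)], of b] conv_mult_right[OF conv_lg[OF assms(1)], of b]
    by (simp add: conv_unique)
qed

lemma lg_commute:
  assumes "a \<in> U lrad" "b \<in> U lrad" "a * b = b * a" shows "lg a * lg b = lg b * lg a"
proof -
  have "b * lg a = lg a * b" using lg_commute1[OF assms(1,3)] by simp
  from lg_commute1[OF assms(2) this] show ?thesis by simp
qed

end

section \<open>Homomorphisms between open subgroups and their differentials\<close>

context padic_division_algebra
begin

text \<open>Such elements are bounded, so among the powers up to \<open>M\<close> two are close and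
  \<open>g ^ (j - i)\<close> is near 1. The difference \<open>j - i\<close> varies with
  \<open>g\<close> but always divides \<open>fact M\<close>, and \<open>U e\<close> is closed under
  powers.\<close>

lemma unit_norm_power_near_1:
  assumes e: "0 < e" "e \<le> 1"
  obtains M where "M > 0" "\<And>g. padic_norm (rnorm g) = 1 \<Longrightarrow> g ^ M \<in> U e"
proof -
  define d q where "d = card Basis" and "q = real CARD('p)"
  have q: "q > 1" using pp_gt1 by (simp add: q_def)
  have d: "d > 0" using finite_Basis Basis_nonempty by (simp add: d_def card_gt_0_iff)
  obtain c where c: "c > 0" "\<And>x. c * mnorm x ^ d \<le> padic_norm (rnorm x)"
    using rnorm_bounded_below unfolding d_def by blast
  obtain r where r: "max 1 (1 / c) < q ^ r" using real_arch_pow[OF q] by blast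
  have bd: "mnorm g \<le> q ^ r" if "padic_norm (rnorm g) = 1" for g
  proof (rule ccontr)
    assume "\<not> mnorm g \<le> q ^ r"
    hence "(q ^ r) ^ d \<le> mnorm g ^ d" using q by (intro power_mono) auto
    moreover have "q ^ r \<le> (q ^ r) ^ d" using r d by (intro self_le_power) auto
    ultimately have "c * (1 / c) < c * mnorm g ^ d" using r c by (intro mult_strict_left_mono) auto
    thus False using c(1) c(2)[of g] that by simp
  qed
  \<comment> \<open>Losses in the estimate: one \<open>mult_bound\<close> for each of the two
    passages from \<open>mnorm\<close> to \<open>nm\<close>, one \<open>q ^ r\<close> for rescaling
    the powers into the unit ball and one for multiplying by \<open>inverse g ^ i\<close>.\<close>
  define K where "K = mult_bound * mult_bound * (q ^ r * q ^ r)"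
  have K: "K > 0" using mult_bound_ge1 q by (simp add: K_def)
  obtain k where k: "(1 / q) ^ k < e / K"
    using real_arch_pow_inv[of "e / K" "1 / q"] e K q by auto
  obtain M :: nat where M: "M > 0" "\<And>f. (\<And>i. i \<le> M \<Longrightarrow> mnorm (f i) \<le> 1) \<Longrightarrow>
     \<exists>i j. i < j \<and> j \<le> M \<and> mnorm (f i - f j) \<le> (1 / q) ^ k"
    using finite_classes[of k] unfolding q_def by metis
  have "g ^ fact M \<in> U e" if g: "padic_norm (rnorm g) = 1" for g
  proof -
    define s where "s = (of_nat CARD('p) :: 'p padic) ^ r"
    have s: "padic_norm s = (1 / q) ^ r" by (simp add: s_def padic_norm_power padic_norm_p q_def)
    have g0: "g \<noteq> 0" using g d by (auto simp: d_def rnorm_smul dest: arg_cong[of _ _ rnorm])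
        (metis padic_norm_0 rnorm_smul scale_zero_left power_0_left mult_zero_left less_numeral_extra(3) zero_neq_one)
    have gi: "padic_norm (rnorm (g ^ i)) = 1" for i by (simp add: rnorm_power padic_norm_power g)
    have gi': "padic_norm (rnorm (inverse g ^ i)) = 1" for i
    proof -
      have "rnorm (g ^ i) * rnorm (inverse g ^ i) = 1"
        using g0 by (simp flip: rnorm_mult power_mult_distrib add: power_inverse)
      hence "padic_norm (rnorm (g ^ i)) * padic_norm (rnorm (inverse g ^ i)) = 1"
        by (simp flip: padic_norm_mult)
      thus ?thesis by (simp add: gi)
    qed
    have "mnorm (smul s (g ^ i)) \<le> 1" for i
    proof -
      have "(1 / q) ^ r * mnorm (g ^ i) \<le> (1 / q) ^ r * q ^ r" using bd[OF gi] q by (intro mult_left_mono) auto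
      thus ?thesis using q by (simp add: mnorm_smul s power_divide)
    qed
    then obtain i j where ij: "i < j" "j \<le> M" "mnorm (smul s (g ^ i) - smul s (g ^ j)) \<le> (1 / q) ^ k"
      using M(2)[of "\<lambda>i. smul s (g ^ i)"] by blast
    have "(1 / q) ^ r * mnorm (g ^ i - g ^ j) \<le> (1 / q) ^ k"
      using ij(3) by (simp flip: scale_right_diff_distrib add: mnorm_smul s)
    hence "q ^ r * ((1 / q) ^ r * mnorm (g ^ i - g ^ j)) \<le> q ^ r * (1 / q) ^ k"
      using q by (intro mult_left_mono) auto
    hence m1: "mnorm (g ^ i - g ^ j) \<le> q ^ r * (1 / q) ^ k" using q by (simp add: power_divide)
    have "1 - g ^ (j - i) = (g ^ i - g ^ j) * inverse g ^ i"
    proof -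
      have "g ^ j = g ^ (j - i) * g ^ i" using ij(1) by (simp flip: power_add)
      thus ?thesis using g0 by (simp add: left_diff_distrib power_inverse mult.assoc)
    qed
    hence "nm (1 - g ^ (j - i)) \<le> nm (g ^ i - g ^ j) * nm (inverse g ^ i)" by (simp add: nm_mult)
    also have "\<dots> \<le> (mult_bound * (q ^ r * (1 / q) ^ k)) * (mult_bound * q ^ r)"
      unfolding nm_def using m1 bd[OF gi'] mult_bound_ge1 q
      by (intro mult_mono mult_left_mono) auto
    also have "\<dots> = K * (1 / q) ^ k" by (simp add: K_def mult_ac)
    also have "\<dots> \<le> K * (e / K)" using k K by (intro mult_left_mono) auto
    finally have "g ^ (j - i) \<in> U e" using K by (simp add: U_def nm_minus_commute[of 1])
    moreover have "j - i dvd fact M" using ij by (intro dvd_fact) auto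
    ultimately show ?thesis using e by (auto simp: dvd_def power_mult intro: U_power)
  qed
  thus ?thesis using that[of "fact M"] by simp
qed

lemma conv_transform:
  assumes "conv s l" "(\<lambda>k. nm (t k - s k)) \<longlonglongrightarrow> 0" shows "conv t l"
proof -
  have "conv (\<lambda>k. t k - s k) 0" using assms(2) by (simp add: conv_def)
  from conv_add[OF this assms(1)] show ?thesis by simp
qed

lemma conv_eventually_eq:
  assumes "conv s l" "\<forall>\<^sub>F k in sequentially. t k = s k" shows "conv t l"
  using assms(1) unfolding conv_def
  by (rule Lim_transform_eventually) (use assms(2) in eventually_elim, simp)

text \<open>Additivity gives homogeneity over the rationals, and boundedness extends it to their
  completion: the defect at \<open>c\<close> equals the defect at \<open>c - of_rat r\<close>, which
  is arbitrarily small.\<close>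

lemma additive_bounded_imp_lin:
  assumes add: "\<And>x y. f (x + y) = f x + f y" and bd: "\<And>x. nm (f x) \<le> C * nm x" and C: "C \<ge> 1"
  shows "lin f"
proof -
  have f0: "f 0 = 0" using add[of 0 0] by simp
  have fm: "f (- x) = - f x" for x using add[of x "- x"] f0 by (simp add: eq_neg_iff_add_eq_0 add.commute)
  have fd: "f (x - y) = f x - f y" for x y using add[of x "- y"] by (simp add: fm)
  have int: "f (smul (of_int a) y) = smul (of_int a) (f y)" for a y
    by (induction a rule: int_induct[of _ 0]) (simp_all add: f0 scale_left_distrib scale_left_diff_distrib add fd)
  have rat: "f (smul (of_rat r) y) = smul (of_rat r) (f y)" for r y
  proof -
    obtain a b where ab: "quotient_of r = (a, b)" by (cases "quotient_of r")
    have b: "b > 0" and r: "r = of_int a / of_int b"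
      using quotient_of_denom_pos[OF ab] quotient_of_div[OF ab] by auto
    have "of_int b * of_rat r = (of_int a :: 'p padic)" using b by (simp add: r of_rat_divide)
    hence "f (smul (of_int b) (smul (of_rat r) y)) = smul (of_int b) (smul (of_rat r) (f y))"
      by (simp add: int)
    hence "smul (of_int b) (f (smul (of_rat r) y)) = smul (of_int b) (smul (of_rat r) (f y))"
      by (simp only: int)
    moreover have "(of_int b :: 'p padic) \<noteq> 0" using b by simp
    ultimately show ?thesis unfolding scale_cancel_left by blast
  qed
  have "f (smul c y) = smul c (f y)" for c y
  proof (rule ccontr)
    assume "\<not> ?thesis"
    hence pos: "nm (f (smul c y) - smul c (f y)) > 0" by (intro nm_pos) simp
    define e where "e = nm (f (smul c y) - smul c (f y)) / (C * nm y + 1)"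
    have den: "C * nm y + 1 > 0" using C by (simp add: add_nonneg_pos)
    have "e > 0" using pos den by (simp add: e_def)
    then obtain r where r: "padic_norm (c - of_rat r) < e" by (rule padic_rat_dense)
    have "f (smul c y) - smul c (f y) = f (smul (c - of_rat r) y) - smul (c - of_rat r) (f y)"
      by (simp add: scale_left_diff_distrib fd rat)
    moreover have "nm (f (smul (c - of_rat r) y)) \<le> e * (C * nm y)"
    proof -
      have "nm (f (smul (c - of_rat r) y)) \<le> padic_norm (c - of_rat r) * (C * nm y)"
        using bd[of "smul (c - of_rat r) y"] by (simp add: nm_smul mult_ac)
      also have "\<dots> \<le> e * (C * nm y)" using r C by (intro mult_right_mono) auto
      finally show ?thesis .
    qed
    moreover have "nm (smul (c - of_rat r) (f y)) \<le> e * (C * nm y)"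
      unfolding nm_smul using r bd \<open>e > 0\<close> by (intro mult_mono) auto
    ultimately have "nm (f (smul c y) - smul c (f y)) \<le> e * (C * nm y)" by (simp add: nm_diff_le)
    also have "\<dots> < e * (C * nm y + 1)" using \<open>e > 0\<close> by simp
    also have "\<dots> = nm (f (smul c y) - smul c (f y))" using den by (simp add: e_def)
    finally show False by simp
  qed
  thus ?thesis using add by (simp add: lin_iff)
qed

definition ppow :: "nat \<Rightarrow> 'd \<Rightarrow> 'd" where "ppow k x = smul (of_nat CARD('p) ^ k) x"

lemma nm_ppow: "nm (ppow k x) = (1 / real CARD('p)) ^ k * nm x"
  by (simp add: ppow_def nm_smul padic_norm_power padic_norm_p)

lemma pinv_ppow: "pinv k (ppow k x) = x"
  by (simp add: ppow_def pinv_pow)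

lemma ppow_add: "ppow k (x + y) = ppow k x + ppow k y"
  by (simp add: ppow_def scale_right_distrib)

lemma ppow_diff: "ppow k (x - y) = ppow k x - ppow k y"
  by (simp add: ppow_def scale_right_diff_distrib)

lemma ppow_mult_left: "ppow k (a * x) = a * ppow k x" and ppow_mult_right: "ppow k (x * a) = ppow k x * a"
  by (simp_all add: ppow_def smul_mult_left smul_mult_right)

lemma eventually_ppow_small:
  assumes "e > 0" shows "\<forall>\<^sub>F k in sequentially. nm (ppow k y) \<le> e"
proof -
  have "\<forall>\<^sub>F k in sequentially. nm y * (1 / real CARD('p)) ^ k < e"
    by (rule order_tendstoD(2)[OF p_power_null assms])
  thus ?thesis by eventually_elim (simp add: nm_ppow mult.commute)
qed

lemma eventually_ppow_U: "e > 0 \<Longrightarrow> \<forall>\<^sub>F k in sequentially. 1 + ppow k y \<in> U e"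
  using eventually_ppow_small[of e y] by (simp add: U_def)

section \<open>The automatic Lipschitz estimate for a local homomorphism\<close>

context
  fixes ph :: "'d \<Rightarrow> 'd" and e0 :: real
  assumes e0: "0 < e0" "e0 < 1"
    and hom: "\<And>x y. x \<in> U e0 \<Longrightarrow> y \<in> U e0 \<Longrightarrow> ph (x * y) = ph x * ph y"
    and ph_ne_0: "\<And>x. x \<in> U e0 \<Longrightarrow> ph x \<noteq> 0"
begin

lemma hom_1: "ph 1 = 1"
  using hom[of 1 1] ph_ne_0[of 1] e0 by (simp add: one_in_U)

lemma hom_power: "x \<in> U e0 \<Longrightarrow> ph (x ^ n) = ph x ^ n"
  using e0 by (induction n) (simp_all add: hom_1 hom U_power)

lemma hom_inverse: "x \<in> U e0 \<Longrightarrow> ph (inverse x) = inverse (ph x)"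
  using hom[of x "inverse x"] e0 U_inverse[of x e0] U_ne_0[of x e0] hom_1
  by (metis inverse_unique right_inverse)

text \<open>Elements near 1 are infinitely \<open>(p + 1)\<close>-divisible, whereas the value group is \<open>\<int>\<close>.\<close>

lemma hom_unit_norm:
  assumes x: "x \<in> U e0" shows "padic_norm (rnorm (ph x)) = 1"
proof -
  \<comment> \<open>\<open>p + 1\<close> has norm 1, so \<open>n\<close>-th roots of elements of the
    ball stay in the same ball and can be extracted indefinitely, in contrast to \<open>p\<close>-th
    roots; and it exceeds 1, so its powers outgrow \<open>m\<close>.\<close>
  define n where "n = CARD('p) + 1"
  define q where "q = real CARD('p)"
  have q: "q > 1" using pp_gt1 by (simp add: q_def)
  have n1: "padic_norm (of_nat n :: 'p padic) = 1"
    using padic_norm_unit_ball_add[of "of_nat CARD('p) :: 'p padic"] pp_gt1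
    by (simp add: n_def padic_norm_p)
  have root: "\<exists>v\<in>U e0. v ^ (n ^ j) = x" for j
  proof (induction j)
    case 0
    thus ?case using x by auto
  next
    case (Suc j)
    then obtain v where v: "v \<in> U e0" "v ^ (n ^ j) = x" by blast
    obtain w where "w \<in> U e0" "w ^ n = v"
      by (rule U_root[of v e0 n]) (use v e0 n1 in auto)
    thus ?case using v by (auto simp: power_mult intro!: bexI[of _ w])
  qed
  obtain m where m: "padic_norm (rnorm (ph x)) = q powi m"
    using padic_norm_powi[OF rnorm_ne_0[OF ph_ne_0[OF x]]] unfolding q_def by blast
  have dvd: "int n ^ j dvd m" for j
  proof -
    obtain v where v: "v \<in> U e0" "v ^ (n ^ j) = x" using root by blast
    obtain l where l: "padic_norm (rnorm (ph v)) = q powi l"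
      using padic_norm_powi[OF rnorm_ne_0[OF ph_ne_0[OF v(1)]]] unfolding q_def by blast
    have "q powi m = (q powi l) ^ (n ^ j)"
      unfolding m[symmetric] l[symmetric] using v
      by (simp add: hom_power rnorm_power padic_norm_power flip: v(2))
    also have "\<dots> = q powi (l * int (n ^ j))"
      by (simp only: power_int_mult power_int_of_nat)
    finally have "m = l * int (n ^ j)" 
      using power_int_strict_increasing[of _ _ q] q by (metis linorder_neqE less_irrefl)
    thus ?thesis by simp
  qed
  have "m = 0"
  proof (rule ccontr)
    assume "m \<noteq> 0"
    hence "int n ^ nat \<bar>m\<bar> \<le> \<bar>m\<bar>" using dvd[of "nat \<bar>m\<bar>"] by (intro zdvd_imp_le) auto
    moreover have "nat \<bar>m\<bar> < 2 ^ nat \<bar>m\<bar>" by (rule less_exp)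
    moreover have "(2::nat) ^ nat \<bar>m\<bar> \<le> n ^ nat \<bar>m\<bar>" using q unfolding q_def n_def by (intro power_mono) auto
    ultimately have "int (n ^ nat \<bar>m\<bar>) \<le> int (nat \<bar>m\<bar>)" "nat \<bar>m\<bar> < n ^ nat \<bar>m\<bar>"
      by (simp, blast intro: less_le_trans)
    thus False by linarith
  qed
  thus ?thesis by (simp add: m)
qed

text \<open>Each \<open>p\<close>-th root may enlarge the distance to 1 by a factor
  \<open>p\<close>. From radius \<open>e * p ^ (-k)\<close> this can be repeated \<open>k\<close>
  times, as all radii stay below \<open>1 / p\<close>.\<close>

lemma p_power_roots:
  assumes e: "0 \<le> e" "e \<le> lrad"
  shows "x \<in> U (e * (1 / real CARD('p)) ^ k) \<Longrightarrow> \<exists>w\<in>U e. w ^ (CARD('p) ^ k) = x"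
proof (induction k arbitrary: x)
  case (Suc k)
  have "e * (1 / real CARD('p)) ^ k \<le> e * 1" using e pp_gt1 by (intro mult_left_mono power_le_one) auto
  moreover have "e < 1 / real CARD('p)"
  proof -
    have "e * real CARD('p) \<le> lrad * real CARD('p)" using e by (intro mult_right_mono) auto
    hence "e * real CARD('p) < 1" using lrad(5)[unfolded mult.commute[of _ lrad]] by linarith
    thus ?thesis using pp_gt1 by (simp add: pos_less_divide_eq)
  qed
  ultimately have "e * (1 / real CARD('p)) ^ k < 1 / real CARD('p)" by linarith
  moreover have "x \<in> U (e * (1 / real CARD('p)) ^ k * padic_norm (of_nat CARD('p) :: 'p padic))"
    using Suc.prems by (simp add: padic_norm_p mult_ac)
  ultimately obtain v where v: "v \<in> U (e * (1 / real CARD('p)) ^ k)" "v ^ CARD('p) = x"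
    using U_root[of x "e * (1 / real CARD('p)) ^ k" "CARD('p)"] e by (auto simp: padic_norm_p)
  obtain w where "w \<in> U e" "w ^ (CARD('p) ^ k) = v" using Suc.IH[OF v(1)] by blast
  thus ?case using v(2) by (auto simp: power_mult mult.commute[of "CARD('p)"] intro!: bexI[of _ w])
qed auto

text \<open>Near 1, \<open>x = (v ^ M) ^ (p ^ k)\<close> with \<open>v\<close> in the domain. The
  element \<open>ph v\<close> has norm one, hence \<open>ph v ^ M\<close> lies in
  \<open>U lrad\<close>, and the \<open>p ^ k\<close>-th power contracts it by
  \<open>p ^ (-k)\<close>. Here continuity at 1 appears.\<close>

lemma hom_scaled:
  "\<exists>\<delta>. 0 < \<delta> \<and> \<delta> \<le> e0 \<and> \<delta> \<le> lrad \<and>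
    (\<forall>k x. x \<in> U (\<delta> * (1 / real CARD('p)) ^ k) \<longrightarrow> ph x \<in> U (lrad * (1 / real CARD('p)) ^ k))"
proof -
  obtain M where M: "M > 0" "\<And>g. padic_norm (rnorm g) = 1 \<Longrightarrow> g ^ M \<in> U lrad"
    using unit_norm_power_near_1[of lrad] lrad by (metis less_imp_le)
  define m where "m = padic_norm (of_nat M :: 'p padic)"
  have "m \<noteq> 0" using M(1) by (simp add: m_def)
  hence m: "m > 0" "m \<le> 1" using padic_norm_ge0[of "of_nat M :: 'p padic"] padic_norm_of_nat_le1[of M, where ?'p = 'p]
    unfolding m_def by linarith+
  define e1 where "e1 = min e0 (m / 2)"
  have e1: "0 < e1" "e1 < m" "e1 \<le> e0" using e0 m by (auto simp: e1_def)
  \<comment> \<open>\<open>e1 * m\<close> is the radius on which \<open>M\<close>-th roots exist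
    inside \<open>U e1\<close>, and \<open>lrad\<close> permits the \<open>p\<close>-power
    roots.\<close>
  define \<delta> where "\<delta> = min lrad (e1 * m)"
  have d: "0 < \<delta>" "\<delta> \<le> lrad" "\<delta> \<le> e1 * m" using lrad e1 m by (auto simp: \<delta>_def)
  have "\<delta> \<le> e1" using d(3) m e1 by (meson less_eq_real_def mult_left_le order_trans)
  have "ph x \<in> U (lrad * (1 / real CARD('p)) ^ k)" if x: "x \<in> U (\<delta> * (1 / real CARD('p)) ^ k)" for k x
  proof -
    obtain w where w: "w \<in> U \<delta>" "w ^ (CARD('p) ^ k) = x" using p_power_roots[of \<delta> x k] d x by auto
    have "w \<in> U (e1 * m)" using w(1) d(3) by (rule U_mono)
    then obtain v where v: "v \<in> U e1" "v ^ M = w" using U_root[of w e1 M] e1 unfolding m_def by auto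
    have ve: "v \<in> U e0" using v(1) e1(3) by (rule U_mono)
    have e: "ph x = (ph v ^ M) ^ (CARD('p) ^ k)"
      using ve by (simp flip: w(2) v(2) power_mult add: hom_power)
    have near: "ph v ^ M \<in> U lrad" by (rule M(2)[OF hom_unit_norm[OF ve]])
    have "nm ((ph v ^ M) ^ (CARD('p) ^ k) - 1) \<le> (1 / real CARD('p)) ^ k * nm (ph v ^ M - 1)"
      using near lrad by (intro p_power_U) (auto simp: U_def)
    also have "\<dots> \<le> (1 / real CARD('p)) ^ k * lrad" using near by (intro mult_left_mono) (auto simp: U_def)
    finally show ?thesis unfolding e U_def by (simp add: mult.commute)
  qed
  moreover have "\<delta> \<le> e0" using \<open>\<delta> \<le> e1\<close> e1(3) by linarith
  ultimately show ?thesis using d by blast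
qed

lemma hom_Lipschitz:
  obtains \<delta> C where "0 < \<delta>" "\<delta> \<le> e0" "\<delta> \<le> lrad" "C \<ge> 1"
    "\<And>x. x \<in> U \<delta> \<Longrightarrow> ph x \<in> U lrad"
    "\<And>x y. x \<in> U \<delta> \<Longrightarrow> y \<in> U \<delta> \<Longrightarrow> nm (ph x - ph y) \<le> C * nm (x - y)"
proof -
  obtain \<delta> where d: "0 < \<delta>" "\<delta> \<le> e0" "\<delta> \<le> lrad"
    "\<And>k x. x \<in> U (\<delta> * (1 / real CARD('p)) ^ k) \<Longrightarrow> ph x \<in> U (lrad * (1 / real CARD('p)) ^ k)"
    using hom_scaled by blast
  define q where "q = real CARD('p)"
  have q: "q > 1" using pp_gt1 by (simp add: q_def)
  have near: "ph x \<in> U lrad" if "x \<in> U \<delta>" for x using d(4)[of x 0] that by simp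
  \<comment> \<open>The bound is known only at radii \<open>\<delta> * p ^ (-k)\<close>; rounding
    \<open>nm (x - 1)\<close> up to such a radius costs the factor \<open>q\<close>.\<close>
  define C where "C = q * lrad / \<delta>"
  have C0: "C > 0" using q lrad d by (simp add: C_def)
  have L1: "nm (ph x - 1) \<le> C * nm (x - 1)" if x: "x \<in> U \<delta>" for x
  proof (cases "x = 1")
    case False
    hence pos: "nm (x - 1) / \<delta> > 0" using d nm_pos[of "x - 1"] by simp
    obtain j where j: "(1 / q) ^ j < nm (x - 1) / \<delta>"
      using real_arch_pow_inv[OF pos, of "1 / q"] q by auto
    define n where "n = (LEAST n. (1 / q) ^ n < nm (x - 1) / \<delta>)"
    have n: "(1 / q) ^ n < nm (x - 1) / \<delta>" unfolding n_def using j by (rule LeastI)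
    have "n \<noteq> 0"
    proof
      assume "n = 0"
      thus False using n x d by (simp add: U_def field_simps)
    qed
    then obtain k where k: "n = Suc k" by (cases n) auto
    have "\<not> (1 / q) ^ k < nm (x - 1) / \<delta>"
      using not_less_Least[of k "\<lambda>n. (1 / q) ^ n < nm (x - 1) / \<delta>"] k by (simp add: n_def)
    hence "x \<in> U (\<delta> * (1 / q) ^ k)" using d by (simp add: U_def field_simps)
    hence "nm (ph x - 1) \<le> lrad * (1 / q) ^ k" using d(4) unfolding q_def U_def by blast
    also have "\<dots> = lrad * q * (1 / q) ^ n" using q by (simp add: k)
    also have "\<dots> \<le> lrad * q * (nm (x - 1) / \<delta>)" using n lrad q by (intro mult_left_mono) auto
    finally show ?thesis by (simp add: C_def mult_ac)
  qed (simp add: hom_1)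
  \<comment> \<open>Translation to 1 by \<open>inverse y\<close> costs \<open>nm 1\<close> once for
    \<open>inverse y\<close> and once for \<open>ph y\<close>.\<close>
  define C' where "C' = max 1 (nm 1 * (C * nm 1))"
  have "nm (ph x - ph y) \<le> C' * nm (x - y)" if x: "x \<in> U \<delta>" and y: "y \<in> U \<delta>" for x y
  proof -
    have d1: "\<delta> < 1" using d e0 by simp
    have ye: "y \<in> U e0" "x \<in> U e0" using x y d U_mono by blast+
    have y0: "y \<noteq> 0" using y d1 by (rule U_ne_0)
    have iy: "inverse y \<in> U \<delta>" using y d1 by (rule U_inverse)
    have iy': "inverse y \<in> U e0" using iy d U_mono by blast
    have z: "inverse y * x \<in> U \<delta>" using iy x d1 by (intro U_mult) auto
    have "ph x - ph y = ph y * (ph (inverse y * x) - 1)"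
      using hom[OF iy' ye(2)] hom_inverse[OF ye(1)] ph_ne_0[OF ye(1)]
      by (simp add: right_diff_distrib flip: mult.assoc)
    moreover have "nm (ph y) \<le> nm 1" using near[OF y] lrad(2) by (intro nm_U) auto
    moreover have "nm (ph (inverse y * x) - 1) \<le> C * nm (inverse y * x - 1)" by (rule L1[OF z])
    moreover have "inverse y * x - 1 = inverse y * (x - y)" using y0 by (simp add: right_diff_distrib)
    moreover have "nm (inverse y * (x - y)) \<le> nm 1 * nm (x - y)"
      using iy d1 by (intro nm_mult_le nm_U) auto
    ultimately have "nm (ph x - ph y) \<le> nm 1 * (C * (nm 1 * nm (x - y)))"
      using C0 by (auto intro!: nm_mult_le intro: order.trans mult_left_mono)
    also have "\<dots> \<le> C' * nm (x - y)"
      unfolding mult.assoc[symmetric] C'_def by (intro mult_right_mono) (auto simp: mult_ac)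
    finally show ?thesis .
  qed
  thus ?thesis using that[of \<delta> C'] d near by (auto simp: C'_def)
qed

section \<open>The differential at 1\<close>

context
  fixes \<delta> C :: real
  assumes d: "0 < \<delta>" "\<delta> \<le> e0" "\<delta> \<le> lrad" and C: "C \<ge> 1"
    and near: "\<And>x. x \<in> U \<delta> \<Longrightarrow> ph x \<in> U lrad"
    and Lip: "\<And>x y. x \<in> U \<delta> \<Longrightarrow> y \<in> U \<delta> \<Longrightarrow> nm (ph x - ph y) \<le> C * nm (x - y)"
begin

lemma U_le_e0: "x \<in> U \<delta> \<Longrightarrow> x \<in> U e0"
  using d U_mono by blast

lemma delta_less_1: "\<delta> < 1"
  using d e0 by simp

lemma Lip1: "x \<in> U \<delta> \<Longrightarrow> nm (ph x - 1) \<le> C * nm (x - 1)"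
  using Lip[of x 1] d by (simp add: hom_1 one_in_U)

text \<open>Difference quotients of \<open>ph\<close> at 1 in direction \<open>y\<close> with
  increment \<open>p ^ k\<close>; their limit \<open>sg\<close> is the differential.\<close>

definition sgs :: "'d \<Rightarrow> nat \<Rightarrow> 'd" where "sgs y k = pinv k (ph (1 + ppow k y) - 1)"

definition sg :: "'d \<Rightarrow> 'd" where "sg y = (SOME l. conv (sgs y) l)"

lemma scaled_null: "(\<lambda>k. real CARD('p) ^ k * (A * ((1 / real CARD('p)) ^ k) ^ 2)) \<longlonglongrightarrow> 0"
proof -
  have "(\<lambda>k. real CARD('p) ^ k * (A * ((1 / real CARD('p)) ^ k) ^ 2)) = (\<lambda>k. A * (1 / real CARD('p)) ^ k)"
    using pp_gt1 by (simp add: fun_eq_iff power2_eq_square power_divide)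
  thus ?thesis using p_power_null[of A] by simp
qed

text \<open>With \<open>t\<close> the norm of \<open>ppow k y\<close>, the points
  \<open>1 + ppow (Suc k) y\<close> and \<open>(1 + ppow k y) ^ p\<close> differ by at most
  \<open>t ^ 2\<close>; on the image side the \<open>p\<close>-th power deviates from its linear
  part by at most \<open>C ^ 2 * t ^ 2\<close>. As \<open>t ^ 2\<close> decays like
  \<open>p ^ (-2 k)\<close>, division by \<open>p ^ Suc k\<close> leaves vanishing steps.\<close>

lemma conv_sg: "conv (sgs y) (sg y)"
proof -
  define A where "A = (C + C ^ 2) * nm y ^ 2"
  have "\<forall>\<^sub>F k in sequentially. nm (ppow k y) \<le> 1" by (rule eventually_ppow_small) simp
  hence ev: "\<forall>\<^sub>F k in sequentially. nm (sgs y (Suc k) - sgs y k) \<le> real CARD('p) * A * (1 / real CARD('p)) ^ k"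
    using eventually_ppow_U[OF d(1), of y]
  proof eventually_elim
    case (elim k)
    define g where "g = 1 + ppow k y"
    define t where "t = nm (ppow k y)"
    have t: "t = nm (g - 1)" "0 \<le> t" by (simp_all add: t_def g_def)
    have gU: "g \<in> U \<delta>" using elim by (simp add: g_def)
    have pg: "ph g ^ CARD('p) = ph (g ^ CARD('p))" using hom_power[OF U_le_e0[OF gU]] by simp
    have g1: "1 + ppow (Suc k) y - 1 = smul (of_nat CARD('p)) (g - 1)"
      by (simp add: g_def ppow_def)
    have sU: "1 + ppow (Suc k) y \<in> U \<delta>"
      using gU unfolding U_def mem_Collect_eq g1 nm_smul padic_norm_p
      using pp_gt1 mult_right_mono[of "1 / real CARD('p)" 1 "nm (g - 1)"] by simp
    have gpU: "g ^ CARD('p) \<in> U \<delta>" using gU delta_less_1 by (intro U_power) auto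
    have "nm (g ^ CARD('p) - 1 ^ CARD('p) - smul (of_nat CARD('p)) (g - 1)) \<le> t * nm (g - 1)"
      using elim(1) by (intro power_U_diff) (auto simp: U_def t t_def g_def)
    hence H: "nm (g ^ CARD('p) - 1 - smul (of_nat CARD('p)) (g - 1)) \<le> t ^ 2"
      by (simp add: t power2_eq_square)
    have s1: "1 + ppow (Suc k) y = 1 + smul (of_nat CARD('p)) (g - 1)"
      by (simp add: g_def ppow_def)
    have "nm (1 + ppow (Suc k) y - g ^ CARD('p)) \<le> t ^ 2"
      unfolding s1 by (subst nm_minus_commute) (use H in \<open>simp only: diff_diff_add\<close>)
    hence "C * nm (1 + ppow (Suc k) y - g ^ CARD('p)) \<le> C * t ^ 2" using C by (intro mult_left_mono) auto
    hence 1: "nm (ph (1 + ppow (Suc k) y) - ph (g ^ CARD('p))) \<le> C * t ^ 2"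
      using Lip[OF sU gpU] by linarith
    have h: "nm (ph g - 1) \<le> C * t" using Lip1[OF gU] by (simp add: t)
    have "nm (ph g ^ CARD('p) - 1 ^ CARD('p) - smul (of_nat CARD('p)) (ph g - 1)) \<le> nm (ph g - 1) * nm (ph g - 1)"
      using near[OF gU] lrad(2) by (intro power_U_diff) (auto simp: U_def)
    also have "\<dots> \<le> C ^ 2 * t ^ 2" using mult_mono[OF h h] C t by (simp add: power2_eq_square mult_ac)
    finally have 2: "nm (ph g ^ CARD('p) - 1 - smul (of_nat CARD('p)) (ph g - 1)) \<le> C ^ 2 * t ^ 2" by simp
    have "nm (ph (1 + ppow (Suc k) y) - 1 - smul (of_nat CARD('p)) (ph g - 1)) \<le> (C + C ^ 2) * t ^ 2"
    proof -
      have e: "ph (1 + ppow (Suc k) y) - 1 - smul (of_nat CARD('p)) (ph g - 1) =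
          (ph (1 + ppow (Suc k) y) - ph (g ^ CARD('p))) + (ph g ^ CARD('p) - 1 - smul (of_nat CARD('p)) (ph g - 1))"
        unfolding pg by (simp add: algebra_simps)
      have "nm ((ph (1 + ppow (Suc k) y) - ph (g ^ CARD('p))) + (ph g ^ CARD('p) - 1 - smul (of_nat CARD('p)) (ph g - 1)))
          \<le> (C + C ^ 2) * t ^ 2"
        using 1 2 C by (intro nm_add_le) (auto simp: algebra_simps intro: order.trans)
      thus ?thesis by (simp only: e)
    qed
    hence "real CARD('p) ^ Suc k * nm (ph (1 + ppow (Suc k) y) - 1 - smul (of_nat CARD('p)) (ph g - 1)) \<le>
       real CARD('p) ^ Suc k * ((C + C ^ 2) * t ^ 2)"
      by (intro mult_left_mono) auto
    also have "real CARD('p) ^ Suc k * nm (ph (1 + ppow (Suc k) y) - 1 - smul (of_nat CARD('p)) (ph g - 1)) =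
        nm (sgs y (Suc k) - sgs y k)"
      unfolding sgs_def pinv_Suc[of k, symmetric] pinv_diff[symmetric] nm_pinv g_def by simp
    also have "real CARD('p) ^ Suc k * ((C + C ^ 2) * t ^ 2) = real CARD('p) * A * (1 / real CARD('p)) ^ k"
      using pp_gt1 by (simp add: t_def A_def nm_ppow power_mult_distrib power_divide power2_eq_square)
    finally show ?case .
  qed
  have "(\<lambda>k. nm (sgs y (Suc k) - sgs y k)) \<longlonglongrightarrow> 0"
    by (rule null_mono[OF p_power_null _ ev]) simp
  then obtain l where "conv (sgs y) l" by (rule convI)
  thus ?thesis unfolding sg_def by (rule someI)
qed

lemma sg_eqI: "conv (sgs y) l \<Longrightarrow> sg y = l"
  using conv_sg conv_unique by blast

text \<open>By the Lipschitz bound any sequence tangent to \<open>y\<close> up to a quadratic error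
  computes \<open>sg y\<close>; products and powers can thus replace
  \<open>1 + ppow k y\<close>.\<close>

lemma conv_sg_approx:
  assumes x: "\<forall>\<^sub>F k in sequentially. x k \<in> U \<delta>"
    and a: "\<And>k. nm (x k - 1 - ppow k y) \<le> A * ((1 / real CARD('p)) ^ k) ^ 2"
  shows "conv (\<lambda>k. pinv k (ph (x k) - 1)) (sg y)"
proof (rule conv_transform[OF conv_sg])
  show "(\<lambda>k. nm (pinv k (ph (x k) - 1) - sgs y k)) \<longlonglongrightarrow> 0"
  proof (rule null_mono[OF scaled_null[of "C * A"]])
    show "\<forall>\<^sub>F k in sequentially. nm (pinv k (ph (x k) - 1) - sgs y k) \<le>
        real CARD('p) ^ k * (C * A * ((1 / real CARD('p)) ^ k) ^ 2)"
      using x eventually_ppow_U[OF d(1), of y]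
    proof eventually_elim
      case (elim k)
      have "nm (pinv k (ph (x k) - 1) - sgs y k) = real CARD('p) ^ k * nm (ph (x k) - ph (1 + ppow k y))"
        by (simp add: sgs_def nm_pinv flip: pinv_diff)
      also have "\<dots> \<le> real CARD('p) ^ k * (C * nm (x k - (1 + ppow k y)))"
        using Lip elim by (intro mult_left_mono) auto
      also have "\<dots> \<le> real CARD('p) ^ k * (C * (A * ((1 / real CARD('p)) ^ k) ^ 2))"
        using a[of k] C by (intro mult_left_mono) (auto simp: algebra_simps)
      finally show ?case by (simp add: mult_ac)
    qed
  qed simp
qed

lemma nm_sgs: "\<forall>\<^sub>F k in sequentially. nm (sgs y k) \<le> C * nm y"
  using eventually_ppow_U[OF d(1), of y]
proof eventually_elim
  case (elim k)
  have "nm (sgs y k) \<le> real CARD('p) ^ k * (C * nm (1 + ppow k y - 1))"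
    unfolding sgs_def nm_pinv using Lip1[OF elim] by (intro mult_left_mono) auto
  thus ?case using pp_gt1 by (simp add: nm_ppow power_divide)
qed

lemma nm_sg: "nm (sg y) \<le> C * nm y"
  using conv_bound[OF conv_sg, of y 0 "C * nm y"] nm_sgs by simp

text \<open>The product of \<open>1 + ppow k x\<close> and \<open>1 + ppow k y\<close> is tangent to
  \<open>x + y\<close>, and its image is the product of the images, whose quadratic term is
  negligible.\<close>

lemma sg_add: "sg (x + y) = sg x + sg y"
proof -
  define z where "z k = (1 + ppow k x) * (1 + ppow k y)" for k
  have ez: "\<forall>\<^sub>F k in sequentially. z k \<in> U \<delta>"
    using eventually_ppow_U[OF d(1), of y] eventually_ppow_U[OF d(1), of x]
    by eventually_elim (use delta_less_1 in \<open>simp add: z_def U_mult\<close>)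
  have "nm (z k - 1 - ppow k (x + y)) \<le> nm x * nm y * ((1 / real CARD('p)) ^ k) ^ 2" for k
  proof -
    have "z k - 1 - ppow k (x + y) = ppow k x * ppow k y" by (simp add: z_def algebra_simps ppow_add)
    thus ?thesis using nm_mult[of "ppow k x" "ppow k y"] by (simp add: nm_ppow power2_eq_square mult_ac)
  qed
  from conv_sg_approx[OF ez this] have 1: "conv (\<lambda>k. pinv k (ph (z k) - 1)) (sg (x + y))" .
  have "conv (\<lambda>k. pinv k (ph (z k) - 1)) (sg x + sg y)"
  proof (rule conv_transform[OF conv_add[OF conv_sg conv_sg]])
    show "(\<lambda>k. nm (pinv k (ph (z k) - 1) - (sgs x k + sgs y k))) \<longlonglongrightarrow> 0"
    proof (rule null_mono[OF scaled_null[of "(C * nm x) * (C * nm y)"]])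
      show "\<forall>\<^sub>F k in sequentially. nm (pinv k (ph (z k) - 1) - (sgs x k + sgs y k))
         \<le> real CARD('p) ^ k * ((C * nm x) * (C * nm y) * ((1 / real CARD('p)) ^ k) ^ 2)"
        using eventually_ppow_U[OF d(1), of y] eventually_ppow_U[OF d(1), of x]
      proof eventually_elim
        case (elim k)
        define a b where "a = ph (1 + ppow k x)" and "b = ph (1 + ppow k y)"
        have "ph (z k) = a * b" unfolding z_def a_def b_def using elim by (intro hom U_le_e0)
        hence "ph (z k) - 1 - ((a - 1) + (b - 1)) = (a - 1) * (b - 1)" by (simp add: algebra_simps)
        hence "nm (pinv k (ph (z k) - 1) - (sgs x k + sgs y k)) = real CARD('p) ^ k * nm ((a - 1) * (b - 1))"
          by (simp add: sgs_def nm_pinv flip: pinv_diff pinv_add a_def b_def)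
        also have "\<dots> \<le> real CARD('p) ^ k * ((C * nm (ppow k x)) * (C * nm (ppow k y)))"
          using Lip1[OF elim(1)] Lip1[OF elim(2)]
          by (intro mult_left_mono nm_mult_le) (auto simp: a_def b_def)
        finally show ?case by (simp add: nm_ppow power2_eq_square mult_ac)
      qed
    qed simp
  qed
  with 1 show ?thesis by (rule conv_unique)
qed

lemma lin_sg: "lin sg"
  by (rule additive_bounded_imp_lin[OF sg_add nm_sg C])

lemma sg_ppow: "sg (ppow k x) = ppow k (sg x)"
  by (simp add: ppow_def lin_smul[OF lin_sg])

text \<open>Conjugation by \<open>u\<close> maps the points \<open>1 + ppow k y\<close> exactly onto
  those for \<open>u * y * inverse u\<close>, so it passes through the difference quotients.\<close>

lemma sg_conj: assumes u: "u \<in> U \<delta>" shows "sg (u * y * inverse u) * ph u = ph u * sg y"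
proof -
  have u0: "u \<noteq> 0" using u delta_less_1 by (rule U_ne_0)
  have iu: "inverse u \<in> U \<delta>" using u delta_less_1 by (rule U_inverse)
  have "conv (sgs (u * y * inverse u)) (ph u * sg y * inverse (ph u))"
  proof (rule conv_eventually_eq[OF conv_mult_right[OF conv_mult_left[OF conv_sg]]])
    show "\<forall>\<^sub>F k in sequentially. sgs (u * y * inverse u) k = ph u * sgs y k * inverse (ph u)"
      using eventually_ppow_U[OF d(1), of y]
    proof eventually_elim
      case (elim k)
      have "1 + ppow k (u * y * inverse u) = u * (1 + ppow k y) * inverse u"
        unfolding ppow_mult_right[of k "u * y" "inverse u"] ppow_mult_left[of k u y]
        using u0 by (simp add: distrib_left distrib_right)
      moreover have "u * (1 + ppow k y) \<in> U \<delta>" using u elim delta_less_1 by (intro U_mult) auto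
      ultimately have "ph (1 + ppow k (u * y * inverse u)) = ph u * ph (1 + ppow k y) * inverse (ph u)"
        using u iu elim by (simp add: hom U_le_e0 hom_inverse)
      hence "ph (1 + ppow k (u * y * inverse u)) - 1 = ph u * (ph (1 + ppow k y) - 1) * inverse (ph u)"
        using ph_ne_0[OF U_le_e0[OF u]] by (simp add: algebra_simps)
      thus ?case
        by (simp only: sgs_def pinv_mult_left[of k "ph u"] pinv_mult_right[of k _ "inverse (ph u)"])
    qed
  qed
  hence "sg (u * y * inverse u) = ph u * sg y * inverse (ph u)" by (rule sg_eqI)
  thus ?thesis using ph_ne_0[OF U_le_e0[OF u]] by (simp add: mult.assoc)
qed

text \<open>The conjugation law is differentiated at \<open>u = 1 + ppow k x\<close>. The identity
  \<open>u * y * inverse u - y = ppow k (ad x y * inverse u)\<close> is exact, so after division by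
  \<open>p ^ k\<close> one side tends to \<open>sg (ad x y)\<close> and the other to the commutator
  of the differentials.\<close>

lemma sg_ad: "sg (ad x y) = ad (sg x) (sg y)"
proof -
  define z where "z = ad x y"
  define u where "u k = 1 + ppow k x" for k
  have eu: "\<forall>\<^sub>F k in sequentially. u k \<in> U \<delta>" unfolding u_def by (rule eventually_ppow_U[OF d(1)])
  have eq: "\<forall>\<^sub>F k in sequentially. sg (z * inverse (u k)) * ph (u k) = sgs x k * sg y - sg y * sgs x k"
    using eu
  proof eventually_elim
    case (elim k)
    have u0: "u k \<noteq> 0" using elim delta_less_1 by (rule U_ne_0)
    have "ppow k (z * inverse (u k)) = ad (u k) y * inverse (u k)"
    proof -
      have "ppow k z = ppow k x * y - y * ppow k x"
        by (simp only: z_def ad_def ppow_diff ppow_mult_right[of k x y] ppow_mult_left[of k y x])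
      also have "\<dots> = ad (u k) y" by (simp add: ad_def u_def algebra_simps)
      finally show ?thesis by (simp only: ppow_mult_right[of k z "inverse (u k)"])
    qed
    also have "\<dots> = u k * y * inverse (u k) - y" using u0 by (simp add: ad_def left_diff_distrib mult.assoc)
    finally have "ppow k (sg (z * inverse (u k))) = sg (u k * y * inverse (u k)) - sg y"
      by (metis sg_ppow lin_diff[OF lin_sg])
    hence "ppow k (sg (z * inverse (u k)) * ph (u k)) = ph (u k) * sg y - sg y * ph (u k)"
      using sg_conj[OF elim, of y] by (simp add: ppow_mult_right left_diff_distrib)
    also have "\<dots> = (ph (u k) - 1) * sg y - sg y * (ph (u k) - 1)" by (simp add: algebra_simps)
    finally have "pinv k (ppow k (sg (z * inverse (u k)) * ph (u k))) =
        pinv k ((ph (u k) - 1) * sg y - sg y * (ph (u k) - 1))" by simp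
    thus ?case
      by (simp only: pinv_ppow pinv_diff[of k "_ * _"] pinv_mult_right[of k _ "sg y"] pinv_mult_left[of k "sg y"]
           sgs_def u_def)
  qed
  have "conv (\<lambda>k. sg (z * inverse (u k)) * ph (u k)) (sg x * sg y - sg y * sg x)"
    by (rule conv_eventually_eq[OF conv_diff[OF conv_mult_right[OF conv_sg] conv_mult_left[OF conv_sg]] eq])
  moreover have "conv (\<lambda>k. sg (z * inverse (u k)) * ph (u k)) (sg z)"
    unfolding conv_def
  proof (rule null_mono)
    show "(\<lambda>k. (C * nm z * nm x * nm 1 + nm (sg z) * (C * nm x)) * (1 / real CARD('p)) ^ k) \<longlonglongrightarrow> 0"
      by (rule p_power_null)
    show "\<forall>\<^sub>F k in sequentially. nm (sg (z * inverse (u k)) * ph (u k) - sg z) \<le>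
        (C * nm z * nm x * nm 1 + nm (sg z) * (C * nm x)) * (1 / real CARD('p)) ^ k"
      using eu
    proof eventually_elim
      case (elim k)
      have nu: "nm (u k - 1) = (1 / real CARD('p)) ^ k * nm x" by (simp add: u_def nm_ppow)
      have "u k \<in> U (nm (u k - 1))" "nm (u k - 1) < 1" using elim delta_less_1 by (auto simp: U_def)
      hence iu: "nm (inverse (u k) - 1) \<le> (1 / real CARD('p)) ^ k * nm x"
        using U_inverse[of "u k" "nm (u k - 1)"] by (simp add: U_def nu)
      have "sg (z * inverse (u k)) * ph (u k) - sg z =
          sg (z * (inverse (u k) - 1)) * ph (u k) + sg z * (ph (u k) - 1)"
        by (simp add: right_diff_distrib lin_diff[OF lin_sg] left_diff_distrib)
      moreover have "nm (sg (z * (inverse (u k) - 1)) * ph (u k)) \<le>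
          (C * (nm z * ((1 / real CARD('p)) ^ k * nm x))) * nm 1"
        using near[OF elim] less_imp_le[OF lrad(2)] iu C
        by (intro nm_mult_le nm_U order.trans[OF nm_sg] mult_left_mono) auto
      moreover have "nm (sg z * (ph (u k) - 1)) \<le> nm (sg z) * (C * ((1 / real CARD('p)) ^ k * nm x))"
        using Lip1[OF elim] by (intro nm_mult_le) (auto simp: nu)
      moreover have "0 \<le> C * (nm z * ((1 / real CARD('p)) ^ k * nm x)) * nm 1"
        "0 \<le> nm (sg z) * (C * ((1 / real CARD('p)) ^ k * nm x))" using C by simp_all
      ultimately have "nm (sg (z * inverse (u k)) * ph (u k) - sg z) \<le>
         C * (nm z * ((1 / real CARD('p)) ^ k * nm x)) * nm 1 + nm (sg z) * (C * ((1 / real CARD('p)) ^ k * nm x))"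
        by (auto intro!: nm_add_le)
      thus ?case by (simp add: algebra_simps)
    qed
  qed simp
  ultimately show ?thesis unfolding z_def ad_def[of "sg x"] by (rule conv_unique[symmetric])
qed

text \<open>The powers \<open>g ^ (p ^ k)\<close> are tangent to \<open>lg g\<close>, and since
  \<open>ph\<close> commutes with powers, the corresponding difference quotients are the logarithm
  approximations of \<open>ph g\<close>.\<close>

lemma lg_hom: assumes g: "g \<in> U \<delta>" shows "lg (ph g) = sg (lg g)"
proof (rule lg_eqI[OF near[OF g]])
  have gl: "g \<in> U lrad" using g d U_mono by blast
  have "conv (\<lambda>k. pinv k (ph (g ^ (CARD('p) ^ k)) - 1)) (sg (lg g))"
  proof (rule conv_sg_approx)
    show "\<forall>\<^sub>F k in sequentially. g ^ (CARD('p) ^ k) \<in> U \<delta>"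
      using g delta_less_1 by (intro always_eventually allI U_power) auto
    show "nm (g ^ (CARD('p) ^ k) - 1 - ppow k (lg g)) \<le>
        real CARD('p) * nm (g - 1) ^ 2 * ((1 / real CARD('p)) ^ k) ^ 2" for k
      using lg_approx_power[OF gl, of k] by (simp add: ppow_def)
  qed
  moreover have "(\<lambda>k. pinv k (ph (g ^ (CARD('p) ^ k)) - 1)) = lgs (ph g)"
    using hom_power[OF U_le_e0[OF g]] by (simp add: fun_eq_iff lgs_def)
  ultimately show "conv (lgs (ph g)) (sg (lg g))" by simp
qed

end

lemma hom_differential:
  "\<exists>\<delta> \<sigma>. 0 < \<delta> \<and> \<delta> \<le> e0 \<and> \<delta> \<le> lrad \<and> lin \<sigma> \<and> (\<forall>x y. \<sigma> (ad x y) = ad (\<sigma> x) (\<sigma> y)) \<and>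
     (\<forall>g\<in>U \<delta>. ph g \<in> U lrad \<and> lg (ph g) = \<sigma> (lg g))"
proof -
  obtain \<delta> C where *: "0 < \<delta>" "\<delta> \<le> e0" "\<delta> \<le> lrad" "C \<ge> 1"
    "\<And>x. x \<in> U \<delta> \<Longrightarrow> ph x \<in> U lrad"
    "\<And>x y. x \<in> U \<delta> \<Longrightarrow> y \<in> U \<delta> \<Longrightarrow> nm (ph x - ph y) \<le> C * nm (x - y)"
    by (rule hom_Lipschitz) blast
  show ?thesis
    using * lin_sg[OF *] sg_ad[OF *] lg_hom[OF *] by blast
qed

end

end

section \<open>Lie automorphisms are uniformly bounded\<close>

context padic_division_algebra
begin

text \<open>The condition at 1 pins the centre: a Lie automorphism could otherwise scale it
  arbitrarily, and no uniform bound could hold.\<close>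

definition Lie_aut :: "('d \<Rightarrow> 'd) set" where
  "Lie_aut = {\<tau>. lin \<tau> \<and> bij \<tau> \<and> (\<forall>x y. \<tau> (ad x y) = ad (\<tau> x) (\<tau> y)) \<and> \<tau> 1 = 1}"

lemma Lie_autD:
  assumes "\<tau> \<in> Lie_aut"
  shows "lin \<tau>" "bij \<tau>" "\<tau> (ad x y) = ad (\<tau> x) (\<tau> y)" "\<tau> 1 = 1"
  using assms by (auto simp: Lie_aut_def)

lemma Lie_aut_id: "(\<lambda>x. x) \<in> Lie_aut"
  by (simp add: Lie_aut_def lin_iff bij_id[unfolded id_def])

lemma Lie_aut_comp: "\<tau> \<in> Lie_aut \<Longrightarrow> \<rho> \<in> Lie_aut \<Longrightarrow> (\<lambda>x. \<tau> (\<rho> x)) \<in> Lie_aut"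
  using bij_comp[of \<rho> \<tau>] by (simp add: Lie_aut_def lin_comp comp_def)

lemma Lie_aut_conj: assumes "h \<noteq> 0" shows "(\<lambda>x. h * x * inverse h) \<in> Lie_aut"
proof -
  have "bij (\<lambda>x. h * x * inverse h)"
    by (rule o_bij[of "\<lambda>x. inverse h * x * h"]) (use assms in \<open>auto simp: fun_eq_iff mult.assoc\<close>,
        simp_all add: assms flip: mult.assoc)
  moreover have "h * ad x y * inverse h = ad (h * x * inverse h) (h * y * inverse h)" for x y
  proof -
    have "(h * x * inverse h) * (h * y * inverse h) = h * x * (inverse h * h) * y * inverse h" for x y
      by (simp only: mult.assoc)
    hence "(h * x * inverse h) * (h * y * inverse h) = h * (x * y) * inverse h" for x y
      using assms by (simp add: mult.assoc)
    thus ?thesis unfolding ad_def by (simp only: left_diff_distrib right_diff_distrib)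
  qed
  ultimately show ?thesis
    using assms lin_comp[OF lin_mult_right lin_mult_left] by (simp add: Lie_aut_def)
qed

text \<open>Commutators go to commutators, and they span the trace zero space.\<close>

lemma ltr_lin_Lie:
  assumes "lin \<sigma>" "\<And>x y. \<sigma> (ad x y) = ad (\<sigma> x) (\<sigma> y)" "ltr y = 0"
  shows "ltr (\<sigma> y) = 0"
proof -
  have "subspace {y. ltr (\<sigma> y) = 0}"
    unfolding subspace_def
    using lin_0[OF assms(1)] ltr_smul[of 0 1] by (simp add: lin_add[OF assms(1)] lin_smul[OF assms(1)] ltr_add ltr_smul)
  hence "y \<in> {y. ltr (\<sigma> y) = 0}"
    by (rule ltr_0_in_subspace) (use assms in \<open>simp_all add: ltr_ad\<close>)
  thus ?thesis by simp
qed

text \<open>\<open>ad (\<tau> y)\<close> is the conjugate of \<open>ad y\<close> by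
  \<open>\<tau>\<close>, and traces are invariant under conjugation.\<close>

lemma tr_ad_Lie_aut:
  assumes \<tau>: "\<tau> \<in> Lie_aut" shows "tr (ad (\<tau> y) ^^ j) = tr (ad y ^^ j)"
proof -
  note t = Lie_autD[OF \<tau>]
  define ti where "ti = inv_into UNIV \<tau>"
  have i: "\<tau> (ti x) = x" "ti (\<tau> x) = x" for x
    using t(2) unfolding ti_def by (simp_all add: bij_is_inj bij_is_surj surj_f_inv_f)
  have li: "lin ti"
    unfolding lin_iff
  proof (intro conjI allI)
    show "ti (x + y) = ti x + ti y" for x y
      using i(2)[of "ti x + ti y"] by (simp add: lin_add[OF t(1)] i)
    show "ti (smul c x) = smul c (ti x)" for c x
      using i(2)[of "smul c (ti x)"] by (simp add: lin_smul[OF t(1)] i)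
  qed
  have "(ad (\<tau> y) ^^ j) (\<tau> x) = \<tau> ((ad y ^^ j) x)" for x
    by (induction j) (simp_all add: t(3))
  from this[of "ti _"] have "ad (\<tau> y) ^^ j = (\<lambda>x. \<tau> ((ad y ^^ j) (ti x)))"
    by (simp add: i fun_eq_iff)
  hence "tr (ad (\<tau> y) ^^ j) = tr (\<lambda>x. (ad y ^^ j) (ti (\<tau> x)))"
    using tr_comp_commute[OF t(1) lin_comp[OF lin_pow[OF lin_ad] li]] by simp
  thus ?thesis by (simp add: i)
qed

lemma tr_ad_smul: "tr (ad (smul c y) ^^ j) = c ^ j * tr (ad y ^^ j)"
proof -
  have "(ad (smul c y) ^^ j) x = smul (c ^ j) ((ad y ^^ j) x)" for x
    by (induction j)
       (simp_all add: ad_def smul_mult_left smul_mult_right scale_right_diff_distrib mult.commute)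
  hence "ad (smul c y) ^^ j = (\<lambda>x. smul (c ^ j) ((ad y ^^ j) x))" by blast
  thus ?thesis by (simp add: tr_smul)
qed

lemma central_ltr_0: "z \<in> range (\<lambda>c. smul c 1) \<Longrightarrow> ltr z = 0 \<Longrightarrow> z = 0"
  using card_Basis_ne_0 by (auto simp: ltr_smul ltr_1)

text \<open>The functions \<open>tr (ad y ^ j)\<close> are invariant, homogeneous of degree \<open>j\<close>, and have no common zero
  on the compact unit sphere of the trace zero space; hence they pinch the norm.\<close>

lemma Lie_aut_bounded_ltr_0:
  "\<exists>C\<ge>1. \<forall>\<tau>\<in>Lie_aut. \<forall>y. ltr y = 0 \<longrightarrow> nm (\<tau> y) \<le> C * nm y"
proof -
  define F where "F j y = tr (ad y ^^ j)" for j y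
  have cF: "cf (F j)" for j unfolding F_def by (rule cf_tr_ad)
  have "\<exists>j\<ge>1. F j x \<noteq> 0" if x: "mnorm x = 1" "ltr x = 0" for x
  proof (rule ccontr)
    assume "\<not> ?thesis"
    hence "x \<in> range (\<lambda>c. smul c 1)" by (intro central_if_tr_ad_0) (auto simp: F_def)
    hence "x = 0" using x(2) by (rule central_ltr_0)
    thus False using x(1) by simp
  qed
  then obtain m :: nat where m: "m \<ge> 1"
    "\<And>x. mnorm x = 1 \<Longrightarrow> ltr x = 0 \<Longrightarrow> \<exists>j. 1 \<le> j \<and> j \<le> m \<and> 1 / real m \<le> padic_norm (F j x)"
    using cf_bounded_below[of F ltr] cF cf_ltr by metis
  have "\<exists>C>0. \<forall>x. mnorm x = 1 \<longrightarrow> padic_norm (F j x) \<le> C" for j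
    using cf_bounded[OF cF, of j] by metis
  then obtain D where D: "\<And>j. D j > 0" "\<And>j x. mnorm x = 1 \<Longrightarrow> padic_norm (F j x) \<le> D j" by metis
  \<comment> \<open>A single bound for all degrees up to \<open>m\<close>; the added 1 ensures
    \<open>K * real m \<ge> 1\<close>.\<close>
  define K where "K = 1 + (\<Sum>j\<le>m. D j)"
  have K: "padic_norm (F j x) \<le> K" if "mnorm x = 1" "j \<le> m" for j x
  proof -
    have "D j \<le> (\<Sum>j\<le>m. D j)" using that D(1) by (intro member_le_sum) (auto intro: less_imp_le)
    thus ?thesis using D(2)[OF that(1), of j] by (simp add: K_def)
  qed
  have K1: "K \<ge> 1" using D(1) by (simp add: K_def sum_nonneg less_imp_le)
  have C1: "K * real m \<ge> 1" using mult_mono[OF K1, of 1 "real m"] m(1) K1 by simp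
  have "\<forall>\<tau>\<in>Lie_aut. \<forall>y. ltr y = 0 \<longrightarrow> nm (\<tau> y) \<le> K * real m * nm y"
  proof (intro ballI allI impI)
    fix \<tau> y assume \<tau>: "\<tau> \<in> Lie_aut" and y: "ltr y = 0"
    show "nm (\<tau> y) \<le> K * real m * nm y"
    proof (cases "y = 0")
      case True
      thus ?thesis by (simp add: lin_0[OF Lie_autD(1)[OF \<tau>]])
    next
      case False
      have ty: "\<tau> y \<noteq> 0"
        using False bij_is_inj[OF Lie_autD(2)[OF \<tau>]] lin_0[OF Lie_autD(1)[OF \<tau>]] by (metis injD)
      have lty: "ltr (\<tau> y) = 0" by (rule ltr_lin_Lie[OF Lie_autD(1)[OF \<tau>] Lie_autD(3)[OF \<tau>] y])
      obtain c where c: "c \<noteq> 0" "mnorm (smul c y) = 1" using mnorm_normalize[OF False] by blast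
      obtain c' where c': "c' \<noteq> 0" "mnorm (smul c' (\<tau> y)) = 1" using mnorm_normalize[OF ty] by blast
      have n: "padic_norm c * mnorm y = 1" "padic_norm c' * mnorm (\<tau> y) = 1"
        using c(2) c'(2) by (simp_all add: mnorm_smul)
      have pos: "padic_norm c > 0" "padic_norm c' > 0"
        using n padic_norm_ge0[of c] padic_norm_ge0[of c'] by (auto simp: less_eq_real_def)
      obtain j where j: "1 \<le> j" "j \<le> m" "1 / real m \<le> padic_norm (F j (smul c' (\<tau> y)))"
        using m(2)[OF c'(2)] lty by (auto simp: ltr_smul)
      define f where "f = padic_norm (F j y)"
      have 1: "1 / real m \<le> padic_norm c' ^ j * f"
        using j(3) by (simp add: F_def tr_ad_smul tr_ad_Lie_aut[OF \<tau>] padic_norm_mult padic_norm_power f_def)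
      have 2: "padic_norm c ^ j * f \<le> K"
        using K[OF c(2) j(2)] by (simp add: F_def tr_ad_smul padic_norm_mult padic_norm_power f_def)
      have "0 < 1 / real m" using m(1) by simp
      hence "f \<noteq> 0" using 1 by auto
      hence f: "f > 0" by (simp add: f_def less_le)
      obtain i where i: "j = Suc i" using j(1) by (cases j) auto
      \<comment> \<open>By invariance the common factor \<open>f\<close> cancels, which bounds the
        \<open>j\<close>-th power of the ratio of the normalising scalars. As \<open>j\<close>
        varies with \<open>y\<close>, \<open>K * real m \<ge> 1\<close> serves to take the root
        uniformly.\<close>
      have "(padic_norm c / padic_norm c') ^ j = (padic_norm c ^ j * f) / (padic_norm c' ^ j * f)"
        using f by (simp add: power_divide)
      also have "\<dots> \<le> K / (1 / real m)"
        using 1 2 K1 m(1) pos f by (intro frac_le) auto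
      also have "\<dots> = K * real m" by simp
      also have "\<dots> \<le> (K * real m) ^ j" using C1 j(1) by (intro self_le_power) auto
      finally have "padic_norm c / padic_norm c' \<le> K * real m"
        unfolding i by (rule power_le_imp_le_base) (use C1 in simp)
      moreover have "padic_norm c / padic_norm c' * mnorm y = mnorm (\<tau> y)"
      proof -
        have "padic_norm c' \<noteq> 0" using pos(2) by linarith
        hence "mnorm (\<tau> y) = (padic_norm c' * mnorm (\<tau> y)) / padic_norm c'"
          by (rule nonzero_mult_div_cancel_left[symmetric])
        hence "mnorm (\<tau> y) = 1 / padic_norm c'" by (simp only: n(2))
        moreover have "padic_norm c / padic_norm c' * mnorm y = (padic_norm c * mnorm y) / padic_norm c'" by simp
        ultimately show ?thesis by (simp only: n(1))
      qed
      ultimately have "mnorm (\<tau> y) \<le> K * real m * mnorm y"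
        by (metis mult_right_mono mnorm_ge0)
      thus ?thesis using mult_bound_ge1 by (simp add: nm_def mult_left_mono mult_ac)
    qed
  qed
  with C1 show ?thesis by (intro exI[of _ "K * real m"] conjI)
qed

text \<open>The scalar component in the decomposition of \<open>D\<close> into its centre and the
  trace zero elements; the division normalises \<open>sc 1\<close> to 1.\<close>

definition sc :: "'d \<Rightarrow> 'p padic" where "sc z = ltr z / of_nat (card Basis)"

lemma ltr_diff_sc: "ltr (z - smul (sc z) 1) = 0"
  using card_Basis_ne_0 by (simp add: ltr_diff ltr_smul ltr_1 sc_def)

lemma sc_add: "sc (x + y) = sc x + sc y" and sc_smul: "sc (smul c x) = c * sc x"
  by (simp_all add: sc_def ltr_add ltr_smul add_divide_distrib)

lemma sc_eq_0: "ltr x = 0 \<Longrightarrow> sc x = 0"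
  by (simp add: sc_def)

lemma nm_sc: obtains C where "C \<ge> 1" "\<And>z. nm (smul (sc z) 1) \<le> C * nm z"
proof -
  have "cf sc" unfolding sc_def divide_inverse by (intro cf_mult cf_const cf_ltr)
  then obtain D where D: "D > 0" "\<And>x. mnorm x = 1 \<Longrightarrow> padic_norm (sc x) \<le> D" using cf_bounded by blast
  have D': "padic_norm (sc z) \<le> D * nm z" for z
  proof (cases "z = 0")
    case True
    thus ?thesis using sc_smul[of 0 0] by simp
  next
    case False
    then obtain c where c: "c \<noteq> 0" "mnorm (smul c z) = 1" using mnorm_normalize by blast
    hence n: "padic_norm c * mnorm z = 1" by (simp add: mnorm_smul)
    have "padic_norm (sc z) = padic_norm c * padic_norm (sc z) * mnorm z" using n by (simp add: mult_ac)
    also have "\<dots> \<le> D * mnorm z"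
      using D(2)[OF c(2)] by (intro mult_right_mono) (auto simp: sc_smul padic_norm_mult)
    also have "\<dots> \<le> D * nm z"
      using D(1) mult_right_mono[OF mult_bound_ge1, of "mnorm z"] by (intro mult_left_mono) (auto simp: nm_def)
    finally show ?thesis .
  qed
  have "nm (smul (sc z) 1) \<le> max 1 (D * nm 1) * nm z" for z
  proof -
    have "nm (smul (sc z) 1) \<le> D * nm z * nm 1" unfolding nm_smul using D' by (intro mult_right_mono) auto
    also have "\<dots> = D * nm 1 * nm z" by simp
    also have "\<dots> \<le> max 1 (D * nm 1) * nm z" by (intro mult_right_mono) auto
    finally show ?thesis .
  qed
  thus ?thesis using that[of "max 1 (D * nm 1)"] by simp
qed

lemma Lie_aut_bounded:
  "\<exists>C\<ge>1. \<forall>\<tau>\<in>Lie_aut. \<forall>z. nm (\<tau> z) \<le> C * nm z"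
proof -
  obtain C where C: "C \<ge> 1" "\<forall>\<tau>\<in>Lie_aut. \<forall>y. ltr y = 0 \<longrightarrow> nm (\<tau> y) \<le> C * nm y"
    using Lie_aut_bounded_ltr_0 by blast
  obtain D where D: "D \<ge> 1" "\<And>z. nm (smul (sc z) 1) \<le> D * nm z" using nm_sc by blast
  have "\<forall>\<tau>\<in>Lie_aut. \<forall>z. nm (\<tau> z) \<le> C * D * nm z"
  proof (intro ballI allI)
    fix \<tau> z assume \<tau>: "\<tau> \<in> Lie_aut"
    define y where "y = z - smul (sc z) 1"
    have "1 * nm z \<le> D * nm z" using D by (intro mult_right_mono) auto
    hence "nm y \<le> D * nm z" unfolding y_def using D by (intro nm_diff_le) auto
    hence "C * nm y \<le> C * (D * nm z)" using C by (intro mult_left_mono) auto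
    moreover have "nm (\<tau> y) \<le> C * nm y" using C(2) \<tau> ltr_diff_sc unfolding y_def by blast
    ultimately have 1: "nm (\<tau> y) \<le> C * D * nm z" by simp
    have "1 * (D * nm z) \<le> C * (D * nm z)" using C D by (intro mult_right_mono) auto
    hence 2: "nm (smul (sc z) 1) \<le> C * D * nm z" using D(2)[of z] by simp
    have "\<tau> z = \<tau> (y + smul (sc z) 1)" by (simp add: y_def)
    also have "\<dots> = \<tau> y + smul (sc z) 1"
      by (simp add: lin_add[OF Lie_autD(1)[OF \<tau>]] lin_smul[OF Lie_autD(1)[OF \<tau>]] Lie_autD(4)[OF \<tau>])
    finally show "nm (\<tau> z) \<le> C * D * nm z" using 1 2 by (simp add: nm_add_le)
  qed
  moreover have "C * D \<ge> 1" using mult_mono[OF C(1) D(1)] C(1) by simp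
  ultimately show ?thesis by (intro exI[of _ "C * D"] conjI)
qed

text \<open>The kernel of \<open>\<sigma>\<close> is a Lie ideal. If it contains all commutators,
  \<open>\<sigma>\<close> vanishes on trace zero elements; if it is central, \<open>\<sigma>\<close>
  is injective on them, and replacing it by the identity on the centre yields an element of
  \<open>Lie_aut\<close>.\<close>

lemma Lie_hom_dichotomy:
  assumes lin: "lin \<sigma>" and Lie: "\<And>x y. \<sigma> (ad x y) = ad (\<sigma> x) (\<sigma> y)"
  shows "(\<forall>y. ltr y = 0 \<longrightarrow> \<sigma> y = 0) \<or> (\<exists>\<tau>\<in>Lie_aut. \<forall>y. ltr y = 0 \<longrightarrow> \<tau> y = \<sigma> y)"
proof -
  define K where "K = {x. \<sigma> x = 0}"
  have sub: "subspace K"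
    unfolding subspace_def K_def by (simp add: lin_0[OF lin] lin_add[OF lin] lin_smul[OF lin])
  have "K \<subseteq> range (\<lambda>c. smul c 1) \<or> (\<forall>x y. ad x y \<in> K)"
    by (rule Lie_ideal_dichotomy) (auto simp: K_def lin_add[OF lin] lin_minus[OF lin] Lie, auto simp: ad_def)
  thus ?thesis
  proof
    assume "\<forall>x y. ad x y \<in> K"
    hence "y \<in> K" if "ltr y = 0" for y using ltr_0_in_subspace[OF sub _ that] by blast
    thus ?thesis by (auto simp: K_def)
  next
    assume K: "K \<subseteq> range (\<lambda>c. smul c 1)"
    define \<tau> where "\<tau> z = smul (sc z) 1 + \<sigma> (z - smul (sc z) 1)" for z
    have t0: "\<tau> y = \<sigma> y" if "ltr y = 0" for y using that by (simp add: \<tau>_def sc_eq_0)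
    have lt: "lin \<tau>"
      unfolding lin_iff \<tau>_def
      by (simp add: sc_add sc_smul lin_add[OF lin] lin_diff[OF lin] lin_smul[OF lin] algebra_simps)
    have "sc 1 = 1" using card_Basis_ne_0 by (simp add: sc_def ltr_1)
    hence t1: "\<tau> 1 = 1" by (simp add: \<tau>_def lin_0[OF lin])
    have ads: "ad (x - smul c 1) (y - smul e 1) = ad x y" for x y c e
      by (simp add: ad_def algebra_simps smul_mult_left smul_mult_right)
    have ads': "ad (smul c 1 + x) (smul e 1 + y) = ad x y" for x y c e
      using ads[of x "- c" y "- e"] by (simp add: add.commute)
    have "\<tau> (ad x y) = ad (\<tau> x) (\<tau> y)" for x y
    proof -
      have "ad (\<tau> x) (\<tau> y) = \<sigma> (ad (x - smul (sc x) 1) (y - smul (sc y) 1))"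
        unfolding \<tau>_def ads' Lie ..
      thus ?thesis by (simp add: ads t0 ltr_ad)
    qed
    moreover have inj: "inj \<tau>"
    proof (rule injI)
      fix x y assume "\<tau> x = \<tau> y"
      define z where "z = x - y"
      have "\<tau> z = 0" using \<open>\<tau> x = \<tau> y\<close> by (simp add: z_def lin_diff[OF lt])
      hence e: "\<sigma> (z - smul (sc z) 1) = smul (- sc z) 1"
        unfolding \<tau>_def by (simp add: eq_neg_iff_add_eq_0 add.commute)
      \<comment> \<open>The image has trace 0, while by \<open>e\<close> it is a scalar, so both
        vanish.\<close>
      have "ltr (\<sigma> (z - smul (sc z) 1)) = 0" by (rule ltr_lin_Lie[OF lin Lie ltr_diff_sc])
      hence "sc z = 0" using card_Basis_ne_0 unfolding e ltr_smul ltr_1 by simp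
      hence "z \<in> K" using e by (simp add: K_def)
      moreover have "ltr z = 0" using \<open>sc z = 0\<close> card_Basis_ne_0 by (simp add: sc_def)
      ultimately have "z = 0" using K central_ltr_0 by blast
      thus "x = y" by (simp add: z_def)
    qed
    moreover have "surj \<tau>" by (rule linear_inj_imp_surj[OF lt inj])
    ultimately have "\<tau> \<in> Lie_aut" using lt t1 by (simp add: Lie_aut_def bij_def)
    thus ?thesis using t0 by blast
  qed
qed

section \<open>A subset invariant under conjugation and under a given homomorphism\<close>

lemma invariant_neighbourhood:
  assumes e0: "0 < e0" "e0 < 1"
    and hom: "\<And>x y. x \<in> U e0 \<Longrightarrow> y \<in> U e0 \<Longrightarrow> ph (x * y) = ph x * ph y"
    and ph_ne_0: "\<And>x. x \<in> U e0 \<Longrightarrow> ph x \<noteq> 0"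
    and noncomm: "\<exists>x y :: 'd. x * y \<noteq> y * x"
  shows "\<exists>S. S \<subseteq> U e0 \<and> (\<forall>x\<in>S. ph x \<in> S) \<and> (\<forall>h. h \<noteq> 0 \<longrightarrow> (\<forall>x\<in>S. h * x * inverse h \<in> S)) \<and>
    (\<exists>x\<in>S. \<exists>y\<in>S. x * y \<noteq> y * x)"
proof -
  have "\<exists>\<delta> \<sigma>. 0 < \<delta> \<and> \<delta> \<le> e0 \<and> \<delta> \<le> lrad \<and> lin \<sigma> \<and> (\<forall>x y. \<sigma> (ad x y) = ad (\<sigma> x) (\<sigma> y)) \<and>
     (\<forall>g\<in>U \<delta>. ph g \<in> U lrad \<and> lg (ph g) = \<sigma> (lg g))"
    by (rule hom_differential[where ph = ph, OF e0]) (fact hom ph_ne_0)+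
  then obtain \<delta> \<sigma> where *: "0 < \<delta> \<and> \<delta> \<le> e0 \<and> \<delta> \<le> lrad \<and> lin \<sigma> \<and> (\<forall>x y. \<sigma> (ad x y) = ad (\<sigma> x) (\<sigma> y)) \<and>
     (\<forall>g\<in>U \<delta>. ph g \<in> U lrad \<and> lg (ph g) = \<sigma> (lg g))"
    by (elim exE)
  have d: "0 < \<delta>" "\<delta> \<le> e0" "\<delta> \<le> lrad" and lin: "lin \<sigma>"
    and Lie: "\<sigma> (ad x y) = ad (\<sigma> x) (\<sigma> y)"
    and near: "g \<in> U \<delta> \<Longrightarrow> ph g \<in> U lrad" and lg: "g \<in> U \<delta> \<Longrightarrow> lg (ph g) = \<sigma> (lg g)" for x y g
    using * by auto
  obtain C where C1: "C \<ge> 1" and CL: "\<forall>\<tau>\<in>Lie_aut. \<forall>z. nm (\<tau> z) \<le> C * nm z"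
    using Lie_aut_bounded by blast
  have C: "C \<ge> 1" "nm (\<tau> z) \<le> C * nm z" if "\<tau> \<in> Lie_aut" for \<tau> z using C1 CL that by auto
  \<comment> \<open>Conjugation is a Lie automorphism, hence expands by at most \<open>C\<close>;
    radius \<open>\<delta> / C\<close> keeps conjugates inside \<open>U lrad\<close>, where the
    logarithm is available.\<close>
  define r where "r = \<delta> / C"
  have r: "r > 0" "r \<le> \<delta>" "C * r = \<delta>" using d C1 by (auto simp: r_def field_simps)
  \<comment> \<open>Quantifying over all of \<open>Lie_aut\<close> makes the bound stable: applying
    some \<open>\<rho>\<close> to the logarithm only replaces each \<open>\<tau>\<close> by its
    composition with \<open>\<rho>\<close>.\<close>
  define S where "S = {x \<in> U lrad. ltr (lg x) = 0 \<and> (\<forall>\<tau>\<in>Lie_aut. nm (\<tau> (lg x)) \<le> r)}"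
  have Sr: "nm (x - 1) \<le> r" if "x \<in> S" for x
    using that Lie_aut_id nm_lg[of x] by (force simp: S_def)
  have Sd: "x \<in> U \<delta>" if "x \<in> S" for x
    using Sr[OF that] r by (simp add: U_def)
  have "S \<subseteq> U e0" using Sd d U_mono by blast
  moreover have "ph x \<in> S" if x: "x \<in> S" for x
  proof -
    have l: "lg (ph x) = \<sigma> (lg x)" by (rule lg[OF Sd[OF x]])
    have x': "ltr (lg x) = 0" "\<And>\<tau>. \<tau> \<in> Lie_aut \<Longrightarrow> nm (\<tau> (lg x)) \<le> r" using x by (auto simp: S_def)
    have "ltr (\<sigma> (lg x)) = 0" by (rule ltr_lin_Lie[OF lin Lie x'(1)])
    moreover have "nm (\<tau> (\<sigma> (lg x))) \<le> r" if \<tau>: "\<tau> \<in> Lie_aut" for \<tau>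
      using Lie_hom_dichotomy[OF lin Lie]
    proof
      assume "\<forall>y. ltr y = 0 \<longrightarrow> \<sigma> y = 0"
      thus ?thesis using x'(1) r by (simp add: lin_0[OF Lie_autD(1)[OF \<tau>]])
    next
      assume "\<exists>\<tau>\<in>Lie_aut. \<forall>y. ltr y = 0 \<longrightarrow> \<tau> y = \<sigma> y"
      then obtain \<rho> where \<rho>: "\<rho> \<in> Lie_aut" "\<rho> (lg x) = \<sigma> (lg x)" using x'(1) by blast
      show ?thesis using x'(2)[OF Lie_aut_comp[OF \<tau> \<rho>(1)]] \<rho>(2) by simp
    qed
    ultimately show ?thesis using near[OF Sd[OF x]] by (simp add: S_def l)
  qed
  moreover have "h * x * inverse h \<in> S" if h: "h \<noteq> 0" and x: "x \<in> S" for h x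
  proof -
    have a: "(\<lambda>x. h * x * inverse h) \<in> Lie_aut" by (rule Lie_aut_conj[OF h])
    have "h * x * inverse h - 1 = h * (x - 1) * inverse h"
      using h by (simp add: left_diff_distrib right_diff_distrib)
    hence "nm (h * x * inverse h - 1) \<le> C * nm (x - 1)" using C(2)[OF a, of "x - 1"] by simp
    also have "\<dots> \<le> C * r" using Sr[OF x] C1 by (intro mult_left_mono) auto
    finally have U: "h * x * inverse h \<in> U lrad" using r d by (simp add: U_def)
    have x': "x \<in> U lrad" "ltr (lg x) = 0" "\<And>\<tau>. \<tau> \<in> Lie_aut \<Longrightarrow> nm (\<tau> (lg x)) \<le> r" using x by (auto simp: S_def)
    have l: "lg (h * x * inverse h) = h * lg x * inverse h" by (rule lg_conj[OF x'(1) U h])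
    show ?thesis
      using U x'(3)[OF Lie_aut_comp[OF _ a]] ltr_lin_Lie[OF Lie_autD(1)[OF a] Lie_autD(3)[OF a] x'(2)]
      by (simp add: S_def l)
  qed
  moreover have "\<exists>x\<in>S. \<exists>y\<in>S. x * y \<noteq> y * x"
  proof -
    obtain x y :: 'd where xy: "x * y \<noteq> y * x" using noncomm by blast
    define a b where "a = x - smul (sc x) 1" and "b = y - smul (sc y) 1"
    have "ad a b = ad x y" by (simp add: a_def b_def ad_def algebra_simps smul_mult_left smul_mult_right)
    moreover have "ad x y \<noteq> 0" using xy by (simp add: ad_def)
    ultimately have "ad a b \<noteq> 0" by simp
    hence ab: "a * b \<noteq> b * a" by (auto simp: ad_def)
    have lab: "ltr a = 0" "ltr b = 0" by (simp_all add: a_def b_def ltr_diff_sc)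
    have "\<forall>\<^sub>F k in sequentially. nm (ppow k a) \<le> r / C \<and> nm (ppow k b) \<le> r / C"
      using r C1 by (intro eventually_conj eventually_ppow_small) auto
    then obtain k where k: "nm (ppow k a) \<le> r / C" "nm (ppow k b) \<le> r / C"
      by (auto simp: eventually_sequentially)
    \<comment> \<open>An element this small stays below \<open>r\<close> under every
      \<open>\<tau>\<close>, since \<open>C\<close> bounds them all, and it has a preimage under the
      logarithm.\<close>
    have ex: "\<exists>s\<in>S. lg s = ppow k c" if c: "ltr c = 0" "nm (ppow k c) \<le> r / C" for c
    proof -
      have b: "nm (\<tau> (ppow k c)) \<le> r" if "\<tau> \<in> Lie_aut" for \<tau>
      proof -
        have "nm (\<tau> (ppow k c)) \<le> C * (r / C)"
          using C1 c(2) by (intro order.trans[OF C(2)[OF that] mult_left_mono]) auto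
        thus ?thesis using C1 by simp
      qed
      hence "nm (ppow k c) \<le> lrad" using b[OF Lie_aut_id] r(2) d(3) by linarith
      then obtain s where "s \<in> U lrad" "lg s = ppow k c" by (rule lg_surj)
      thus ?thesis using b c(1) by (intro bexI[of _ s]) (auto simp: S_def ppow_def ltr_smul)
    qed
    obtain s t where st: "s \<in> S" "lg s = ppow k a" "t \<in> S" "lg t = ppow k b"
      using ex[OF lab(1) k(1)] ex[OF lab(2) k(2)] by blast
    have "s * t \<noteq> t * s"
    proof
      assume "s * t = t * s"
      hence "ppow k a * ppow k b = ppow k b * ppow k a"
        using lg_commute[of s t] st by (auto simp: S_def)
      hence "ppow k (ppow k (a * b)) = ppow k (ppow k (b * a))"
        by (simp add: ppow_def smul_mult_left smul_mult_right)
      hence "a * b = b * a" by (metis pinv_ppow)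
      thus False using ab by blast
    qed
    thus ?thesis using st by blast
  qed
  ultimately show ?thesis by (intro exI[of _ S] conjI ballI allI impI)
qed

end

section \<open>The virtual endomorphism of a self-similar action\<close>

lemma tree_automorphism_length:
  assumes "tree_automorphism d g" shows "w \<in> lists {..<d} \<Longrightarrow> length (g w) = length w"
proof (induction w rule: rev_induct)
  case Nil
  thus ?case using assms by (simp add: tree_automorphism_def)
next
  case (snoc x w)
  hence "g (w @ [x]) \<noteq> [] \<and> butlast (g (w @ [x])) = g w"
    using assms unfolding tree_automorphism_def by (metis butlast_snoc snoc_eq_iff_butlast)
  moreover have "length (g w) = length w" using snoc by (simp add: append_in_lists_conv)
  ultimately show ?case by (cases "g (w @ [x])" rule: rev_cases) auto
qed

text \<open>\<open>H\<close> is the stabiliser of the first-level vertex \<open>[0]\<close>, and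
  \<open>\<theta>\<close> takes the section at this vertex. Instead of the index of \<open>H\<close>
  a power condition is recorded, which elements near 1, having roots, can exploit. The last clause
  is simplicity in a form for subsets, as its proof concerns single elements fixing
  vertices.\<close>

lemma self_similar_virtual_endomorphism:
  fixes G :: "('a, 'b) monoid_scheme" (structure)
  assumes ss: "self_similar_of_index G d" and d: "d \<ge> 1"
  obtains H \<theta> where "group G" "subgroup H G" "\<And>g. g \<in> carrier G \<Longrightarrow> g [^] (fact d :: nat) \<in> H"
    "\<And>g. g \<in> H \<Longrightarrow> \<theta> g \<in> carrier G" "\<And>g h. g \<in> H \<Longrightarrow> h \<in> H \<Longrightarrow> \<theta> (g \<otimes> h) = \<theta> g \<otimes> \<theta> h"
    "\<And>S. S \<subseteq> H \<Longrightarrow> (\<forall>g\<in>carrier G. \<forall>s\<in>S. g \<otimes> s \<otimes> inv g \<in> S) \<Longrightarrow> (\<forall>s\<in>S. \<theta> s \<in> S) \<Longrightarrow> S \<subseteq> {\<one>}"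
proof -
  define E where "E = lists {..<d}"
  obtain \<phi> where fa: "faithful_action G E \<phi>"
    and ta: "\<And>g. g \<in> carrier G \<Longrightarrow> tree_automorphism d (\<phi> g)"
    and self: "\<And>g x. g \<in> carrier G \<Longrightarrow> x < d \<Longrightarrow> \<exists>h \<in> carrier G. \<exists>y<d. \<forall>w \<in> E. \<phi> g (x # w) = y # \<phi> h w"
    and trans: "\<And>x y. x < d \<Longrightarrow> y < d \<Longrightarrow> \<exists>g \<in> carrier G. \<phi> g [x] = [y]"
    using ss unfolding self_similar_of_index_def E_def by metis
  interpret faithful_action G E \<phi> by (rule fa)
  have grp: "group G" using group_hom unfolding group_hom_def by blast
  interpret group G by (rule grp)
  have d0: "0 < d" using d by simp
  have nil: "\<phi> g [] = []" if "g \<in> carrier G" for g using ta[OF that] by (simp add: tree_automorphism_def)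
  have im: "\<phi> g w \<in> E" if "g \<in> carrier G" "w \<in> E" for g w using element_image[OF that] by blast
  have ext: "g = h" if g: "g \<in> carrier G" and h: "h \<in> carrier G" and e: "\<And>w. w \<in> E \<Longrightarrow> \<phi> g w = \<phi> h w" for g h
  proof -
    have "\<phi> x \<in> extensional E" if "x \<in> carrier G" for x
      using bij_prop0[OF that] by (simp add: Bij_def)
    hence "\<phi> g = \<phi> h" using g h e by (intro extensionalityI[where A = E]) auto
    thus ?thesis using faithful g h by (meson inj_onD)
  qed
  define H where "H = {g \<in> carrier G. \<phi> g [0] = [0]}"
  define \<theta> where "\<theta> g = (SOME h. h \<in> carrier G \<and> (\<forall>w\<in>E. \<phi> g (0 # w) = 0 # \<phi> h w))" for g
  have inE: "x # w \<in> E" if "x < d" "w \<in> E" for x w using that by (simp add: E_def)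
  have nilE: "[] \<in> E" by (simp add: E_def)
  have th: "\<theta> g \<in> carrier G \<and> (\<forall>w\<in>E. \<phi> g (0 # w) = 0 # \<phi> (\<theta> g) w)" if g: "g \<in> H" for g
  proof -
    obtain h y where h: "h \<in> carrier G" "\<forall>w\<in>E. \<phi> g (0 # w) = y # \<phi> h w"
      using self[of g 0] g d0 unfolding H_def by blast
    \<comment> \<open>Evaluation at the empty word identifies \<open>y\<close> with the image of the
      vertex \<open>0\<close>.\<close>
    have "y = 0" using h nilE nil[OF h(1)] g unfolding H_def by force
    hence "\<exists>h. h \<in> carrier G \<and> (\<forall>w\<in>E. \<phi> g (0 # w) = 0 # \<phi> h w)" using h by blast
    thus ?thesis unfolding \<theta>_def by (rule someI_ex)
  qed
  have mult: "\<phi> (g \<otimes> h) w = \<phi> g (\<phi> h w)" if "g \<in> carrier G" "h \<in> carrier G" "w \<in> E" for g h w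
    using composition_rule[OF that(3,1,2)] .
  have sub: "subgroup H G"
  proof (rule subgroupI)
    show "H \<subseteq> carrier G" by (auto simp: H_def)
    have "\<phi> \<one> [0] = [0]" using inE[OF d0 nilE] by (simp flip: id_eq_one)
    thus "H \<noteq> {}" by (auto simp: H_def)
    show "inv a \<in> H" if "a \<in> H" for a
      using that orbit_sym_aux[of a "[0]" "[0]"] inE[OF d0 nilE] by (auto simp: H_def)
    show "a \<otimes> b \<in> H" if "a \<in> H" "b \<in> H" for a b
      using that mult[of a b "[0]"] inE[OF d0 nilE] by (auto simp: H_def)
  qed
  \<comment> \<open>Pigeonhole on the images of \<open>[0]\<close> under the powers of
    \<open>g\<close> with exponents \<open>0\<close> to \<open>d\<close> gives a period
    \<open>j - i \<le> d\<close>, and every such period divides \<open>fact d\<close>.\<close>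
  have pw: "g [^] (fact d :: nat) \<in> H" if g: "g \<in> carrier G" for g
  proof -
    have "\<exists>y<d. \<phi> (g [^] i) [0] = [y]" for i :: nat
    proof -
      obtain h y where "h \<in> carrier G" "y < d" "\<forall>w\<in>E. \<phi> (g [^] i) (0 # w) = y # \<phi> h w"
        using self[of "g [^] i" 0] g d0 by auto
      thus ?thesis using nilE nil by auto
    qed
    then obtain f where f: "\<And>i :: nat. f i < d \<and> \<phi> (g [^] i) [0] = [f i]" by metis
    have "\<not> inj_on f {..d}"
    proof
      assume "inj_on f {..d}"
      hence "card {..d} \<le> card {..<d}" using f by (intro card_inj_on_le) auto
      thus False by simp
    qed
    then obtain i j where ij: "i < j" "j \<le> d" "f i = f j"
      unfolding inj_on_def by (metis atMost_iff linorder_neqE_nat)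
    have 0: "[0] \<in> E" by (rule inE[OF d0 nilE])
    have "\<phi> (g [^] i) (\<phi> (g [^] (j - i)) [0]) = \<phi> (g [^] (i + (j - i))) [0]"
      using mult[OF nat_pow_closed[OF g] nat_pow_closed[OF g] 0] by (simp add: nat_pow_mult g)
    also have "\<dots> = \<phi> (g [^] i) [0]" using f[of i] f[of j] ij by simp
    finally have "\<phi> (g [^] (j - i)) [0] = [0]"
      using inj_prop[OF nat_pow_closed[OF g, of i]] im[OF nat_pow_closed[OF g] 0] 0 by (meson inj_onD)
    hence "g [^] (j - i) \<in> H" using g by (simp add: H_def)
    hence "(g [^] (j - i)) [^] k \<in> H" for k :: nat
      by (induction k) (auto simp: subgroup.one_closed[OF sub] subgroup.m_closed[OF sub])
    hence "g [^] ((j - i) * k) \<in> H" for k :: nat using g by (simp add: nat_pow_pow)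
    moreover have "j - i dvd fact d" using ij by (intro dvd_fact) auto
    ultimately show ?thesis by (auto elim!: dvdE)
  qed
  have hom: "\<theta> (g \<otimes> h) = \<theta> g \<otimes> \<theta> h" if g: "g \<in> H" and h: "h \<in> H" for g h
  proof (rule ext)
    have gh: "g \<otimes> h \<in> H" by (rule subgroup.m_closed[OF sub g h])
    have c: "g \<in> carrier G" "h \<in> carrier G" using g h by (auto simp: H_def)
    note t = th[OF g] th[OF h] th[OF gh]
    show "\<theta> (g \<otimes> h) \<in> carrier G" "\<theta> g \<otimes> \<theta> h \<in> carrier G" using t by auto
    fix w assume w: "w \<in> E"
    have "0 # \<phi> (\<theta> (g \<otimes> h)) w = \<phi> g (\<phi> h (0 # w))" using t(3) w mult[OF c inE[OF d0 w]] by auto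
    also have "\<dots> = 0 # \<phi> (\<theta> g) (\<phi> (\<theta> h) w)" using t(1,2) w im by auto
    also have "\<phi> (\<theta> g) (\<phi> (\<theta> h) w) = \<phi> (\<theta> g \<otimes> \<theta> h) w" using t(1,2) w mult by auto
    finally show "\<phi> (\<theta> (g \<otimes> h)) w = \<phi> (\<theta> g \<otimes> \<theta> h) w" by simp
  qed
  have triv: "S \<subseteq> {\<one>}" if S: "S \<subseteq> H" and conj: "\<forall>g\<in>carrier G. \<forall>s\<in>S. g \<otimes> s \<otimes> inv g \<in> S"
    and inv: "\<forall>s\<in>S. \<theta> s \<in> S" for S
  proof
    fix s assume s: "s \<in> S"
    have SG: "t \<in> carrier G" if "t \<in> S" for t using that S by (auto simp: H_def)
    \<comment> \<open>Induction on the level. By transitivity some \<open>g\<close> carries the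
      subtree below \<open>0\<close> to the one below \<open>x\<close>; the conjugate
      \<open>t'\<close> of \<open>t\<close> by \<open>g\<close> is still in \<open>S\<close> and
      acts below \<open>0\<close> through \<open>\<theta> t'\<close>, which is in \<open>S\<close>
      and fixes the shorter word.\<close>
    have fix_all: "\<forall>w\<in>E. length w = n \<longrightarrow> (\<forall>t\<in>S. \<phi> t w = w)" for n
    proof (induction n)
      case 0
      thus ?case using nil SG by auto
    next
      case (Suc n)
      show ?case
      proof (intro ballI impI)
        fix w t assume w: "w \<in> E" "length w = Suc n" and t: "t \<in> S"
        then obtain x v where xv: "w = x # v" "x < d" "v \<in> E" "length v = n"
          by (cases w) (auto simp: E_def)
        obtain g where g: "g \<in> carrier G" "\<phi> g [0] = [x]" using trans[OF d0 xv(2)] by blast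
        obtain h y where h: "h \<in> carrier G" "\<forall>w\<in>E. \<phi> g (0 # w) = y # \<phi> h w"
          using self[OF g(1) d0] by blast
        have "y = x" using h nilE nil[OF h(1)] g(2) by force
        define u where "u = \<phi> (inv h) v"
        have u: "u \<in> E" "length u = n"
          using im[of "inv h" v] h(1) xv tree_automorphism_length[OF ta[of "inv h"], of v] by (auto simp: u_def E_def)
        have hu: "\<phi> h u = v"
          using mult[of h "inv h" v] h(1) xv(3) by (simp add: u_def flip: id_eq_one)
        hence w_eq: "\<phi> g (0 # u) = w" using h u \<open>y = x\<close> xv by simp
        define t' where "t' = inv g \<otimes> t \<otimes> g"
        have t': "t' \<in> S" using conj t g(1) unfolding t'_def by (metis inv_closed inv_inv)
        have "t \<otimes> g = g \<otimes> t'" using SG[OF t] g(1) by (simp add: t'_def flip: m_assoc)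
        hence "\<phi> t w = \<phi> g (\<phi> t' (0 # u))"
          using mult[OF SG[OF t] g(1) inE[OF d0 u(1)]] mult[OF g(1) SG[OF t'] inE[OF d0 u(1)]] w_eq by simp
        also have "\<phi> t' (0 # u) = 0 # \<phi> (\<theta> t') u" using th[of t'] S t' u by blast
        also have "\<phi> (\<theta> t') u = u" using Suc.IH u inv t' by blast
        finally show "\<phi> t w = w" using w_eq by simp
      qed
    qed
    have "s = \<one>"
    proof (rule ext[OF SG[OF s] one_closed])
      show "\<phi> s w = \<phi> \<one> w" if "w \<in> E" for w
        using fix_all[of "length w"] that s by (simp flip: id_eq_one)
    qed
    thus "s \<in> {\<one>}" by simp
  qed
  show ?thesis
    by (rule that[OF grp sub pw _ hom triv]) (use th in auto)
qed

section \<open>The determinant of a splitting\<close>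

text \<open>The Kronecker product of the identity of size \<open>m\<close> with \<open>A\<close>:
  the matrix of left multiplication by \<open>A\<close> when matrices are stored column after
  column.\<close>

definition block_diag :: "nat \<Rightarrow> nat \<Rightarrow> 'a :: idom mat \<Rightarrow> 'a mat" where
  "block_diag m n A = mat (m * n) (m * n) (\<lambda>(r, c). if r div n = c div n then A $$ (r mod n, c mod n) else 0)"

lemma det_block_diag:
  assumes A: "A \<in> carrier_mat n n" and n: "n > 0" shows "det (block_diag m n A) = det A ^ m"
proof (induction m)
  case 0
  show ?case by (simp add: block_diag_def det_dim_zero[where A = "mat 0 0 _"])
next
  case (Suc m)
  have "block_diag (Suc m) n A = four_block_mat A (0\<^sub>m n (m * n)) (0\<^sub>m (m * n) n) (block_diag m n A)"
  proof (rule eq_matI)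
    fix r c
    assume "r < dim_row (four_block_mat A (0\<^sub>m n (m * n)) (0\<^sub>m (m * n) n) (block_diag m n A))"
      "c < dim_col (four_block_mat A (0\<^sub>m n (m * n)) (0\<^sub>m (m * n) n) (block_diag m n A))"
    hence rc: "r < n + m * n" "c < n + m * n" using A by (simp_all add: block_diag_def)
    have small: "r div n = 0 \<longleftrightarrow> r < n" "c div n = 0 \<longleftrightarrow> c < n" using n by (auto simp: div_eq_0_iff)
    have big: "x div n = Suc ((x - n) div n)" "x mod n = (x - n) mod n" if "\<not> x < n" for x
      using that n by (auto simp: le_div_geq le_mod_geq)
    show "block_diag (Suc m) n A $$ (r, c) =
        four_block_mat A (0\<^sub>m n (m * n)) (0\<^sub>m (m * n) n) (block_diag m n A) $$ (r, c)"
      using rc A small big[of r] big[of c] by (cases "r < n"; cases "c < n") (auto simp: block_diag_def)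
  qed (use A in \<open>auto simp: block_diag_def\<close>)
  also have "det \<dots> = det A * det (block_diag m n A)"
    by (rule det_four_block_mat_upper_right_zero) (use A in \<open>auto simp: block_diag_def\<close>)
  finally show ?case by (simp add: Suc)
qed

context central_division_algebra_char_0
begin

text \<open>Left multiplication by \<open>f x\<close> on all matrices consists of \<open>n\<close>
  copies of \<open>f x\<close> in the basis of matrix units, and it is \<open>lmat x\<close> in the
  basis formed by the images of \<open>Basis\<close>. Comparing determinants exhibits the regular
  norm as the \<open>n\<close>-th power of the reduced norm.\<close>

lemma splitting_det:
  assumes sp: "splitting smul Basis n f"
  shows "n * n = card Basis" and "det (f x) ^ n = to_ac (rnorm x)"
proof -
  define N where "N = card Basis"
  have f: "f x \<in> carrier_mat n n" "f (x + y) = f x + f y" "f (x * y) = f x * f y" "f (smul c x) = to_ac c \<cdot>\<^sub>m f x" for x y c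
    using sp by (auto simp: splitting_def)
  have basis: "\<exists>!a. a \<in> extensional Basis \<and> M = mat n n (\<lambda>(i, j). \<Sum>b\<in>Basis. a b * f b $$ (i, j))"
    if "M \<in> carrier_mat n n" for M
    using sp that by (auto simp: splitting_def)
  \<comment> \<open>For \<open>n = 0\<close> all matrices coincide, so the zero matrix would have
    two coordinate families over the nonempty \<open>Basis\<close>, against uniqueness.\<close>
  have n: "n > 0"
  proof (rule ccontr)
    assume "\<not> n > 0"
    hence eq: "A = B" if "A \<in> carrier_mat n n" "B \<in> carrier_mat n n" for A B :: "'k alg_closure mat"
      using that by auto
    obtain b where b: "b \<in> Basis" using Basis_nonempty by blast
    define a0 a1 :: "'d \<Rightarrow> 'k alg_closure" where "a0 = (\<lambda>x\<in>Basis. 0)" and "a1 = (\<lambda>x\<in>Basis. 1)"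
    have "a0 = a1" using basis[of "0\<^sub>m n n"] eq[of "0\<^sub>m n n"] by (auto simp: a0_def a1_def)
    thus False using b by (metis a0_def a1_def restrict_apply' zero_neq_one)
  qed
  have basis': "\<exists>!a. a \<in> extensional Basis \<and> (\<forall>i<n. \<forall>j<n. M $$ (i, j) = (\<Sum>b\<in>Basis. a b * f b $$ (i, j)))"
    if M: "M \<in> carrier_mat n n" for M
  proof -
    have "M = mat n n (\<lambda>(i, j). \<Sum>b\<in>Basis. a b * f b $$ (i, j)) \<longleftrightarrow>
       (\<forall>i<n. \<forall>j<n. M $$ (i, j) = (\<Sum>b\<in>Basis. a b * f b $$ (i, j)))" for a
      using M by (auto simp: mat_eq_iff)
    thus ?thesis using basis[OF M] by simp
  qed
  \<comment> \<open>The matrix units; their coordinates \<open>a i j\<close> are the entries of the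
    inverse of the base change.\<close>
  define E where "E i j = mat n n (\<lambda>(k, l). if k = i \<and> l = j then 1 else (0 :: 'k alg_closure))" for i j
  have "\<exists>a. \<forall>k<n. \<forall>l<n. E i j $$ (k, l) = (\<Sum>b\<in>Basis. a b * f b $$ (k, l))" for i j
  proof -
    have "E i j \<in> carrier_mat n n" by (simp add: E_def)
    from ex1_implies_ex[OF basis'[OF this]] show ?thesis by blast
  qed
  then obtain a where a: "\<And>i j k l. k < n \<Longrightarrow> l < n \<Longrightarrow> E i j $$ (k, l) = (\<Sum>b\<in>Basis. a i j b * f b $$ (k, l))"
    by metis
  have dual: "(\<Sum>i<n. \<Sum>j<n. f b $$ (i, j) * a i j c) = (if b = c then 1 else 0)"
    if b: "b \<in> Basis" and c: "c \<in> Basis" for b c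
  proof -
    define u v where "u = (\<lambda>c\<in>Basis. \<Sum>i<n. \<Sum>j<n. f b $$ (i, j) * a i j c)"
      and "v = (\<lambda>c\<in>Basis. if b = c then 1 else (0 :: 'k alg_closure))"
    have "f b $$ (k, l) = (\<Sum>c\<in>Basis. u c * f c $$ (k, l))" if kl: "k < n" "l < n" for k l
    proof -
      have "(\<Sum>c\<in>Basis. u c * f c $$ (k, l)) = (\<Sum>i<n. \<Sum>j<n. f b $$ (i, j) * E i j $$ (k, l))"
        unfolding a[OF kl] sum_distrib_left u_def
        by (simp add: sum_distrib_right mult.assoc sum.swap[of _ Basis])
      also have "\<dots> = (\<Sum>i<n. \<Sum>j<n. if i = k then (if j = l then f b $$ (i, j) else 0) else 0)"
        using kl by (intro sum.cong refl) (auto simp: E_def)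
      also have "\<dots> = (\<Sum>i<n. if i = k then (\<Sum>j<n. if j = l then f b $$ (i, j) else 0) else 0)"
        by (intro sum.cong refl) auto
      also have "\<dots> = f b $$ (k, l)" using kl by (simp add: sum.delta)
      finally show ?thesis by simp
    qed
    moreover have "f b $$ (k, l) = (\<Sum>c\<in>Basis. v c * f c $$ (k, l))" for k l
    proof -
      have "(\<Sum>c\<in>Basis. v c * f c $$ (k, l)) = (\<Sum>c\<in>Basis. if b = c then f c $$ (k, l) else 0)"
        by (intro sum.cong refl) (auto simp: v_def)
      thus ?thesis using b finite_Basis by (simp add: sum.delta)
    qed
    ultimately have "u = v"
      using basis'[OF f(1)[of b]] by (auto simp: u_def v_def)
    hence "u c = v c" by simp
    thus ?thesis using c by (simp add: u_def v_def)
  qed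
  \<comment> \<open>Summing the diagonal of the duality relation counts \<open>Basis\<close> in one
    order and the \<open>n * n\<close> matrix units in the other; characteristic 0 turns this into
    an equality of natural numbers.\<close>
  have "(of_nat N :: 'k alg_closure) = (\<Sum>b\<in>Basis. \<Sum>i<n. \<Sum>j<n. f b $$ (i, j) * a i j b)"
    by (simp add: dual N_def)
  also have "\<dots> = (\<Sum>i<n. \<Sum>j<n. \<Sum>b\<in>Basis. a i j b * f b $$ (i, j))"
    by (simp add: sum.swap[of _ Basis] mult.commute)
  also have "\<dots> = (\<Sum>i<n. \<Sum>j<n. E i j $$ (i, j))" using a by simp
  also have "\<dots> = of_nat (n * n)" by (simp add: E_def)
  finally have "to_ac (of_nat N :: 'k) = to_ac (of_nat (n * n) :: 'k)" by simp
  hence N: "N = n * n" by (simp only: to_ac_eq_iff of_nat_eq_iff)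
  thus "n * n = card Basis" by (simp add: N_def)
  \<comment> \<open>Column \<open>k\<close> is the matrix \<open>f (bs ! k)\<close> stored column
    after column, so row \<open>r\<close> stands for the entry in row \<open>r mod n\<close> and
    column \<open>r div n\<close>.\<close>
  define T where "T = mat N N (\<lambda>(r, k). f (bs ! k) $$ (r mod n, r div n))"
  define T' where "T' = mat N N (\<lambda>(k, r). a (r mod n) (r div n) (bs ! k))"
  have sum_pairs: "(\<Sum>r<n * n. g (r mod n) (r div n)) = (\<Sum>i<n. \<Sum>j<n. g i j)" for g :: "nat \<Rightarrow> nat \<Rightarrow> 'k alg_closure"
  proof -
    have "bij_betw (\<lambda>r. (r mod n, r div n)) {..<n * n} ({..<n} \<times> {..<n})"
    proof (rule bij_betw_byWitness[where f' = "\<lambda>(i, j). j * n + i"])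
      show "(\<lambda>r. (r mod n, r div n)) ` {..<n * n} \<subseteq> {..<n} \<times> {..<n}"
        using n by (auto simp: less_mult_imp_div_less)
      have "j * n + i < n * n" if "i < n" "j < n" for i j
      proof -
        have "j * n + i < Suc j * n" using that by simp
        also have "\<dots> \<le> n * n" using that by (intro mult_right_mono) auto
        finally show ?thesis .
      qed
      thus "(\<lambda>(i, j). j * n + i) ` ({..<n} \<times> {..<n}) \<subseteq> {..<n * n}" by auto
    qed (use n in auto)
    from sum.reindex_bij_betw[OF this, of "\<lambda>(i, j). g i j"] show ?thesis
      by (simp add: sum.cartesian_product)
  qed
  have "T' * T = 1\<^sub>m N"
  proof (rule eq_matI)
    fix k l assume "k < dim_row (1\<^sub>m N)" "l < dim_col (1\<^sub>m N)"
    hence kl: "k < N" "l < N" by auto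
    have "(T' * T) $$ (k, l) = (\<Sum>r<n * n. a (r mod n) (r div n) (bs ! k) * f (bs ! l) $$ (r mod n, r div n))"
      using kl by (simp add: T_def T'_def scalar_prod_def lessThan_atLeast0 N)
    also have "\<dots> = (\<Sum>i<n. \<Sum>j<n. f (bs ! l) $$ (i, j) * a i j (bs ! k))"
      by (subst sum_pairs[of "\<lambda>i j. a i j (bs ! k) * f (bs ! l) $$ (i, j)"]) (simp add: mult.commute)
    also have "\<dots> = (if bs ! l = bs ! k then 1 else 0)"
      using kl by (intro dual bs_nth_Basis) (simp_all add: N_def)
    also have "\<dots> = 1\<^sub>m N $$ (k, l)"
      using kl bs length_bs by (simp add: N_def nth_eq_iff_index_eq)
    finally show "(T' * T) $$ (k, l) = 1\<^sub>m N $$ (k, l)" .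
  qed (simp_all add: T_def T'_def)
  hence "det T' * det T = 1"
    using det_mult[of T' N T] by (simp add: T_def T'_def)
  hence T0: "det T \<noteq> 0" by auto
  have fsum: "f (sum g I) = sum_mat"
    if "sum_mat = mat n n (\<lambda>(i, j). \<Sum>b\<in>I. f (g b) $$ (i, j))" "finite I" for g :: "'d \<Rightarrow> 'd" and I sum_mat
    using that(2) unfolding that(1)
  proof (induction I rule: finite_induct)
    case empty
    have "f 0 = f (smul 0 0)" by simp
    also have "\<dots> = 0\<^sub>m n n" unfolding f(4) using f(1)[of 0] by (intro eq_matI) auto
    finally show ?case by (auto intro!: eq_matI)
  next
    case (insert b I)
    thus ?case using f(1)[of "g b"] by (simp add: f(2)) (intro eq_matI; auto)
  qed
  have "block_diag n n (f x) * T = T * map_mat to_ac (lmat x)"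
  proof (rule eq_matI)
    fix r k assume "r < dim_row (T * map_mat to_ac (lmat x))" "k < dim_col (T * map_mat to_ac (lmat x))"
    hence rk: "r < n * n" "k < n * n" "k < N" "r < N" by (auto simp: T_def lmat_def N[unfolded N_def] N)
    define i j where "i = r mod n" and "j = r div n"
    have ij: "i < n" "j < n" using rk n by (auto simp: i_def j_def less_mult_imp_div_less)
    have "(block_diag n n (f x) * T) $$ (r, k) =
        (\<Sum>s<n * n. (if j = s div n then f x $$ (i, s mod n) else 0) * f (bs ! k) $$ (s mod n, s div n))"
      unfolding i_def j_def using rk by (simp add: block_diag_def T_def N scalar_prod_def lessThan_atLeast0)
    also have "\<dots> = (\<Sum>i'<n. \<Sum>j'<n. (if j = j' then f x $$ (i, i') else 0) * f (bs ! k) $$ (i', j'))"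
      by (rule sum_pairs[of "\<lambda>i' j'. (if j = j' then f x $$ (i, i') else 0) * f (bs ! k) $$ (i', j')"])
    also have "\<dots> = (\<Sum>i'<n. f x $$ (i, i') * f (bs ! k) $$ (i', j))"
    proof (rule sum.cong[OF refl])
      fix i'
      have "(\<Sum>j'<n. (if j = j' then f x $$ (i, i') else 0) * f (bs ! k) $$ (i', j')) =
          (\<Sum>j'<n. if j = j' then f x $$ (i, i') * f (bs ! k) $$ (i', j') else 0)"
        by (intro sum.cong refl) auto
      thus "(\<Sum>j'<n. (if j = j' then f x $$ (i, i') else 0) * f (bs ! k) $$ (i', j')) = f x $$ (i, i') * f (bs ! k) $$ (i', j)"
        using ij by (simp add: sum.delta)
    qed
    also have "\<dots> = (f x * f (bs ! k)) $$ (i, j)"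
      using ij f(1)[of x] f(1)[of "bs ! k"] by (simp add: scalar_prod_def lessThan_atLeast0)
    also have "f x * f (bs ! k) = f (\<Sum>b\<in>Basis. smul (coord (x * bs ! k) b) b)" by (simp add: f(3) coord_expand)
    also have "\<dots> $$ (i, j) = (\<Sum>b\<in>Basis. to_ac (coord (x * bs ! k) b) * f b $$ (i, j))"
      using ij carrier_matD[OF f(1)] by (subst fsum[OF refl finite_Basis]) (simp add: f(4))
    also have "\<dots> = (\<Sum>l<N. f (bs ! l) $$ (i, j) * to_ac (coord (x * bs ! k) (bs ! l)))"
      unfolding N_def by (subst sum_bs[symmetric]) (simp add: mult.commute)
    also have "\<dots> = (T * map_mat to_ac (lmat x)) $$ (r, k)"
      unfolding i_def j_def using rk by (simp add: T_def lmat_def scalar_prod_def lessThan_atLeast0 N_def[symmetric])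
    finally show "(block_diag n n (f x) * T) $$ (r, k) = (T * map_mat to_ac (lmat x)) $$ (r, k)" .
  qed (auto simp: block_diag_def T_def lmat_def N N_def[symmetric])
  hence "det (block_diag n n (f x) * T) = det (T * map_mat to_ac (lmat x))" by simp
  moreover have "det (block_diag n n (f x) * T) = det (f x) ^ n * det T"
    by (subst det_mult[of _ "n * n"]) (auto simp: block_diag_def T_def N det_block_diag[OF f(1) n, unfolded block_diag_def])
  moreover have "det (T * map_mat to_ac (lmat x)) = det T * to_ac (det (lmat x))"
  proof -
    interpret to_ac: comm_ring_hom "to_ac :: 'k \<Rightarrow> 'k alg_closure" by standard auto
    have "det (map_mat to_ac (lmat x)) = to_ac (det (lmat x))" by (rule to_ac.hom_det)
    thus ?thesis by (subst det_mult[of _ N]) (auto simp: T_def lmat_def N_def)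
  qed
  ultimately show "det (f x) ^ n = to_ac (rnorm x)" using T0 by (simp add: rnorm_def)
qed

end

section \<open>Norm one elements near the identity\<close>

context padic_division_algebra
begin

lemma coord_le_nm: "b \<in> Basis \<Longrightarrow> padic_norm (coord x b) \<le> nm x"
  using coord_le_mnorm[of b x] mult_right_mono[OF mult_bound_ge1, of "mnorm x"] by (simp add: nm_def)

text \<open>The linear term \<open>M (a - b)\<close> dominates the remainder, whose norm is at most
  \<open>e * nm (a - b)\<close>, so the power map is injective on \<open>U e\<close>.\<close>

lemma U_root_unique:
  assumes "a \<in> U e" "b \<in> U e" "e < padic_norm (of_nat M :: 'p padic)" "a ^ M = b ^ M"
  shows "a = b"
proof (rule ccontr)
  assume "a \<noteq> b"
  hence pos: "nm (a - b) > 0" by (intro nm_pos) simp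
  have "e \<le> 1" using assms(3) padic_norm_of_nat_le1[of M, where ?'p = 'p] by linarith
  hence "nm (a ^ M - b ^ M - smul (of_nat M) (a - b)) \<le> e * nm (a - b)"
    using assms by (intro power_U_diff)
  hence "padic_norm (of_nat M :: 'p padic) * nm (a - b) \<le> e * nm (a - b)"
    using assms(4) by (simp add: nm_smul)
  thus False using pos assms(3) by simp
qed

text \<open>Stated for any \<open>I\<close> containing \<open>Basis\<close>: with
  \<open>I = Basis\<close> it serves \<open>coord_topology\<close>, with \<open>I = UNIV\<close> the
  continuity notion \<open>cf\<close>. Coordinates outside \<open>Basis\<close> are constantly
  0.\<close>

lemma coord_neighbourhood:
  assumes V: "openin (product_topology (\<lambda>_. euclidean) I) V" and 1: "(\<lambda>b\<in>I. coord 1 b) \<in> V" and I: "Basis \<subseteq> I"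
  shows "\<exists>e>0. \<forall>x\<in>U e. (\<lambda>b\<in>I. coord x b) \<in> V"
proof -
  obtain Z where Z: "(\<lambda>b\<in>I. coord 1 b) \<in> (\<Pi>\<^sub>E b\<in>I. Z b)" "\<And>b. open (Z b)" "(\<Pi>\<^sub>E b\<in>I. Z b) \<subseteq> V"
    using product_topology_open_contains_basis[OF V 1] by auto
  have "\<exists>e>0. \<forall>c. dist c (coord 1 b) < e \<longrightarrow> c \<in> Z b" if "b \<in> Basis" for b
    using Z(1,2) that I unfolding open_dist by (auto simp: PiE_iff)
  then obtain r where r: "\<And>b. b \<in> Basis \<Longrightarrow> r b > 0" "\<And>b c. b \<in> Basis \<Longrightarrow> dist c (coord 1 b) < r b \<Longrightarrow> c \<in> Z b"
    by metis
  define e where "e = Min (r ` Basis) / 2"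
  have Mr: "Min (r ` Basis) > 0" using r(1) finite_Basis Basis_nonempty by simp
  have "(\<lambda>b\<in>I. coord x b) \<in> V" if x: "x \<in> U e" for x
  proof -
    have "coord x b \<in> Z b" if b: "b \<in> I" for b
    proof (cases "b \<in> Basis")
      case True
      have "padic_norm (coord x b - coord 1 b) \<le> e"
        using coord_le_nm[OF True, of "x - 1"] x by (simp add: U_def coord_diff)
      also have "e < Min (r ` Basis)" using Mr by (simp add: e_def)
      also have "\<dots> \<le> r b" using True finite_Basis by simp
      finally show ?thesis using r(2)[OF True] by (simp add: dist_padic_def)
    next
      case False
      hence "coord x b = coord 1 b" using representation_ne_zero by metis
      thus ?thesis using Z(1) b by auto
    qed
    hence "(\<lambda>b\<in>I. coord x b) \<in> (\<Pi>\<^sub>E b\<in>I. Z b)" by auto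
    thus ?thesis using Z(3) by blast
  qed
  thus ?thesis using Mr by (intro exI[of _ e]) (auto simp: e_def)
qed

lemma rnorm_near_1:
  assumes "\<eta> > 0" shows "\<exists>e>0. \<forall>x\<in>U e. padic_norm (rnorm x - 1) < \<eta>"
proof -
  have "open {v. padic_norm (rnorm (elt v) - 1) < \<eta>}"
    using cf_rnorm unfolding cf_def by (intro open_Collect_less continuous_intros)
  hence "openin (product_topology (\<lambda>_. euclidean) UNIV) {v. padic_norm (rnorm (elt v) - 1) < \<eta>}"
    by (simp add: open_fun_def)
  from coord_neighbourhood[OF this] show ?thesis
    using assms by (simp add: elt_coord restrict_def)
qed

end

text \<open>The base field is itself a one-dimensional instance, so existence and uniqueness of
  roots become available for scalars.\<close>

lemma padic_division_algebra_padic: "padic_division_algebra ((*) :: 'p::prime_card padic \<Rightarrow> _) {1}"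
proof -
  interpret V: vector_space "(*) :: 'p padic \<Rightarrow> _" by standard (simp_all add: algebra_simps)
  have "x \<in> V.span {1}" for x :: "'p padic"
    using V.span_scale[OF V.span_base[of 1 "{1}"], of x] by simp
  hence "finite_dimensional_vector_space ((*) :: 'p padic \<Rightarrow> _) {1}"
    by unfold_locales (auto simp: V.dependent_single)
  moreover have "{z :: 'p padic. \<forall>x. z * x = x * z} = range (\<lambda>c. c * 1)"
    by (simp add: mult.commute)
  ultimately have "central_division_algebra ((*) :: 'p padic \<Rightarrow> _) {1}"
    by (intro central_division_algebra.intro central_division_algebra_axioms.intro)
       (simp_all only: mult.assoc mult.left_commute)
  thus ?thesis by (simp add: padic_division_algebra_def central_division_algebra_char_0_def)
qed

lemma nm_padic: "padic_division_algebra.nm (*) {1} (x :: 'p::prime_card padic) = padic_norm x"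
proof -
  interpret padic_division_algebra "(*) :: 'p padic \<Rightarrow> _" "{1}" by (rule padic_division_algebra_padic)
  have c: "coord 1 1 = 1" by (simp add: coord_Basis)
  have "mnorm 1 = 1" unfolding mnorm_def by (simp add: c)
  moreover from this have "mult_bound = 1" unfolding mult_bound_def by simp
  ultimately have "nm 1 = 1" by (simp add: nm_def)
  thus ?thesis using nm_smul[of x 1] by simp
qed

lemma padic_root:
  assumes "padic_norm (c - 1) \<le> e * padic_norm (of_nat M :: 'p::prime_card padic)" "0 \<le> e"
    "e < padic_norm (of_nat M :: 'p padic)"
  obtains v where "padic_norm (v - 1) \<le> e" "v ^ M = (c :: 'p padic)"
proof -
  interpret padic_division_algebra "(*) :: 'p padic \<Rightarrow> _" "{1}" by (rule padic_division_algebra_padic)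
  have "c \<in> U (e * padic_norm (of_nat M :: 'p padic))" using assms(1) by (simp add: U_def nm_padic)
  then obtain v where "v \<in> U e" "v ^ M = c" using assms(2,3) by (rule U_root)
  thus ?thesis by (intro that[of v]) (simp_all add: U_def nm_padic)
qed

lemma padic_root_unique:
  assumes "padic_norm (a - 1) \<le> e" "padic_norm (b - 1) \<le> e" "e < padic_norm (of_nat M :: 'p::prime_card padic)"
    "a ^ M = (b :: 'p padic) ^ M"
  shows "a = b"
proof -
  interpret padic_division_algebra "(*) :: 'p padic \<Rightarrow> _" "{1}" by (rule padic_division_algebra_padic)
  show ?thesis by (rule U_root_unique[of a e b M]) (use assms in \<open>simp_all add: U_def nm_padic\<close>)
qed

context padic_division_algebra
begin

text \<open>\<open>\<mu> x\<close> is the root of \<open>inverse (rnorm x)\<close> of order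
  \<open>card Basis\<close> that lies near 1. Uniqueness of such roots makes \<open>\<mu>\<close>
  multiplicative.\<close>

lemma norm_one_scaling:
  assumes e': "e' > 0"
  shows "\<exists>e \<mu>. 0 < e \<and> e < 1 \<and> (\<forall>x\<in>U e. \<mu> x \<noteq> 0 \<and> rnorm (smul (\<mu> x) x) = 1 \<and> smul (\<mu> x) x \<in> U e') \<and>
     (\<forall>x\<in>U e. \<forall>y\<in>U e. \<mu> (x * y) = \<mu> x * \<mu> y)"
proof -
  define d where "d = card Basis"
  define m where "m = padic_norm (of_nat d :: 'p padic)"
  have "(of_nat d :: 'p padic) \<noteq> 0" using card_Basis_ne_0 by (simp add: d_def)
  hence m: "m > 0" "m \<le> 1"
    using padic_norm_ge0[of "of_nat d :: 'p padic"] padic_norm_eq_0_iff[of "of_nat d :: 'p padic"]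
      padic_norm_of_nat_le1[of d, where ?'p = 'p] unfolding m_def by linarith+
  \<comment> \<open>The first bound makes roots exist and be unique, the second keeps the change
    from \<open>x\<close> to \<open>smul (\<mu> x) x\<close> within \<open>e'\<close>.\<close>
  define e1 where "e1 = min (m / 2) (e' / nm 1)"
  have n1: "nm 1 > 0" using nm_1_ge1 by linarith
  have e1: "e1 > 0" "e1 < m" "e1 < 1" using m e' n1 by (auto simp: e1_def min_less_iff_disj)
  have "e1 \<le> e' / nm 1" by (simp add: e1_def)
  hence e1': "e1 * nm 1 \<le> e'" using n1 by (simp add: pos_le_divide_eq)
  obtain e2 where e2: "e2 > 0" "\<forall>x\<in>U e2. padic_norm (rnorm x - 1) < e1 * m"
    using rnorm_near_1[of "e1 * m"] e1 m by auto
  define e where "e = min e2 (min e' (1 / 2))"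
  have e: "0 < e" "e < 1" "e \<le> e'" "e \<le> e2" using e2 e' by (auto simp: e_def)
  define \<mu> where "\<mu> x = (SOME c. padic_norm (c - 1) \<le> e1 \<and> c ^ d = inverse (rnorm x))" for x
  have mu: "padic_norm (\<mu> x - 1) \<le> e1 \<and> \<mu> x ^ d = inverse (rnorm x)" and r0: "rnorm x \<noteq> 0"
    if x: "x \<in> U e" for x
  proof -
    have n: "padic_norm (rnorm x - 1) < e1 * m" using e2(2) U_mono[OF x e(4)] by blast
    show r0: "rnorm x \<noteq> 0" using x e(2) by (intro rnorm_ne_0 U_ne_0)
    have "e1 * m < 1" using mult_left_le[of m e1] e1 m by linarith
    hence r1: "padic_norm (rnorm x) = 1"
      using padic_norm_unit_ball_add[of "rnorm x - 1"] n by simp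
    have eq: "inverse (rnorm x) - 1 = - (rnorm x - 1) * inverse (rnorm x)"
      using r0 by (simp add: algebra_simps)
    have "padic_norm (inverse (rnorm x) - 1) = padic_norm (rnorm x - 1)"
      unfolding eq padic_norm_mult padic_norm_inverse padic_norm_minus r1 by simp
    then obtain c where "padic_norm (c - 1) \<le> e1" "c ^ d = inverse (rnorm x)"
      using padic_root[of "inverse (rnorm x)" e1 d] n e1 unfolding m_def by (metis less_imp_le)
    thus "padic_norm (\<mu> x - 1) \<le> e1 \<and> \<mu> x ^ d = inverse (rnorm x)"
      unfolding \<mu>_def by (intro someI[where P = "\<lambda>c. padic_norm (c - 1) \<le> e1 \<and> c ^ d = inverse (rnorm x)"]) simp
  qed
  have unit: "padic_norm (\<mu> x) = 1" if "x \<in> U e" for x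
    using padic_norm_unit_ball_add[of "\<mu> x - 1"] mu[OF that] e1 by simp
  have "\<mu> x \<noteq> 0 \<and> rnorm (smul (\<mu> x) x) = 1 \<and> smul (\<mu> x) x \<in> U e'" if x: "x \<in> U e" for x
  proof (intro conjI)
    show "\<mu> x \<noteq> 0" using unit[OF x] by auto
    show "rnorm (smul (\<mu> x) x) = 1" using mu[OF x] r0[OF x] by (simp add: rnorm_smul d_def)
    have "nm (smul (\<mu> x - 1) x) \<le> e1 * nm 1"
      unfolding nm_smul using mu[OF x] nm_U[OF x] e e1 by (intro mult_mono) auto
    moreover have eq: "smul (\<mu> x) x - 1 = smul (\<mu> x - 1) x + (x - 1)" by (simp add: scale_left_diff_distrib)
    ultimately show "smul (\<mu> x) x \<in> U e'"
      unfolding U_def mem_Collect_eq eq using x e(3) e1' by (intro nm_add_le) (auto simp: U_def)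
  qed
  moreover have "\<mu> (x * y) = \<mu> x * \<mu> y" if x: "x \<in> U e" and y: "y \<in> U e" for x y
  proof (rule padic_root_unique)
    have xy: "x * y \<in> U e" using x y e(2) by (intro U_mult) auto
    show "padic_norm (\<mu> (x * y) - 1) \<le> e1" using mu[OF xy] by blast
    show "e1 < padic_norm (of_nat d :: 'p padic)" using e1 by (simp add: m_def)
    show "\<mu> (x * y) ^ d = (\<mu> x * \<mu> y) ^ d"
      using mu[OF x] mu[OF y] mu[OF xy] by (simp add: power_mult_distrib rnorm_mult)
    have eq: "\<mu> x * \<mu> y - 1 = \<mu> x * (\<mu> y - 1) + (\<mu> x - 1)" by (simp add: algebra_simps)
    show "padic_norm (\<mu> x * \<mu> y - 1) \<le> e1"
      unfolding eq using mu[OF x] mu[OF y] unit[OF x]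
      by (intro order.trans[OF padic_norm_ultra]) (simp add: padic_norm_mult)
  qed
  ultimately show ?thesis using e(1,2) by blast
qed

text \<open>An element near 1 is an \<open>n\<close>-th power \<open>v ^ n\<close>, and \<open>det (f (v ^ n)) = rnorm v\<close> for every splitting \<open>f\<close>;
  this makes the reduced norm near 1 independent of the splitting and rational over the base field.\<close>

lemma reduced_norm_eq_1:
  assumes "splitting smul Basis n f"
  shows "\<exists>e>0. \<forall>x\<in>U e. rnorm x = 1 \<longrightarrow> reduced_norm smul Basis x = 1"
proof -
  have nn: "n * n = card Basis" by (rule splitting_det(1)[OF assms])
  define m where "m = padic_norm (of_nat n :: 'p padic)"
  have "n \<noteq> 0" using nn finite_Basis Basis_nonempty by (auto simp: card_eq_0_iff)
  hence m: "m > 0"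
    using padic_norm_ge0[of "of_nat n :: 'p padic"] padic_norm_eq_0_iff[of "of_nat n :: 'p padic"]
    unfolding m_def by (metis of_nat_eq_0_iff less_eq_real_def)
  obtain e2 where e2: "e2 > 0" "\<forall>x\<in>U e2. padic_norm (rnorm x - 1) < m / 2"
    using rnorm_near_1[of "m / 2"] m by auto
  define e1 where "e1 = min (m / 2) e2"
  have e1: "e1 > 0" "e1 < m" "e1 \<le> e2" using m e2 by (auto simp: e1_def)
  have "reduced_norm smul Basis x = 1" if x: "x \<in> U (e1 * m)" and r: "rnorm x = 1" for x
  proof -
    obtain v where v: "v \<in> U e1" "v ^ n = x" using U_root[of x e1 n] x e1 unfolding m_def by auto
    \<comment> \<open>\<open>rnorm v\<close> is a root of unity near 1, hence equal to 1; then every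
      splitting \<open>g\<close> gives
      \<open>det (g x) = det (g v) ^ n = to_ac (rnorm v) = 1\<close>.\<close>
    have "rnorm v ^ n = 1 ^ n" using r v by (simp flip: rnorm_power)
    moreover have "padic_norm (rnorm v - 1) \<le> m / 2" using e2(2) U_mono[OF v(1) e1(3)] by (auto intro: less_imp_le)
    ultimately have rv: "rnorm v = 1" using m by (intro padic_root_unique[of _ "m / 2" 1 n]) (auto simp: m_def)
    have det1: "det (g x) = 1" if sp: "splitting smul Basis k g" for k g
    proof -
      have "k * k = n * n" using splitting_det(1)[OF sp] nn by simp
      hence "k\<^sup>2 = n\<^sup>2" by (simp only: power2_eq_square)
      hence k: "k = n" by simp
      have g: "g y \<in> carrier_mat k k" "g 1 = 1\<^sub>m k" "g (y * z) = g y * g z" for y z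
        using sp by (auto simp: splitting_def)
      have pw: "det (g (v ^ j)) = det (g v) ^ j" for j
        by (induction j) (simp_all add: g det_mult[OF g(1) g(1)])
      show ?thesis using splitting_det(2)[OF sp, of v] pw[of n] k v(2) rv by simp
    qed
    show ?thesis
      unfolding reduced_norm_def
    proof (rule the_equality)
      show "\<exists>n f. splitting smul Basis n f \<and> to_ac 1 = det (f x)" using assms det1 by (metis to_ac_1)
      show "c = 1" if "\<exists>n f. splitting smul Basis n f \<and> to_ac c = det (f x)" for c
        using that det1 by auto
    qed
  qed
  thus ?thesis using e1 m by (intro exI[of _ "e1 * m"]) simp
qed

lemma open_subgroup_scaling:
  assumes 1: "1 \<in> G" and G: "openin (subtopology (coord_topology smul Basis) (carrier (SL1 smul Basis))) G"
  shows "\<exists>e \<mu>. 0 < e \<and> e < 1 \<and> (\<forall>x\<in>U e. \<mu> x \<noteq> 0 \<and> smul (\<mu> x) x \<in> G) \<and>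
     (\<forall>x\<in>U e. \<forall>y\<in>U e. \<mu> (x * y) = \<mu> x * \<mu> y)"
proof -
  obtain T where T: "openin (coord_topology smul Basis) T" "G = T \<inter> carrier (SL1 smul Basis)"
    using G by (auto simp: openin_subtopology)
  obtain V where V: "openin (product_topology (\<lambda>_. euclidean) Basis) V"
    "T = (\<lambda>x. \<lambda>b\<in>Basis. coord x b) -` V \<inter> UNIV"
    using T(1) unfolding coord_topology_def openin_pullback_topology by blast
  have "(\<lambda>b\<in>Basis. coord 1 b) \<in> V" using 1 T(2) V(2) by auto
  then obtain e3 where e3: "e3 > 0" "\<forall>x\<in>U e3. x \<in> T"
    using coord_neighbourhood[OF V(1)] V(2) by auto
  show ?thesis
  proof (cases "\<exists>n f. splitting smul Basis n f")
    case True
    then obtain e4 where e4: "e4 > 0" "\<forall>x\<in>U e4. rnorm x = 1 \<longrightarrow> reduced_norm smul Basis x = 1"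
      using reduced_norm_eq_1 by blast
    have inG: "x \<in> G" if "x \<in> U (min e3 e4)" "rnorm x = 1" for x
    proof -
      have "x \<in> U e3" "x \<in> U e4" using that(1) by (auto simp: U_def)
      thus ?thesis using e3 e4 that(2) T(2) by (auto simp: SL1_def)
    qed
    obtain e \<mu> where "0 < e" "e < 1"
      "\<forall>x\<in>U e. \<mu> x \<noteq> 0 \<and> rnorm (smul (\<mu> x) x) = 1 \<and> smul (\<mu> x) x \<in> U (min e3 e4)"
      "\<forall>x\<in>U e. \<forall>y\<in>U e. \<mu> (x * y) = \<mu> x * \<mu> y"
      using norm_one_scaling[of "min e3 e4"] e3 e4 by auto
    thus ?thesis using inG by (intro exI[of _ e] exI[of _ \<mu>]) auto
  next
    case False
    \<comment> \<open>Without splittings the reduced norm is the constant \<open>THE c. False\<close>, so that \<open>SL1\<close> is everything.\<close>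
    hence const: "reduced_norm smul Basis x = reduced_norm smul Basis y" for x y
      by (simp add: reduced_norm_def)
    have "reduced_norm smul Basis 1 = 1" using 1 T(2) by (simp add: SL1_def)
    hence "carrier (SL1 smul Basis) = UNIV" using const[of _ 1] by (simp add: SL1_def)
    hence "G = T" using T(2) by simp
    moreover have "x \<in> U e3" if "x \<in> U (min e3 (1 / 2))" for x using that by (auto simp: U_def)
    ultimately show ?thesis using e3
      by (intro exI[of _ "min e3 (1 / 2)"] exI[of _ "\<lambda>_. 1"]) auto
  qed
qed

lemma smul_power: "smul c x ^ n = smul (c ^ n) (x ^ n)"
  by (induction n) (simp_all add: smul_mult_left smul_mult_right mult.commute)

lemma not_self_similar:
  assumes noncomm: "\<exists>x y :: 'd. x * y \<noteq> y * x"
    and G: "subgroup G (SL1 smul Basis)"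
    and op: "openin (subtopology (coord_topology smul Basis) (carrier (SL1 smul Basis))) G"
  shows "\<not> self_similar ((SL1 smul Basis)\<lparr>carrier := G\<rparr>)"
proof
  define GG where "GG = (SL1 smul Basis)\<lparr>carrier := G\<rparr>"
  have GG: "carrier GG = G" "x \<otimes>\<^bsub>GG\<^esub> y = x * y" "\<one>\<^bsub>GG\<^esub> = 1" for x y
    by (simp_all add: GG_def SL1_def)
  assume "self_similar ((SL1 smul Basis)\<lparr>carrier := G\<rparr>)"
  then obtain D where D: "D \<ge> 1" "self_similar_of_index GG D" by (auto simp: self_similar_def GG_def)
  obtain H \<theta> where grp: "group GG" and H: "subgroup H GG"
    and pw: "\<And>g. g \<in> carrier GG \<Longrightarrow> g [^]\<^bsub>GG\<^esub> (fact D :: nat) \<in> H"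
    and \<theta>: "\<And>g. g \<in> H \<Longrightarrow> \<theta> g \<in> carrier GG"
    and hom: "\<And>g h. g \<in> H \<Longrightarrow> h \<in> H \<Longrightarrow> \<theta> (g \<otimes>\<^bsub>GG\<^esub> h) = \<theta> g \<otimes>\<^bsub>GG\<^esub> \<theta> h"
    and triv: "\<And>S. S \<subseteq> H \<Longrightarrow> (\<forall>g\<in>carrier GG. \<forall>s\<in>S. g \<otimes>\<^bsub>GG\<^esub> s \<otimes>\<^bsub>GG\<^esub> inv\<^bsub>GG\<^esub> g \<in> S) \<Longrightarrow>
        (\<forall>s\<in>S. \<theta> s \<in> S) \<Longrightarrow> S \<subseteq> {\<one>\<^bsub>GG\<^esub>}"
    by (rule self_similar_virtual_endomorphism[OF D(2,1)]) blast
  interpret GG: group GG by (rule grp)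
  have G0: "g \<noteq> 0" if "g \<in> G" for g
    using GG.r_inv[of g] that by (auto simp: GG)
  have inv: "inv\<^bsub>GG\<^esub> g = inverse g" if "g \<in> G" for g
    using GG.r_inv[of g] that inverse_unique[of g "inv\<^bsub>GG\<^esub> g"] by (simp add: GG)
  have pow: "g [^]\<^bsub>GG\<^esub> (n :: nat) = g ^ n" for g n
    by (induction n) (simp_all add: GG power_commutes)
  have HG: "H \<subseteq> G" using subgroup.subset[OF H] by (simp add: GG)
  have Hm: "x * y \<in> H" if "x \<in> H" "y \<in> H" for x y
    using subgroup.m_closed[OF H that] by (simp add: GG)
  have Hi: "inverse x \<in> H" if "x \<in> H" for x
    using subgroup.m_inv_closed[OF H that] HG that inv by auto
  have H1: "1 \<in> H" using subgroup.one_closed[OF H] by (simp add: GG)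
  have hom': "\<theta> (x * y) = \<theta> x * \<theta> y" if "x \<in> H" "y \<in> H" for x y
    using hom[OF that] by (simp add: GG)
  have \<theta>0: "\<theta> x \<noteq> 0" if "x \<in> H" for x using \<theta>[OF that] G0 by (simp add: GG)
  have \<theta>1: "\<theta> 1 = 1" using hom'[OF H1 H1] \<theta>0[OF H1] by simp
  have \<theta>i: "\<theta> (inverse x) = inverse (\<theta> x)" if x: "x \<in> H" for x
  proof -
    have "\<theta> x * \<theta> (inverse x) = 1"
      using hom'[OF x Hi[OF x]] G0[of x] HG x \<theta>1 by auto
    thus ?thesis by (metis inverse_unique)
  qed
  have "1 \<in> G" using subgroup.one_closed[OF G] by (simp add: SL1_def)
  then obtain e \<mu> where e: "0 < e" "e < 1" and \<mu>: "\<And>x. x \<in> U e \<Longrightarrow> \<mu> x \<noteq> 0 \<and> smul (\<mu> x) x \<in> G"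
    and \<mu>m: "\<And>x y. x \<in> U e \<Longrightarrow> y \<in> U e \<Longrightarrow> \<mu> (x * y) = \<mu> x * \<mu> y"
    using open_subgroup_scaling[OF _ op] by blast
  define M :: nat where "M = fact D"
  define m where "m = padic_norm (of_nat M :: 'p padic)"
  have "M \<noteq> 0" by (simp add: M_def)
  hence m: "m > 0" "m \<le> 1"
    using padic_norm_ge0[of "of_nat M :: 'p padic"] padic_norm_eq_0_iff[of "of_nat M :: 'p padic"]
      padic_norm_of_nat_le1[of M, where ?'p = 'p]
    unfolding m_def by (metis of_nat_eq_0_iff less_eq_real_def, simp)
  define e1 where "e1 = min e (m / 2)"
  have e1: "0 < e1" "e1 < m" "e1 \<le> e" using e m by (auto simp: e1_def)
  define e0 where "e0 = e1 * m"
  have e0: "0 < e0" "e0 \<le> e1" "e0 < 1"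
    using e1 m e by (auto simp: e0_def mult_left_le intro: le_less_trans[OF mult_left_le])
  \<comment> \<open>Near 1, \<open>x = v ^ M\<close>, and multiplicativity of \<open>\<mu>\<close>
    turns \<open>smul (\<mu> x) x\<close> into the \<open>M\<close>-th power of an element of
    \<open>G\<close>; the choice \<open>M = fact D\<close> puts it into \<open>H\<close>.\<close>
  have \<mu>H: "smul (\<mu> x) x \<in> H" if x: "x \<in> U e0" for x
  proof -
    obtain v where v: "v \<in> U e1" "v ^ M = x" using U_root[of x e1 M] x e1 unfolding e0_def m_def by auto
    have ve: "v \<in> U e" using v(1) e1(3) by (rule U_mono)
    have 1: "1 \<in> U e" using e by (simp add: one_in_U)
    have "\<mu> 1 = 1" using \<mu>m[OF 1 1] \<mu>[OF 1] by simp
    hence "\<mu> (v ^ k) = \<mu> v ^ k" for k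
      using e by (induction k) (simp_all add: \<mu>m ve U_power)
    hence "smul (\<mu> x) x = smul (\<mu> v) v ^ M" using v(2) by (simp add: smul_power flip: v(2))
    thus ?thesis using pw[of "smul (\<mu> v) v"] \<mu>[OF ve] by (simp add: GG pow M_def)
  qed
  have Ue: "x \<in> U e" if "x \<in> U e0" for x using that e0 e1 U_mono by (meson order_trans)
  define ph where "ph x = \<theta> (smul (\<mu> x) x)" for x
  have ph_hom: "ph (x * y) = ph x * ph y" if "x \<in> U e0" "y \<in> U e0" for x y
  proof -
    have "smul (\<mu> (x * y)) (x * y) = smul (\<mu> x) x * smul (\<mu> y) y"
      using \<mu>m[of x y] Ue that by (simp add: smul_mult_left smul_mult_right)
    thus ?thesis unfolding ph_def using hom'[OF \<mu>H[OF that(1)] \<mu>H[OF that(2)]] by simp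
  qed
  have ph_ne_0: "ph x \<noteq> 0" if "x \<in> U e0" for x unfolding ph_def by (rule \<theta>0[OF \<mu>H[OF that]])
  obtain S where S: "S \<subseteq> U e0" and Sph: "\<forall>x\<in>S. ph x \<in> S"
    and Sconj: "\<forall>h. h \<noteq> 0 \<longrightarrow> (\<forall>x\<in>S. h * x * inverse h \<in> S)" and Snc: "\<exists>x\<in>S. \<exists>y\<in>S. x * y \<noteq> y * x"
    using invariant_neighbourhood[of e0 ph, OF e0(1,3) ph_hom ph_ne_0 noncomm] by blast
  \<comment> \<open>Elements of \<open>S\<close> need not belong to \<open>G\<close>, but scalars
    cancel in commutators, so these are commutators of elements of \<open>H\<close>.\<close>
  define K where "K = {x * y * inverse x * inverse y | x y. x \<in> S \<and> y \<in> S}"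
  have comm: "x * y * inverse x * inverse y =
      smul (\<mu> x) x * smul (\<mu> y) y * inverse (smul (\<mu> x) x) * inverse (smul (\<mu> y) y)"
    if "x \<in> S" "y \<in> S" for x y
  proof -
    have i: "inverse (smul (\<mu> z) z) = smul (inverse (\<mu> z)) (inverse z)" if "z \<in> S" for z
    proof (rule inverse_unique)
      have "z \<noteq> 0" "\<mu> z \<noteq> 0" using U_ne_0[of z e] \<mu>[of z] Ue S that e by auto
      thus "smul (\<mu> z) z * smul (inverse (\<mu> z)) (inverse z) = 1"
        by (simp add: smul_mult_left smul_mult_right)
    qed
    have "\<mu> x \<noteq> 0" "\<mu> y \<noteq> 0" using \<mu> Ue S that by auto
    hence "inverse (\<mu> y) * (inverse (\<mu> x) * (\<mu> y * \<mu> x)) = 1" by (simp add: field_simps)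
    thus ?thesis unfolding i[OF that(1)] i[OF that(2)] by (simp add: smul_mult_left smul_mult_right)
  qed
  have "K \<subseteq> {\<one>\<^bsub>GG\<^esub>}"
  proof (rule triv)
    show "K \<subseteq> H"
    proof
      fix z assume "z \<in> K"
      then obtain x y where xy: "x \<in> S" "y \<in> S" "z = x * y * inverse x * inverse y" by (auto simp: K_def)
      show "z \<in> H" unfolding xy(3) comm[OF xy(1,2)] using xy S by (intro Hm Hi \<mu>H) auto
    qed
    show "\<forall>s\<in>K. \<theta> s \<in> K"
    proof
      fix z assume "z \<in> K"
      then obtain x y where xy: "x \<in> S" "y \<in> S" "z = x * y * inverse x * inverse y" by (auto simp: K_def)
      have h: "smul (\<mu> x) x \<in> H" "smul (\<mu> y) y \<in> H" using xy S by (auto intro: \<mu>H)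
      have "\<theta> z = ph x * ph y * inverse (ph x) * inverse (ph y)"
        unfolding xy(3) comm[OF xy(1,2)] ph_def using h by (simp add: hom' Hm Hi \<theta>i)
      thus "\<theta> z \<in> K" using Sph xy by (auto simp: K_def)
    qed
    show "\<forall>g\<in>carrier GG. \<forall>s\<in>K. g \<otimes>\<^bsub>GG\<^esub> s \<otimes>\<^bsub>GG\<^esub> inv\<^bsub>GG\<^esub> g \<in> K"
    proof (intro ballI)
      fix g z assume g: "g \<in> carrier GG" and "z \<in> K"
      then obtain x y where xy: "x \<in> S" "y \<in> S" "z = x * y * inverse x * inverse y" by (auto simp: K_def)
      have g0: "g \<noteq> 0" using g G0 by (simp add: GG)
      have nz: "x \<noteq> 0" "y \<noteq> 0" using U_ne_0[of _ e0] xy S e0 by auto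
      define c where "c x = g * x * inverse g" for x
      have cm: "c x * c y = c (x * y)" for x y
      proof -
        have "c x * c y = g * x * (inverse g * g) * y * inverse g" unfolding c_def by (simp only: mult.assoc)
        thus ?thesis using g0 by (simp add: c_def mult.assoc)
      qed
      have ci: "inverse (c x) = c (inverse x)" if "x \<noteq> 0" for x
        using that g0 by (intro inverse_unique) (simp add: cm, simp add: c_def)
      have "g \<otimes>\<^bsub>GG\<^esub> z \<otimes>\<^bsub>GG\<^esub> inv\<^bsub>GG\<^esub> g = c z" using g inv[of g] by (simp add: GG c_def)
      also have "\<dots> = c x * c y * inverse (c x) * inverse (c y)" using nz by (simp add: cm ci xy(3))
      finally show "g \<otimes>\<^bsub>GG\<^esub> z \<otimes>\<^bsub>GG\<^esub> inv\<^bsub>GG\<^esub> g \<in> K"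
        using Sconj g0 xy by (auto simp: K_def c_def)
    qed
  qed
  moreover obtain x y where xy: "x \<in> S" "y \<in> S" "x * y \<noteq> y * x" using Snc by blast
  ultimately have "x * y * inverse x * inverse y = 1" by (auto simp: K_def GG)
  hence "x * y * inverse x * inverse y * (y * x) = y * x" by simp
  moreover have "x \<noteq> 0" "y \<noteq> 0" using U_ne_0[of _ e0] xy S e0 by auto
  ultimately have "x * y = y * x"
    using mult.assoc[of "x * y * inverse x" "inverse y" "y * x"] mult.assoc[of "inverse y" y x]
      mult.assoc[of "x * y" "inverse x" x] by simp
  thus False using xy(3) by blast
qed

end

theorem theoremA:
  fixes smul :: "'p::prime_card padic \<Rightarrow> 'd::division_ring \<Rightarrow> 'd"
    and B :: "'d set" and G :: "'d set"
  assumes "central_division_algebra smul B"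
    and "\<exists>x y :: 'd. x * y \<noteq> y * x"
    and "subgroup G (SL1 smul B)"
    and "openin (subtopology (coord_topology smul B) (carrier (SL1 smul B))) G"
  shows "\<not> self_similar ((SL1 smul B)\<lparr>carrier := G\<rparr>)"
proof -
  interpret padic_division_algebra smul B
    using assms(1) by (simp add: padic_division_algebra_def central_division_algebra_char_0_def)
  show ?thesis by (rule not_self_similar[OF assms(2-4)])
qed

end
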